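(* Let $\mathcal A=\mathbb T^4_\theta$ be the noncommutative 4-torus, regarded as a quantum principal $U(1)$-bundle over a noncommutative 3-torus $\mathcal B$ via $\delta_4$, with flat Dirac operator $D=\sum_{j=1}^4\gamma^j\delta_j$. The only strong connection compatible with $D$ is $\omega=\gamma^4$. Moreover, let $\omega=\gamma^4+\sum_{j=1}^3\gamma^j\omega_j$, with $\omega_j=\omega_j^*\in\mathcal B$, be a selfadjoint strong connection. Then the Dirac operator $$\mathcal D_\omega=D-\sum_{j=1}^3\gamma^jJ\omega_jJ^{-1}\delta_4$$ is compatible with $\omega$.
   Context: $\mathcal A=\mathbb T^4_\theta$ is the smooth algebra of the noncommutative 4-torus, generated by unitaries $U_1,\dots,U_4$ with $U_iU_j=e^{2\pi i\theta_{ij}}U_jU_i$, where $(\theta_{ij})$ is an antisymmetric real matrix with no rational (off-diagonal) entries and no rational relation between them. Derivations: $\delta_i(U_j)=\delta_{ij}U_j$. The $U(1)$-action is generated by $\delta=\delta_4$; $\mathcal A^{(k)}=\{a:\delta_4(a)=ka\}$; $\mathcal B=\mathcal A^{(0)}$ is generated by $U_1,U_2,U_3$. $\mathcal H=\mathcal H_\tau\otimes\mathbb C^4$, $\mathcal H_\tau$ the GNS space of the canonical trace $\tau$; $\mathcal A$ acts on the first factor; $\delta_i$ also denote the selfadjoint operators on $\mathcal H$ (killing the cyclic vector) implementing the derivations; $\mathcal H_k$ is the $k$-eigenspace of $\delta_4$. In $2\times2$ block form, with Pauli matrices $\sigma^j$: $\gamma^4=\begin{pmatrix}1&0\\0&-1\end{pmatrix}$,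 $\gamma^j=\begin{pmatrix}0&i\sigma^j\\-i\sigma^j&0\end{pmatrix}$ ($j=1,2,3$), $\gamma^5=\gamma^1\gamma^2\gamma^3\gamma^4$. Grading $\gamma=\gamma^5$; $J=J_0\otimes(\gamma^4\gamma^2\circ c.c.)$, $J_0$ the Tomita–Takesaki involution and $c.c.$ complex conjugation; $\Gamma=\gamma^4$. The horizontal part of an operator $D'$ is $D'_h=\frac12\Gamma[\Gamma,D']$; in particular $D_h=\sum_{i=1}^3\gamma^i\delta_i$. $\Omega^1_D(\mathcal A)$ (resp. $\Omega^1_D(\mathcal B)$) is the span of $a'[D,a]$ with $a,a'\in\mathcal A$ (resp. $\mathcal B$). A strong connection is $\omega\in\Omega^1_D(\mathcal A)$ with $[\delta_4,\omega]=0$; $\sum_ip_i\delta_4(q_i)=1$ whenever $\omega=\sum_ip_i[D,q_i]$; and $\nabla_\omega(a):=[D,a]-\delta_4(a)\omega\in\Omega^1_D(\mathcal B)\mathcal A$ for all $a\in\mathcal A$. Right actions: $ha:=Ja^*J^{-1}h$; for $b,b'\in\mathcal B$, $h(b'[D,b]):=[D,Jb^*J^{-1}](hb')$ (so $h\eta=-J\eta^*J^{-1}h$ for $\eta\in\Omega^1_D(\mathcal B)$), and $h(\eta a)=(h\eta)a$. The twisted Dirac operator $D_\omega$ is determined on the span of the vectors $ha$ ($h\in\mathcal H_0$ in the domain of $D_h$, $a\in\mathcal A^{(k)}$, $k\in\mathbb Z$) by $D_\omega(ha)=(D_hh)a+h\nabla_\omega(a)$. A Dirac operator $D'$ on $\mathcal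 H$ (having the same restriction of its horizontal part to $\mathcal H_0$ as $D$) is compatible with $\omega$ if $D_\omega$ and $D'_h$ coincide on a dense subset of $\mathcal H$. *)

theory Defs
  imports "HOL-Analysis.Analysis"
begin

section \<open>The Hilbert space\<close>

text \<open>
  The GNS space of the canonical trace has the orthonormal basis of classes of (Weyl ordered)
  monomials in the generators, indexed by \<open>int^4\<close>; see \<open>gns_inner\<close> below.  Its tensor product
  with a four-dimensional space is the space of square-summable spinor-valued families.
\<close>

definition ell2 :: "(int^4 \<Rightarrow> complex^4) \<Rightarrow> bool" where
  "ell2 f \<longleftrightarrow> (\<lambda>n. (norm (f n))\<^sup>2) summable_on UNIV"

lemma ell2_zero: "ell2 (\<lambda>n. 0)"
  by (simp add: ell2_def)

lemma ell2_add:
  assumes "ell2 f" "ell2 g" shows "ell2 (\<lambda>n. f n + g n)"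
proof -
  have "(\<lambda>n. 2 * ((norm (f n))\<^sup>2 + (norm (g n))\<^sup>2)) summable_on UNIV"
    using assms unfolding ell2_def by (intro summable_on_cmult_right summable_on_add)
  then show ?thesis unfolding ell2_def
  proof (rule summable_on_comparison_test)
    fix n
    have "(norm (f n + g n))\<^sup>2 \<le> (norm (f n) + norm (g n))\<^sup>2"
      by (simp add: norm_triangle_ineq power_mono)
    also have "\<dots> \<le> 2 * ((norm (f n))\<^sup>2 + (norm (g n))\<^sup>2)"
      using zero_le_power2[of "norm (f n) - norm (g n)"]
      by (simp add: power2_eq_square algebra_simps)
    finally show "(norm (f n + g n))\<^sup>2 \<le> 2 * ((norm (f n))\<^sup>2 + (norm (g n))\<^sup>2)" .
  qed simp
qed

lemma ell2_bounded:
  assumes "ell2 f" "\<And>n. norm (g n) \<le> C * norm (f n)" shows "ell2 g"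
proof -
  have "(\<lambda>n. C\<^sup>2 * (norm (f n))\<^sup>2) summable_on UNIV"
    using assms(1) unfolding ell2_def by (rule summable_on_cmult_right)
  then show ?thesis unfolding ell2_def
  proof (rule summable_on_comparison_test)
    fix n show "(norm (g n))\<^sup>2 \<le> C\<^sup>2 * (norm (f n))\<^sup>2"
      using power_mono[OF assms(2)[of n], of 2] by (simp add: power_mult_distrib)
  qed simp
qed

lemma ell2_diff:
  assumes "ell2 f" "ell2 g" shows "ell2 (\<lambda>n. f n - g n)"
  using ell2_add[OF assms(1), of "\<lambda>n. - g n"] assms(2) by (simp add: ell2_def)

lemma ell2_inner_summable:
  assumes "ell2 f" "ell2 g" shows "(\<lambda>n. f n \<bullet> g n) summable_on UNIV"
proof -
  have "(\<lambda>n. (norm (f n))\<^sup>2 + (norm (g n))\<^sup>2) summable_on UNIV"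
    using assms unfolding ell2_def by (rule summable_on_add)
  then have "(\<lambda>n. norm (f n \<bullet> g n)) summable_on UNIV"
  proof (rule Infinite_Sum.abs_summable_on_comparison_test')
    fix n
    have "norm (f n \<bullet> g n) \<le> norm (f n) * norm (g n)"
      using Cauchy_Schwarz_ineq2 by simp
    also have "\<dots> \<le> (norm (f n))\<^sup>2 + (norm (g n))\<^sup>2"
    proof -
      have "2 * (norm (f n) * norm (g n)) \<le> (norm (f n))\<^sup>2 + (norm (g n))\<^sup>2"
        using zero_le_power2[of "norm (f n) - norm (g n)"]
        by (simp add: power2_eq_square algebra_simps)
      moreover have "0 \<le> norm (f n) * norm (g n)" by simp
      ultimately show ?thesis by linarith
    qed
    finally show "norm (f n \<bullet> g n) \<le> (norm (f n))\<^sup>2 + (norm (g n))\<^sup>2" .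
  qed
  then show ?thesis using summable_on_iff_abs_summable_on_real by blast
qed

typedef hil = "Collect ell2"
  using ell2_zero by blast

setup_lifting type_definition_hil

instantiation hil :: real_inner
begin

lift_definition zero_hil :: hil is "\<lambda>n. 0" by (simp add: ell2_zero)
lift_definition plus_hil :: "hil \<Rightarrow> hil \<Rightarrow> hil" is "\<lambda>f g n. f n + g n" by (simp add: ell2_add)
lift_definition scaleR_hil :: "real \<Rightarrow> hil \<Rightarrow> hil" is "\<lambda>r f n. r *\<^sub>R f n"
  by (auto intro: ell2_bounded)
lift_definition uminus_hil :: "hil \<Rightarrow> hil" is "\<lambda>f n. - f n"
  by (simp add: ell2_def)
lift_definition minus_hil :: "hil \<Rightarrow> hil \<Rightarrow> hil" is "\<lambda>f g n. f n - g n"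
  by (auto intro: ell2_diff)
lift_definition inner_hil :: "hil \<Rightarrow> hil \<Rightarrow> real" is "\<lambda>f g. \<Sum>\<^sub>\<infinity>n. f n \<bullet> g n" .
definition norm_hil :: "hil \<Rightarrow> real" where "norm_hil f = sqrt (inner f f)"
definition dist_hil :: "hil \<Rightarrow> hil \<Rightarrow> real" where "dist_hil f g = norm (f - g)"
definition sgn_hil :: "hil \<Rightarrow> hil" where "sgn_hil f = inverse (norm f) *\<^sub>R f"
definition uniformity_hil :: "(hil \<times> hil) filter" where
  "uniformity_hil = (INF e\<in>{0<..}. principal {(x, y). dist x y < e})"
definition open_hil :: "hil set \<Rightarrow> bool" where
  "open_hil U = (\<forall>x\<in>U. \<forall>\<^sub>F (x', y) in uniformity. x' = x \<longrightarrow> y \<in> U)"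

instance
proof
  fix x y z :: hil and r s :: real
  show "x + y + z = x + (y + z)" by transfer (simp add: add.assoc)
  show "x + y = y + x" by transfer (simp add: add.commute)
  show "0 + x = x" by transfer simp
  show "- x + x = 0" by transfer simp
  show "x - y = x + - y" by transfer simp
  show "r *\<^sub>R (x + y) = r *\<^sub>R x + r *\<^sub>R y" by transfer (simp add: scaleR_add_right)
  show "(r + s) *\<^sub>R x = r *\<^sub>R x + s *\<^sub>R x" by transfer (simp add: scaleR_add_left)
  show "r *\<^sub>R s *\<^sub>R x = (r * s) *\<^sub>R x" by transfer simp
  show "1 *\<^sub>R x = x" by transfer simp
  show "dist x y = norm (x - y)" by (rule dist_hil_def)
  show "sgn x = inverse (norm x) *\<^sub>R x" by (rule sgn_hil_def)
  show "norm x = sqrt (x \<bullet> x)" by (rule norm_hil_def)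
  show "uniformity = (INF e\<in>{0<..}. principal {(x::hil, y). dist x y < e})"
    by (rule uniformity_hil_def)
  show "open U = (\<forall>x\<in>U. \<forall>\<^sub>F (x', y) in uniformity. x' = x \<longrightarrow> y \<in> U)" for U :: "hil set"
    by (rule open_hil_def)
  show "x \<bullet> y = y \<bullet> x" by transfer (simp add: inner_commute)
  show "(x + y) \<bullet> z = x \<bullet> z + y \<bullet> z"
    by transfer (simp add: inner_add_left infsum_add ell2_inner_summable)
  show "r *\<^sub>R x \<bullet> y = r * (x \<bullet> y)"
    by transfer (simp add: infsum_cmult_right')
  show "0 \<le> x \<bullet> x" by transfer (simp add: infsum_nonneg)
  show "x \<bullet> x = 0 \<longleftrightarrow> x = 0"
  proof transfer
    fix f :: "int^4 \<Rightarrow> complex^4" assume "f \<in> Collect ell2"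
    then have S: "(\<lambda>n. f n \<bullet> f n) summable_on UNIV" by (simp add: ell2_inner_summable)
    show "(\<Sum>\<^sub>\<infinity>n. f n \<bullet> f n) = 0 \<longleftrightarrow> f = (\<lambda>n. 0)"
    proof
      assume "(\<Sum>\<^sub>\<infinity>n. f n \<bullet> f n) = 0"
      then have "f n \<bullet> f n = 0" for n
        using nonneg_infsum_le_0D[of "\<lambda>n. f n \<bullet> f n" UNIV n] S by simp
      then show "f = (\<lambda>n. 0)" by auto
    qed simp
  qed
qed

end

text \<open>Hermitian inner product, antilinear in the first argument.\<close>

definition cinner :: "hil \<Rightarrow> hil \<Rightarrow> complex" where
  "cinner \<psi> \<phi> = (\<Sum>\<^sub>\<infinity>n. \<Sum>i\<in>UNIV. cnj (Rep_hil \<psi> n $ i) * Rep_hil \<phi> n $ i)"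

lift_definition spin_op :: "complex^4^4 \<Rightarrow> hil \<Rightarrow> hil" is "\<lambda>M f n. M *v f n"
proof -
  fix M :: "complex^4^4" and f :: "int^4 \<Rightarrow> complex^4" assume "f \<in> Collect ell2"
  then have "ell2 f" by simp
  then have "ell2 (\<lambda>n. M *v f n)"
    by (rule ell2_bounded[where C = "onorm ((*v) M)"]) (simp add: onorm)
  then show "(\<lambda>n. M *v f n) \<in> Collect ell2" by simp
qed

section \<open>The smooth algebra\<close>

text \<open>
  An element is identified with its coefficient family \<open>a\<close> with respect to the unitaries
  \<open>W n\<close>, where \<open>W n\<close> is \<open>U\<^sub>1^n\<^sub>1 U\<^sub>2^n\<^sub>2 U\<^sub>3^n\<^sub>3 U\<^sub>4^n\<^sub>4\<close> times the phase for which
  \<open>W m * W n = cis (pi * \<theta>(m,n)) * W (m + n)\<close> and \<open>W n\<^sup>* = W (- n)\<close>.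
\<close>

definition smooth :: "(int^4 \<Rightarrow> complex) set" where
  "smooth = {a. \<forall>k::nat. \<exists>C. \<forall>n. (1 + (\<Sum>j\<in>UNIV. \<bar>real_of_int (n $ j)\<bar>)) ^ k * cmod (a n) \<le> C}"

definition theta_form :: "real^4^4 \<Rightarrow> int^4 \<Rightarrow> int^4 \<Rightarrow> real" where
  "theta_form \<theta> m n = (\<Sum>i\<in>UNIV. \<Sum>j\<in>UNIV. of_int (m $ i) * \<theta> $ i $ j * of_int (n $ j))"

definition tmul :: "real^4^4 \<Rightarrow> (int^4 \<Rightarrow> complex) \<Rightarrow> (int^4 \<Rightarrow> complex) \<Rightarrow> int^4 \<Rightarrow> complex" where
  "tmul \<theta> a b n = (\<Sum>\<^sub>\<infinity>m. cis (pi * theta_form \<theta> m (n - m)) * a m * b (n - m))"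

definition tone :: "int^4 \<Rightarrow> complex" where
  "tone n = (if n = 0 then 1 else 0)"

definition star :: "(int^4 \<Rightarrow> complex) \<Rightarrow> int^4 \<Rightarrow> complex" where
  "star a n = cnj (a (- n))"

definition trace :: "(int^4 \<Rightarrow> complex) \<Rightarrow> complex" where
  "trace a = a 0"

definition der :: "4 \<Rightarrow> (int^4 \<Rightarrow> complex) \<Rightarrow> int^4 \<Rightarrow> complex" where
  "der j a n = of_int (n $ j) * a n"

definition gen :: "4 \<Rightarrow> int^4 \<Rightarrow> complex" where
  "gen j n = (if n = axis j 1 then 1 else 0)"

definition homog :: "int \<Rightarrow> (int^4 \<Rightarrow> complex) set" where
  "homog k = {a \<in> smooth. der 4 a = (\<lambda>n. of_int k * a n)}"

abbreviation base :: "(int^4 \<Rightarrow> complex) set" where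
  "base \<equiv> homog 0"

text \<open>
  No off-diagonal entry is rational, and the entries above the diagonal satisfy no nontrivial
  linear relation with rational coefficients.
\<close>

definition generic_theta :: "real^4^4 \<Rightarrow> bool" where
  "generic_theta \<theta> \<longleftrightarrow>
     transpose \<theta> = - \<theta> \<and>
     (\<forall>i j. i \<noteq> j \<longrightarrow> \<theta> $ i $ j \<notin> \<rat>) \<and>
     (\<forall>c :: 4 \<Rightarrow> 4 \<Rightarrow> rat.
        (\<Sum>(i,j)\<in>{(i,j). i < j}. of_rat (c i j) * \<theta> $ i $ j) = 0 \<longrightarrow>
        (\<forall>i j. i < j \<longrightarrow> c i j = 0))"

lemma theta_form_axis: "theta_form \<theta> (axis i 1) (axis j 1) = \<theta> $ i $ j"
proof -
  have "theta_form \<theta> (axis i 1) (axis j 1) =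
      (\<Sum>k\<in>UNIV. \<Sum>l\<in>UNIV. if l = j then (if k = i then \<theta> $ k $ l else 0) else 0)"
    unfolding theta_form_def by (intro sum.cong) (auto simp: axis_def)
  then show ?thesis by simp
qed

lemma tmul_gen_left:
  "tmul \<theta> (gen i) b n = cis (pi * theta_form \<theta> (axis i 1) (n - axis i 1)) * b (n - axis i 1)"
proof -
  have "tmul \<theta> (gen i) b n =
      (\<Sum>\<^sub>\<infinity>m\<in>{axis i 1}. cis (pi * theta_form \<theta> m (n - m)) * gen i m * b (n - m))"
    unfolding tmul_def by (rule infsum_cong_neutral) (auto simp: gen_def)
  then show ?thesis by (simp add: gen_def)
qed

lemma gen_commutation:
  assumes "transpose \<theta> = - \<theta>"
  shows "tmul \<theta> (gen i) (gen j) n = cis (2 * pi * \<theta> $ i $ j) * tmul \<theta> (gen j) (gen i) n"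
proof -
  have "transpose \<theta> $ i $ j = - \<theta> $ i $ j" by (simp add: assms)
  then have skew: "\<theta> $ j $ i = - \<theta> $ i $ j" by (simp add: transpose_def)
  show ?thesis
  proof (cases "n = axis i 1 + axis j 1")
    case True
    then show ?thesis
      by (simp add: tmul_gen_left gen_def theta_form_axis skew cis_mult algebra_simps)
  next
    case False
    then have "n - axis i 1 \<noteq> axis j 1" "n - axis j 1 \<noteq> axis i 1"
      by (metis add.commute diff_add_cancel)+
    then show ?thesis by (simp add: tmul_gen_left gen_def)
  qed
qed

lemma gen_unitary:
  assumes "transpose \<theta> = - \<theta>"
  shows "tmul \<theta> (star (gen j)) (gen j) = tone" "tmul \<theta> (gen j) (star (gen j)) = tone"
proof -
  have "transpose \<theta> $ j $ j = - \<theta> $ j $ j" by (simp add: assms)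
  then have d: "\<theta> $ j $ j = 0" by (simp add: transpose_def)
  have neg: "theta_form \<theta> (- m) n = - theta_form \<theta> m n" "theta_form \<theta> m (- n) = - theta_form \<theta> m n" for m n
    by (simp_all add: theta_form_def sum_negf)
  show "tmul \<theta> (star (gen j)) (gen j) = tone"
  proof
    fix n
    have "tmul \<theta> (star (gen j)) (gen j) n = (\<Sum>\<^sub>\<infinity>m\<in>{- axis j 1}.
        cis (pi * theta_form \<theta> m (n - m)) * star (gen j) m * gen j (n - m))"
      unfolding tmul_def by (rule infsum_cong_neutral) (auto simp: gen_def star_def dest: minus_equation_iff[THEN iffD1])
    then show "tmul \<theta> (star (gen j)) (gen j) n = tone n"
      by (auto simp: gen_def star_def tone_def neg theta_form_axis d)
  qed
  show "tmul \<theta> (gen j) (star (gen j)) = tone"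
  proof
    fix n show "tmul \<theta> (gen j) (star (gen j)) n = tone n"
      by (auto simp: tmul_gen_left gen_def star_def tone_def neg theta_form_axis d)
  qed
qed
lemma der_gen: "der i (gen j) = (\<lambda>n. (if i = j then 1 else 0) * gen j n)"
  by (auto simp: der_def gen_def axis_def)

lemma gns_inner:
  assumes "transpose \<theta> = - \<theta>"
  shows "trace (tmul \<theta> (star a) b) = (\<Sum>\<^sub>\<infinity>n. cnj (a n) * b n)"
proof -
  have skew: "\<theta> $ j $ i = - \<theta> $ i $ j" for i j
  proof -
    have "transpose \<theta> $ i $ j = - \<theta> $ i $ j" by (simp add: assms)
    then show ?thesis by (simp add: transpose_def)
  qed
  have zero: "theta_form \<theta> m (- m) = 0" for m
  proof -
    have "theta_form \<theta> m (- m) =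
        (\<Sum>j\<in>UNIV. \<Sum>i\<in>UNIV. of_int (m $ i) * \<theta> $ i $ j * of_int (- m $ j))"
      unfolding theta_form_def by (subst sum.swap) simp
    also have "\<dots> = - theta_form \<theta> m (- m)"
      unfolding theta_form_def sum_negf[symmetric]
      by (intro sum.cong refl) (subst skew, simp add: mult_ac)
    finally show ?thesis by simp
  qed
  have "trace (tmul \<theta> (star a) b) = (\<Sum>\<^sub>\<infinity>m. cnj (a (- m)) * b (- m))"
    by (simp add: trace_def tmul_def star_def zero)
  also have "\<dots> = (\<Sum>\<^sub>\<infinity>n. cnj (a n) * b n)"
    by (rule infsum_reindex_bij_witness[where i = uminus and j = uminus]) auto
  finally show ?thesis .
qed

section \<open>Operators\<close>

text \<open>
  \<open>Abs_hil\<close> is applied to a square-summable family whenever \<open>a\<close> is smooth.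
\<close>

definition lmult :: "real^4^4 \<Rightarrow> (int^4 \<Rightarrow> complex) \<Rightarrow> hil \<Rightarrow> hil" where
  "lmult \<theta> a \<psi> = Abs_hil (\<lambda>n. \<chi> i. tmul \<theta> a (\<lambda>m. Rep_hil \<psi> m $ i) n)"

definition pauli :: "nat \<Rightarrow> complex^2^2" where
  "pauli j = (if j = 1 then vector [vector [0, 1], vector [1, 0]]
              else if j = 2 then vector [vector [0, - \<i>], vector [\<i>, 0]]
              else vector [vector [1, 0], vector [0, -1]])"

definition block :: "complex^2^2 \<Rightarrow> complex^2^2 \<Rightarrow> complex^2^2 \<Rightarrow> complex^2^2 \<Rightarrow> complex^4^4" where
  "block A B C D = vector
     [vector [A$1$1, A$1$2, B$1$1, B$1$2],
      vector [A$2$1, A$2$2, B$2$1, B$2$2],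
      vector [C$1$1, C$1$2, D$1$1, D$1$2],
      vector [C$2$1, C$2$2, D$2$1, D$2$2]]"

definition gamma :: "4 \<Rightarrow> complex^4^4" where
  "gamma j =
     (if j = 1 then block 0 (mat \<i> ** pauli 1) (- (mat \<i> ** pauli 1)) 0
      else if j = 2 then block 0 (mat \<i> ** pauli 2) (- (mat \<i> ** pauli 2)) 0
      else if j = 3 then block 0 (mat \<i> ** pauli 3) (- (mat \<i> ** pauli 3)) 0
      else block (mat 1) 0 0 (- mat 1))"

lemma vector_4_nth:
  "(vector [a, b, c, d] :: 'a::zero^4) $ 1 = a" "(vector [a, b, c, d] :: 'a::zero^4) $ 2 = b"
  "(vector [a, b, c, d] :: 'a::zero^4) $ 3 = c" "(vector [a, b, c, d] :: 'a::zero^4) $ 4 = d"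
  by (simp_all add: vector_def)

lemma four_neq: "(1::4) \<noteq> 2" "(1::4) \<noteq> 3" "(1::4) \<noteq> 4" "(2::4) \<noteq> 3" "(2::4) \<noteq> 4" "(3::4) \<noteq> 4"
  by simp_all

lemma mat_mult_nth: "(mat z ** A) $ i $ j = z * A $ i $ j" for A :: "complex^'n^'n::finite"
proof -
  have "(mat z ** A) $ i $ j = (\<Sum>k\<in>UNIV. if k = i then z * A $ k $ j else 0)"
    unfolding matrix_matrix_mult_def mat_def vec_lambda_beta by (intro sum.cong) auto
  then show ?thesis by simp
qed

lemma mat_nth: "mat z $ i $ j = (if i = j then z else 0)"
  by (simp add: mat_def)

lemma mult4_nth: "(A ** B) $ i $ j =
    A $ i $ 1 * B $ 1 $ j + A $ i $ 2 * B $ 2 $ j + A $ i $ 3 * B $ 3 $ j + A $ i $ 4 * B $ 4 $ j"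
  for A B :: "complex^4^4"
  by (simp add: matrix_matrix_mult_def sum_4)

lemma gamma_clifford:
  "gamma i ** gamma j + gamma j ** gamma i = (if i = j then mat 2 else 0)"
proof -
  have e: "\<forall>k l. (gamma i ** gamma j + gamma j ** gamma i) $ k $ l = (if i = j then mat 2 else 0) $ k $ l"
    using exhaust_4[of i] exhaust_4[of j]
    by (elim disjE; hypsubst)
      (simp_all add: forall_4 gamma_def block_def pauli_def vector_4_nth mat_mult_nth
        mult4_nth four_neq four_neq[symmetric] mat_nth)
  then show ?thesis by (simp add: vec_eq_iff)
qed

lemma gamma_hermitian: "cnj (gamma j $ k $ l) = gamma j $ l $ k"
proof -
  have "\<forall>k l. cnj (gamma j $ k $ l) = gamma j $ l $ k"
    using exhaust_4[of j]
    by (elim disjE; hypsubst)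
      (simp_all add: forall_4 gamma_def block_def pauli_def vector_4_nth mat_mult_nth mat_nth)
  then show ?thesis by simp
qed

definition grading :: "hil \<Rightarrow> hil" where
  "grading = spin_op (gamma 1 ** gamma 2 ** gamma 3 ** gamma 4)"

abbreviation Gam :: "hil \<Rightarrow> hil" where
  "Gam \<equiv> spin_op (gamma 4)"

text \<open>On the GNS space, the Tomita--Takesaki involution is the extension of \<open>star\<close>.\<close>

lift_definition J :: "hil \<Rightarrow> hil" is
  "\<lambda>f n. (gamma 4 ** gamma 2) *v (\<chi> i. star (\<lambda>m. f m $ i) n)"
proof -
  fix f :: "int^4 \<Rightarrow> complex^4" assume "f \<in> Collect ell2"
  then have f: "ell2 f" by simp
  have "bij_betw uminus (UNIV :: (int^4) set) UNIV"
    by (rule bij_betw_byWitness[where f' = uminus]) auto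
  then have "ell2 (\<lambda>n. f (- n))"
    using f summable_on_reindex_bij_betw[of uminus UNIV UNIV "\<lambda>n. (norm (f n))\<^sup>2"]
    by (simp add: ell2_def)
  then have "ell2 (\<lambda>n. \<chi> i. star (\<lambda>m. f m $ i) n)"
    by (rule ell2_bounded[where C = 1]) (simp add: star_def norm_vec_def)
  then have "ell2 (\<lambda>n. (gamma 4 ** gamma 2) *v (\<chi> i. star (\<lambda>m. f m $ i) n))"
    by (rule ell2_bounded[where C = "onorm ((*v) (gamma 4 ** gamma 2))"]) (simp add: onorm)
  then show "(\<lambda>n. (gamma 4 ** gamma 2) *v (\<chi> i. star (\<lambda>m. f m $ i) n)) \<in> Collect ell2"
    by simp
qed

text \<open>
  Unbounded operators are partial functions, with \<open>dom T\<close> the domain of \<open>T\<close>; a bounded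
  operator \<open>X\<close> composed on the left with \<open>T\<close> is \<open>map_option X \<circ> T\<close>.
\<close>

definition op_sum :: "('i \<Rightarrow> hil \<rightharpoonup> hil) \<Rightarrow> 'i set \<Rightarrow> hil \<rightharpoonup> hil" where
  "op_sum T I \<psi> = (if \<forall>i\<in>I. \<psi> \<in> dom (T i) then Some (\<Sum>i\<in>I. the (T i \<psi>)) else None)"

definition op_diff :: "(hil \<rightharpoonup> hil) \<Rightarrow> (hil \<rightharpoonup> hil) \<Rightarrow> hil \<rightharpoonup> hil" where
  "op_diff S T \<psi> = (if \<psi> \<in> dom S \<and> \<psi> \<in> dom T then Some (the (S \<psi>) - the (T \<psi>)) else None)"

text \<open>Equality of a densely defined operator with its adjoint, domains included.\<close>

definition selfadjoint :: "(hil \<rightharpoonup> hil) \<Rightarrow> bool" where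
  "selfadjoint T \<longleftrightarrow> closure (dom T) = UNIV \<and>
     (\<forall>\<phi> \<xi>. T \<phi> = Some \<xi> \<longleftrightarrow> (\<forall>\<psi> \<kappa>. T \<psi> = Some \<kappa> \<longrightarrow> cinner \<phi> \<kappa> = cinner \<xi> \<psi>))"

definition compact_resolvent :: "(hil \<rightharpoonup> hil) \<Rightarrow> bool" where
  "compact_resolvent T \<longleftrightarrow> (\<exists>z::complex. \<exists>R.
     (\<forall>\<phi> \<psi>. R \<phi> = \<psi> \<longleftrightarrow> (\<exists>\<kappa>. T \<psi> = Some \<kappa> \<and> \<kappa> - spin_op (mat z) \<psi> = \<phi>)) \<and>
     compact (closure (R ` cball 0 1)))"

text \<open>\<open>A\<close> preserves the domain of \<open>T\<close>, and \<open>[T, A]\<close> extends to the bounded operator \<open>X\<close>.\<close>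

definition has_comm :: "(hil \<rightharpoonup> hil) \<Rightarrow> (hil \<Rightarrow> hil) \<Rightarrow> (hil \<Rightarrow> hil) \<Rightarrow> bool" where
  "has_comm T A X \<longleftrightarrow> bounded_linear X \<and>
     (\<forall>\<psi> \<phi>. T \<psi> = Some \<phi> \<longrightarrow> T (A \<psi>) = Some (A \<phi> + X \<psi>))"

definition comm :: "(hil \<rightharpoonup> hil) \<Rightarrow> (hil \<Rightarrow> hil) \<Rightarrow> hil \<Rightarrow> hil" where
  "comm T A = (THE X. has_comm T A X)"

definition delta :: "4 \<Rightarrow> hil \<rightharpoonup> hil" where
  "delta j \<psi> =
     (let f = (\<lambda>n. real_of_int (n $ j) *\<^sub>R Rep_hil \<psi> n) in if ell2 f then Some (Abs_hil f) else None)"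

definition hil_deg :: "int \<Rightarrow> hil set" where
  "hil_deg k = {\<psi>. delta 4 \<psi> = Some (of_int k *\<^sub>R \<psi>)}"

definition flatD :: "hil \<rightharpoonup> hil" where
  "flatD = op_sum (\<lambda>j. map_option (spin_op (gamma j)) \<circ> delta j) {1, 2, 3, 4}"

definition hor :: "(hil \<rightharpoonup> hil) \<Rightarrow> hil \<rightharpoonup> hil" where
  "hor T = map_option (\<lambda>\<phi>. (1/2) *\<^sub>R Gam \<phi>) \<circ> op_diff (map_option Gam \<circ> T) (T \<circ> Gam)"

definition dirac_operator :: "real^4^4 \<Rightarrow> (hil \<rightharpoonup> hil) \<Rightarrow> bool" where
  "dirac_operator \<theta> T \<longleftrightarrow> selfadjoint T \<and> compact_resolvent T \<and>
     (\<forall>a\<in>smooth. \<exists>X. has_comm T (lmult \<theta> a) X) \<and>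
     (\<forall>\<psi> \<phi>. T \<psi> = Some \<phi> \<longrightarrow> T (grading \<psi>) = Some (- grading \<phi>))"

section \<open>One-forms and strong connections\<close>

text \<open>
  Linear spans are taken over finite sums only: all sets of algebra elements used below are
  closed under complex scalars, which are absorbed into the summands.
\<close>

definition form ::
  "real^4^4 \<Rightarrow> ((int^4 \<Rightarrow> complex) \<times> (int^4 \<Rightarrow> complex)) list \<Rightarrow> hil \<Rightarrow> hil" where
  "form \<theta> xs \<psi> = (\<Sum>(p, q)\<leftarrow>xs. lmult \<theta> p (comm flatD (lmult \<theta> q) \<psi>))"

definition Omega1 :: "real^4^4 \<Rightarrow> (int^4 \<Rightarrow> complex) set \<Rightarrow> (hil \<Rightarrow> hil) set" where
  "Omega1 \<theta> C = form \<theta> ` lists (C \<times> C)"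

definition Omega1_base_smooth :: "real^4^4 \<Rightarrow> (hil \<Rightarrow> hil) set" where
  "Omega1_base_smooth \<theta> =
     (\<lambda>xs \<psi>. \<Sum>(\<eta>, a)\<leftarrow>xs. \<eta> (lmult \<theta> a \<psi>)) ` lists (Omega1 \<theta> base \<times> smooth)"

definition nabla :: "real^4^4 \<Rightarrow> (hil \<Rightarrow> hil) \<Rightarrow> (int^4 \<Rightarrow> complex) \<Rightarrow> hil \<Rightarrow> hil" where
  "nabla \<theta> \<omega> a \<psi> = comm flatD (lmult \<theta> a) \<psi> - lmult \<theta> (der 4 a) (\<omega> \<psi>)"

definition strong_connection :: "real^4^4 \<Rightarrow> (hil \<Rightarrow> hil) \<Rightarrow> bool" where
  "strong_connection \<theta> \<omega> \<longleftrightarrow>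
     \<omega> \<in> Omega1 \<theta> smooth \<and>
     has_comm (delta 4) \<omega> (\<lambda>_. 0) \<and>
     (\<forall>xs\<in>lists (smooth \<times> smooth). \<omega> = form \<theta> xs \<longrightarrow>
        (\<lambda>n. \<Sum>(p, q)\<leftarrow>xs. tmul \<theta> p (der 4 q) n) = tone) \<and>
     (\<forall>a\<in>smooth. nabla \<theta> \<omega> a \<in> Omega1_base_smooth \<theta>)"

section \<open>Twisted Dirac operators and compatibility\<close>

definition rmult :: "real^4^4 \<Rightarrow> (int^4 \<Rightarrow> complex) \<Rightarrow> hil \<Rightarrow> hil" where
  "rmult \<theta> a h = J (lmult \<theta> (star a) (inv J h))"

text \<open>
  The vector \<open>h \<zeta>\<close>, determined by \<open>h (b' [D, b] a) = ([D, J b\<^sup>* J\<^sup>-\<^sup>1] (h b')) a\<close> and additivity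
  in \<open>\<zeta>\<close>.
\<close>

definition form_right :: "real^4^4 \<Rightarrow> hil \<Rightarrow> (hil \<Rightarrow> hil) \<Rightarrow> hil" where
  "form_right \<theta> h \<zeta> = (THE v. \<exists>xs\<in>lists (base \<times> base \<times> smooth).
     \<zeta> = (\<lambda>\<psi>. \<Sum>(b', b, a)\<leftarrow>xs. lmult \<theta> b' (comm flatD (lmult \<theta> b) (lmult \<theta> a \<psi>))) \<and>
     v = (\<Sum>(b', b, a)\<leftarrow>xs. rmult \<theta> a (comm flatD (rmult \<theta> b) (rmult \<theta> b' h))))"

definition twisted_dirac :: "real^4^4 \<Rightarrow> (hil \<Rightarrow> hil) \<Rightarrow> hil \<rightharpoonup> hil" where
  "twisted_dirac \<theta> \<omega> \<psi> =
     (let reps = {xs \<in> lists ((hil_deg 0 \<inter> dom (hor flatD)) \<times> (\<Union>k. homog k)).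
                    \<psi> = (\<Sum>(h, a)\<leftarrow>xs. rmult \<theta> a h)}
      in if reps = {} then None
         else Some (THE v. \<exists>xs\<in>reps. v = (\<Sum>(h, a)\<leftarrow>xs.
                rmult \<theta> a (the (hor flatD h)) + form_right \<theta> h (nabla \<theta> \<omega> a))))"

definition compatible :: "real^4^4 \<Rightarrow> (hil \<rightharpoonup> hil) \<Rightarrow> (hil \<Rightarrow> hil) \<Rightarrow> bool" where
  "compatible \<theta> D' \<omega> \<longleftrightarrow>
     dirac_operator \<theta> D' \<and>
     (\<forall>h\<in>hil_deg 0. hor D' h = hor flatD h) \<and>
     (\<exists>S. closure S = UNIV \<and> S \<subseteq> dom (twisted_dirac \<theta> \<omega>) \<and> S \<subseteq> dom (hor D') \<and>
        (\<forall>\<psi>\<in>S. twisted_dirac \<theta> \<omega> \<psi> = hor D' \<psi>))"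

definition connection_form :: "real^4^4 \<Rightarrow> (4 \<Rightarrow> int^4 \<Rightarrow> complex) \<Rightarrow> hil \<Rightarrow> hil" where
  "connection_form \<theta> w \<psi> =
     spin_op (gamma 4) \<psi> + (\<Sum>j\<in>{1, 2, 3}. spin_op (gamma j) (lmult \<theta> (w j) \<psi>))"

definition connection_dirac :: "real^4^4 \<Rightarrow> (4 \<Rightarrow> int^4 \<Rightarrow> complex) \<Rightarrow> hil \<rightharpoonup> hil" where
  "connection_dirac \<theta> w = op_diff flatD
     (op_sum (\<lambda>j. map_option (\<lambda>\<phi>. spin_op (gamma j) (J (lmult \<theta> (w j) (inv J \<phi>)))) \<circ> delta 4)
        {1, 2, 3})"

end

theory Submission
  imports Defs
begin

text \<open>
  Right multiplication by \<open>a\<close> is the twisted convolution for the transposed form, so it is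
  bounded, commutes with left multiplication and with the gamma matrices, and obeys the Leibniz
  rule (\<open>rmult_eq_lmult\<close>, \<open>lmult_commute_opposite\<close>, \<open>delta_lmult\<close>).  One-forms are
  operators \<open>\<Sum>\<^sub>j \<gamma>\<^sup>j c\<^sub>j\<close>, with unique coefficients \<open>c\<^sub>j\<close> in the smooth algebra
  (\<open>one_form_injective\<close>).  Hence a strong connection is \<open>\<omega> = \<gamma>\<^sup>4 + \<Sum>\<^sub>j \<gamma>\<^sup>j \<omega>\<^sub>j\<close> with \<open>\<omega>\<^sub>j\<close> in the
  base algebra, \<open>j\<close> running over the horizontal directions (\<open>strong_connectionD\<close>).

  Write \<open>R\<^sub>j\<close> for the right multiplication by \<open>\<omega>\<^sub>j\<close>.  For \<open>h\<close> of degree zero the Leibniz rule gives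
  \<open>\<delta>\<^sub>j (h a) = (\<delta>\<^sub>j h) a + h \<delta>\<^sub>j(a)\<close> and \<open>\<delta>\<^sub>4 (h a) = h \<delta>\<^sub>4(a)\<close>.  Therefore the twisted Dirac operator
  is, on its whole domain, the restriction of \<open>\<Sum>\<^sub>j \<gamma>\<^sup>j (\<delta>\<^sub>j - R\<^sub>j \<delta>\<^sub>4)\<close> (\<open>twisted_dirac_eq\<close>); the
  domain contains all finitely supported fields, so it is dense.  Compatibility with a Dirac
  operator thus compares its horizontal part with this expression.  For the flat operator it says
  that \<open>(\<Sum>\<^sub>j \<gamma>\<^sup>j R\<^sub>j) \<delta>\<^sub>4\<close> vanishes on a dense set, and this forces all \<open>\<omega>\<^sub>j\<close> to be zero
  (\<open>compatible_flatD_imp_zero\<close>).  For the operator \<open>D - B \<delta>\<^sub>4\<close> with \<open>B = \<Sum>\<^sub>j \<gamma>\<^sup>j R\<^sub>j\<close> the two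
  expressions agree by construction.

  What remains is analytic: \<open>D - B \<delta>\<^sub>4\<close> is selfadjoint with compact resolvent on the domain of
  \<open>D\<close>, although \<open>B \<delta>\<^sub>4\<close> is as unbounded as \<open>D\<close> and \<open>B\<close> need not be small.  The reason is that the
  horizontal part preserves the degree and anticommutes with \<open>\<gamma>\<^sup>4\<close>, so that it cannot cancel the
  vertical part \<open>\<gamma>\<^sup>4 \<delta>\<^sub>4\<close>.  Pairing with \<open>\<gamma>\<^sup>4 \<delta>\<^sub>4 \<psi>\<close> gives
  \<open>\<parallel>\<delta>\<^sub>4 \<psi>\<parallel> \<le> \<parallel>(D - B \<delta>\<^sub>4 - \<i>) \<psi>\<parallel>\<close> (\<open>norm_grad_4_le\<close>), hence the a priori estimate
  \<open>\<parallel>(D - \<i>) \<psi>\<parallel> \<le> (1 + \<parallel>B\<parallel>) \<parallel>(D - B \<delta>\<^sub>4 - \<i>) \<psi>\<parallel>\<close>.  It holds uniformly for \<open>s B\<close>, \<open>0 \<le> s \<le> 1\<close>, and the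
  method of continuity carries surjectivity of \<open>D - \<i>\<close> over to \<open>D - B \<delta>\<^sub>4 - \<i>\<close>.  The grading maps
  this to surjectivity for \<open>- \<i>\<close>, and a symmetric operator with both properties is selfadjoint.
  The estimate also shows that the resolvent maps the unit ball into a set of bounded
  \<open>\<parallel>(D - \<i>) \<psi>\<parallel>\<close>, which is compact (\<open>compact_energy_ball\<close>).  The flat operator is the case \<open>B = 0\<close>.
\<close>

section \<open>Square-summable spinor fields\<close>

lemma ell2_Rep: "ell2 (Rep_hil \<psi>)"
  using Rep_hil by auto

lemma Rep_Abs_hil: "ell2 f \<Longrightarrow> Rep_hil (Abs_hil f) = f"
  by (simp add: Abs_hil_inverse)

lemma hil_eqI: "(\<And>n. Rep_hil \<psi> n = Rep_hil \<phi> n) \<Longrightarrow> \<psi> = \<phi>"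
  by (metis Rep_hil_inject ext)

lemma Rep_hil_sum: "Rep_hil (sum f A) n = (\<Sum>i\<in>A. Rep_hil (f i) n)"
  by (induction A rule: infinite_finite_induct) (simp_all add: zero_hil.rep_eq plus_hil.rep_eq)

lemmas Rep_hil_simps =
  zero_hil.rep_eq plus_hil.rep_eq scaleR_hil.rep_eq uminus_hil.rep_eq minus_hil.rep_eq
  spin_op.rep_eq Rep_hil_sum

lemma inner_hil_has_sum: "((\<lambda>n. Rep_hil \<psi> n \<bullet> Rep_hil \<phi> n) has_sum (\<psi> \<bullet> \<phi>)) UNIV"
  unfolding inner_hil.rep_eq
  by (rule has_sum_infsum[OF ell2_inner_summable[OF ell2_Rep ell2_Rep]])

lemma norm_hil_has_sum: "((\<lambda>n. (norm (Rep_hil \<psi> n))\<^sup>2) has_sum (norm \<psi>)\<^sup>2) UNIV"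
  using inner_hil_has_sum[of \<psi> \<psi>] by (simp add: power2_norm_eq_inner)

lemma sum_norm_le_norm_hil:
  "finite F \<Longrightarrow> (\<Sum>n\<in>F. (norm (Rep_hil \<psi> n))\<^sup>2) \<le> (norm \<psi>)\<^sup>2"
  by (rule finite_sum_le_has_sum[OF norm_hil_has_sum]) auto

lemma norm_Rep_hil_le: "norm (Rep_hil \<psi> n) \<le> norm \<psi>"
  using sum_norm_le_norm_hil[of "{n}" \<psi>] by (simp add: power2_le_iff_abs_le)

lemma norm_hil_leI:
  assumes "\<And>F. finite F \<Longrightarrow> (\<Sum>n\<in>F. (norm (Rep_hil \<psi> n))\<^sup>2) \<le> C\<^sup>2" "0 \<le> C"
  shows "norm \<psi> \<le> C"
proof -
  have "(norm \<psi>)\<^sup>2 \<le> C\<^sup>2"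
    by (rule has_sum_le_finite_sums[OF norm_hil_has_sum]) (use assms(1) in auto)
  then show ?thesis using assms(2) by (rule power2_le_imp_le)
qed

lemma ell2_partial_sumsI:
  assumes "\<And>F. finite F \<Longrightarrow> (\<Sum>n\<in>F. (norm (f n))\<^sup>2) \<le> C"
  shows "ell2 f"
  unfolding ell2_def
  by (rule nonneg_bounded_partial_sums_imp_summable_on[where C = C])
    (use assms in \<open>auto intro: eventually_finite_subsets_at_top_weakI\<close>)

lemma bounded_linear_Rep_hil: "bounded_linear (\<lambda>\<psi>. Rep_hil \<psi> n)"
  by (rule bounded_linear_intro[where K = 1]) (simp_all add: Rep_hil_simps norm_Rep_hil_le)

text \<open>
  The limit is taken coefficientwise; the bound on finite partial sums survives the limit and
  gives square-summability and norm convergence at once.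
\<close>

instance hil :: banach
proof
  fix X :: "nat \<Rightarrow> hil"
  assume C: "Cauchy X"
  have "\<exists>f. \<forall>n. (\<lambda>k. Rep_hil (X k) n) \<longlonglongrightarrow> f n"
    using bounded_linear.Cauchy[OF bounded_linear_Rep_hil C]
    by (meson Cauchy_convergent convergent_LIMSEQ_iff)
  then obtain f where f: "\<And>n. (\<lambda>k. Rep_hil (X k) n) \<longlonglongrightarrow> f n" by blast
  have close: "\<exists>M. \<forall>m\<ge>M. \<forall>F. finite F \<longrightarrow> (\<Sum>n\<in>F. (norm (Rep_hil (X m) n - f n))\<^sup>2) \<le> e\<^sup>2"
    if "e > 0" for e
  proof -
    obtain M where M: "\<And>m k. m \<ge> M \<Longrightarrow> k \<ge> M \<Longrightarrow> norm (X m - X k) < e"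
      using CauchyD[OF C \<open>e > 0\<close>] by blast
    have "(\<Sum>n\<in>F. (norm (Rep_hil (X m) n - f n))\<^sup>2) \<le> e\<^sup>2" if "m \<ge> M" "finite F" for m F
    proof (rule tendsto_upperbound)
      show "(\<lambda>k. \<Sum>n\<in>F. (norm (Rep_hil (X m) n - Rep_hil (X k) n))\<^sup>2) \<longlonglongrightarrow>
          (\<Sum>n\<in>F. (norm (Rep_hil (X m) n - f n))\<^sup>2)"
        by (intro tendsto_intros f)
      show "\<forall>\<^sub>F k in sequentially. (\<Sum>n\<in>F. (norm (Rep_hil (X m) n - Rep_hil (X k) n))\<^sup>2) \<le> e\<^sup>2"
      proof (rule eventually_sequentiallyI[of M])
        fix k assume "k \<ge> M"
        have "(\<Sum>n\<in>F. (norm (Rep_hil (X m) n - Rep_hil (X k) n))\<^sup>2) \<le> (norm (X m - X k))\<^sup>2"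
          using sum_norm_le_norm_hil[OF \<open>finite F\<close>, of "X m - X k"] by (simp add: Rep_hil_simps)
        also have "\<dots> \<le> e\<^sup>2"
          using M[OF \<open>m \<ge> M\<close> \<open>k \<ge> M\<close>] by (simp add: power_mono)
        finally show "(\<Sum>n\<in>F. (norm (Rep_hil (X m) n - Rep_hil (X k) n))\<^sup>2) \<le> e\<^sup>2" .
      qed
    qed simp
    then show ?thesis by blast
  qed
  obtain M where "\<And>F. finite F \<Longrightarrow> (\<Sum>n\<in>F. (norm (Rep_hil (X M) n - f n))\<^sup>2) \<le> 1\<^sup>2"
    using close[of 1] by auto
  then have "ell2 (\<lambda>n. Rep_hil (X M) n - f n)" by (rule ell2_partial_sumsI)
  from ell2_diff[OF ell2_Rep[of "X M"] this] have f2: "ell2 f" by simp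
  have "X \<longlonglongrightarrow> Abs_hil f"
  proof (rule LIMSEQ_I)
    fix r :: real assume "0 < r"
    then obtain M where
      M: "\<And>m F. m \<ge> M \<Longrightarrow> finite F \<Longrightarrow> (\<Sum>n\<in>F. (norm (Rep_hil (X m) n - f n))\<^sup>2) \<le> (r/2)\<^sup>2"
      using close[of "r/2"] by auto
    have "norm (X m - Abs_hil f) \<le> r/2" if "m \<ge> M" for m
      by (rule norm_hil_leI) (use M[OF that] \<open>0 < r\<close> in \<open>simp_all add: Rep_hil_simps Rep_Abs_hil f2\<close>)
    then show "\<exists>no. \<forall>m\<ge>no. norm (X m - Abs_hil f) < r"
      using \<open>0 < r\<close> by (intro exI[of _ M]) force
  qed
  then show "convergent X" by (auto simp: convergent_def)
qed

lift_definition unit_at :: "int^4 \<Rightarrow> complex^4 \<Rightarrow> hil" is "\<lambda>m v n. if n = m then v else 0"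
proof -
  fix m :: "int^4" and v :: "complex^4"
  have "(\<lambda>n. (norm (if n = m then v else 0))\<^sup>2) summable_on UNIV \<longleftrightarrow>
      (\<lambda>n. (norm (if n = m then v else 0))\<^sup>2) summable_on {m}"
    by (rule summable_on_cong_neutral) simp_all
  then have "(\<lambda>n. (norm (if n = m then v else 0))\<^sup>2) summable_on UNIV" by simp
  then show "(\<lambda>n. if n = m then v else 0) \<in> Collect ell2" by (simp add: ell2_def)
qed

lemma Rep_unit_at: "Rep_hil (unit_at m v) n = (if n = m then v else 0)"
  by (simp add: unit_at.rep_eq)

lemma Rep_hil_truncation:
  "finite F \<Longrightarrow> Rep_hil (\<Sum>k\<in>F. unit_at k (f k)) n = (if n \<in> F then f n else 0)"
  by (simp add: Rep_hil_sum Rep_unit_at if_distrib cong: if_cong)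

lemma inner_unit_at: "\<psi> \<bullet> unit_at m v = Rep_hil \<psi> m \<bullet> v"
proof -
  have "((\<lambda>n. Rep_hil \<psi> n \<bullet> Rep_hil (unit_at m v) n) has_sum (Rep_hil \<psi> m \<bullet> v)) UNIV"
    by (rule has_sum_finite_neutralI[of "{m}"]) (auto simp: Rep_unit_at)
  then show ?thesis using has_sum_unique[OF inner_hil_has_sum] by blast
qed

lemma unit_at_has_sum: "((\<lambda>n. unit_at n (Rep_hil \<psi> n)) has_sum \<psi>) UNIV"
proof -
  let ?P = "\<lambda>F. \<Sum>n\<in>F. unit_at n (Rep_hil \<psi> n)"
  have dist: "(norm (?P F - \<psi>))\<^sup>2 = (norm \<psi>)\<^sup>2 - (\<Sum>n\<in>F. (norm (Rep_hil \<psi> n))\<^sup>2)" if "finite F" for F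
  proof -
    have "\<psi> \<bullet> ?P F = (\<Sum>n\<in>F. (norm (Rep_hil \<psi> n))\<^sup>2)"
      by (simp add: inner_sum_right inner_unit_at power2_norm_eq_inner)
    moreover have "?P F \<bullet> ?P F = (\<Sum>n\<in>F. (norm (Rep_hil \<psi> n))\<^sup>2)"
      by (simp add: inner_sum_right[of "?P F"] inner_unit_at Rep_hil_truncation[OF that] power2_norm_eq_inner)
    ultimately show ?thesis
      by (simp add: power2_norm_eq_inner inner_diff_left inner_diff_right inner_commute)
  qed
  have "((\<lambda>F. \<Sum>n\<in>F. (norm (Rep_hil \<psi> n))\<^sup>2) \<longlongrightarrow> (norm \<psi>)\<^sup>2) (finite_subsets_at_top UNIV)"
    using norm_hil_has_sum by (simp add: has_sum_def)
  then have "((\<lambda>F. (norm \<psi>)\<^sup>2 - (\<Sum>n\<in>F. (norm (Rep_hil \<psi> n))\<^sup>2)) \<longlongrightarrow> (norm \<psi>)\<^sup>2 - (norm \<psi>)\<^sup>2)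
      (finite_subsets_at_top UNIV)"
    by (intro tendsto_intros)
  moreover have "\<forall>\<^sub>F F in finite_subsets_at_top UNIV.
      (norm \<psi>)\<^sup>2 - (\<Sum>n\<in>F. (norm (Rep_hil \<psi> n))\<^sup>2) = (norm (?P F - \<psi>))\<^sup>2"
    by (intro eventually_finite_subsets_at_top_weakI) (simp add: dist)
  ultimately have "((\<lambda>F. (norm (?P F - \<psi>))\<^sup>2) \<longlongrightarrow> 0) (finite_subsets_at_top UNIV)"
    by (simp add: tendsto_cong)
  then have "((\<lambda>F. sqrt ((norm (?P F - \<psi>))\<^sup>2)) \<longlongrightarrow> sqrt 0) (finite_subsets_at_top UNIV)"
    by (rule tendsto_real_sqrt)
  then have "((\<lambda>F. ?P F - \<psi>) \<longlongrightarrow> 0) (finite_subsets_at_top UNIV)"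
    by (simp add: tendsto_norm_zero_iff)
  then show ?thesis by (simp add: has_sum_def LIM_zero_iff)
qed

text \<open>
  Identities between bounded operators are checked on fields supported at one lattice point,
  where the convolutions below have a single nonzero term.
\<close>

lemma bounded_linear_eq_on_unit_at:
  fixes f g :: "hil \<Rightarrow> 'b::real_normed_vector"
  assumes "bounded_linear f" "bounded_linear g" "\<And>n v. f (unit_at n v) = g (unit_at n v)"
  shows "f = g"
proof
  fix \<psi>
  have "((\<lambda>n. f (unit_at n (Rep_hil \<psi> n))) has_sum f \<psi>) UNIV"
       "((\<lambda>n. g (unit_at n (Rep_hil \<psi> n))) has_sum g \<psi>) UNIV"
    by (rule has_sum_bounded_linear[OF assms(1) unit_at_has_sum],
        rule has_sum_bounded_linear[OF assms(2) unit_at_has_sum])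
  then show "f \<psi> = g \<psi>" unfolding assms(3) by (rule has_sum_unique)
qed

lemma closure_eq_UNIV_if_truncations:
  assumes "\<And>F f. finite F \<Longrightarrow> (\<Sum>n\<in>F. unit_at n (f n)) \<in> S"
  shows "closure S = UNIV"
proof -
  have "\<psi> \<in> closure S" for \<psi>
  proof (rule Lim_in_closed_set[OF closed_closure])
    show "((\<lambda>F. \<Sum>n\<in>F. unit_at n (Rep_hil \<psi> n)) \<longlongrightarrow> \<psi>) (finite_subsets_at_top UNIV)"
      using unit_at_has_sum by (simp add: has_sum_def)
    show "\<forall>\<^sub>F F in finite_subsets_at_top UNIV. (\<Sum>n\<in>F. unit_at n (Rep_hil \<psi> n)) \<in> closure S"
      using assms closure_subset by (intro eventually_finite_subsets_at_top_weakI) blast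
  qed simp
  then show ?thesis by auto
qed

lemma bounded_linear_eq_on_dense:
  assumes "bounded_linear f" "bounded_linear g" "closure S = UNIV" "\<And>\<psi>. \<psi> \<in> S \<Longrightarrow> f \<psi> = g \<psi>"
  shows "f = g"
proof
  fix \<psi>
  have "bounded_linear (\<lambda>\<psi>. f \<psi> - g \<psi>)" using assms by (intro bounded_linear_sub)
  then have "continuous_on UNIV (\<lambda>\<psi>. f \<psi> - g \<psi>)" by (rule linear_continuous_on)
  then have "f \<psi> - g \<psi> = 0"
    by (intro continuous_constant_on_closure[of S "\<lambda>\<psi>. f \<psi> - g \<psi>" 0 \<psi>]) (use assms in auto)
  then show "f \<psi> = g \<psi>" by simp
qed

section \<open>The method of continuity\<close>

text \<open>
  If \<open>1 - s K\<close> is bounded below uniformly in \<open>s\<close>, its inverse at \<open>s = i / N\<close> is a Lipschitz map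
  with constant \<open>c\<close>, and solving the equation at \<open>(i + 1) / N\<close> is a fixed point problem for a map
  with Lipschitz constant \<open>c \<parallel>K\<parallel> / N < 1\<close>.  So \<open>N\<close> steps lead from the identity to \<open>1 - K\<close>.
\<close>

lemma method_of_continuity:
  fixes K :: "'a::banach \<Rightarrow> 'a"
  assumes K: "bounded_linear K" and "0 \<le> c"
    and bound: "\<And>s x. 0 \<le> s \<Longrightarrow> s \<le> 1 \<Longrightarrow> norm x \<le> c * norm (x - s *\<^sub>R K x)"
  shows "\<exists>x. x - K x = y"
proof -
  interpret K: bounded_linear K by (fact K)
  obtain B where B: "\<And>x. norm (K x) \<le> norm x * B" "0 < B" using K.pos_bounded by blast
  obtain N :: nat where N: "c * B < N" using reals_Archimedean2 by blast
  have "0 < N" using N \<open>0 \<le> c\<close> B(2) by (metis gr0I mult_nonneg_nonneg not_less of_nat_0 order_less_imp_le)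
  have "i \<le> N \<Longrightarrow> \<exists>x. x - (real i / N) *\<^sub>R K x = y" for i y
  proof (induction i arbitrary: y)
    case 0
    show ?case by simp
  next
    case (Suc i)
    let ?S = "\<lambda>x. x - (real i / N) *\<^sub>R K x"
    define V where "V = (\<lambda>y. SOME x. ?S x = y)"
    have SV: "?S (V y) = y" for y
      unfolding V_def by (rule someI_ex) (use Suc in simp)
    have V: "norm (V y - V z) \<le> c * norm (y - z)" for y z
    proof -
      have "norm (V y - V z) \<le> c * norm ((V y - V z) - (real i / N) *\<^sub>R K (V y - V z))"
        using Suc.prems \<open>0 < N\<close> by (intro bound) auto
      also have "(V y - V z) - (real i / N) *\<^sub>R K (V y - V z) = ?S (V y) - ?S (V z)"
        by (simp add: K.diff algebra_simps)
      finally show ?thesis by (simp only: SV)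
    qed
    let ?\<Phi> = "\<lambda>x. V (y + (1 / N) *\<^sub>R K x)"
    have "\<exists>!x. ?\<Phi> x = x"
    proof (rule banach_fix_type)
      show "0 \<le> c * B / N" "c * B / N < 1" using N \<open>0 \<le> c\<close> B(2) \<open>0 < N\<close> by auto
      show "\<forall>x z. dist (?\<Phi> x) (?\<Phi> z) \<le> c * B / N * dist x z"
      proof (intro allI)
        fix x z
        have "dist (?\<Phi> x) (?\<Phi> z) \<le> c * norm ((1 / N) *\<^sub>R K (x - z))"
          using V[of "y + (1 / N) *\<^sub>R K x" "y + (1 / N) *\<^sub>R K z"]
          by (simp add: dist_norm K.diff scaleR_diff_right)
        also have "\<dots> \<le> c * ((norm (x - z) * B) / N)"
          using B(1)[of "x - z"] \<open>0 \<le> c\<close> by (intro mult_left_mono) (simp_all add: divide_right_mono)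
        finally show "dist (?\<Phi> x) (?\<Phi> z) \<le> c * B / N * dist x z"
          by (simp add: dist_norm mult_ac)
      qed
    qed
    then obtain x where "V (y + (1 / N) *\<^sub>R K x) = x" by blast
    then have "?S x = y + (1 / N) *\<^sub>R K x" using SV by metis
    then have "x - (real (Suc i) / N) *\<^sub>R K x = y"
      by (simp add: add_divide_distrib scaleR_add_left algebra_simps)
    then show ?case by blast
  qed
  from this[of N] show ?thesis using \<open>0 < N\<close> by simp
qed

section \<open>Rapidly decreasing coefficient families\<close>

definition weight :: "int^4 \<Rightarrow> real" where
  "weight n = 1 + (\<Sum>j\<in>UNIV. \<bar>real_of_int (n $ j)\<bar>)"

lemma smooth_iff: "a \<in> smooth \<longleftrightarrow> (\<forall>k. \<exists>C. \<forall>n. weight n ^ k * cmod (a n) \<le> C)"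
  by (simp add: smooth_def weight_def)

lemma smoothD: "a \<in> smooth \<Longrightarrow> \<exists>C. \<forall>n. weight n ^ k * cmod (a n) \<le> C"
  by (simp add: smooth_iff)

lemma weight_ge_1: "1 \<le> weight n"
  by (simp add: weight_def sum_nonneg)

lemma weight_pos: "0 < weight n"
  using weight_ge_1[of n] by linarith

lemma weight_component: "1 + \<bar>real_of_int (n $ j)\<bar> \<le> weight n"
  using member_le_sum[of j UNIV "\<lambda>j. \<bar>real_of_int (n $ j)\<bar>"] by (simp add: weight_def)

lemma weight_uminus: "weight (- n) = weight n"
  by (simp add: weight_def)

lemma weight_add: "weight (m + n) \<le> weight m * weight n"
proof -
  have "weight (m + n) \<le> 1 + ((\<Sum>j\<in>UNIV. \<bar>real_of_int (m $ j)\<bar>) + (\<Sum>j\<in>UNIV. \<bar>real_of_int (n $ j)\<bar>))"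
    unfolding weight_def sum.distrib[symmetric] by (intro add_left_mono sum_mono) simp
  also have "\<dots> \<le> weight m * weight n"
    unfolding weight_def by (simp add: algebra_simps sum_nonneg)
  finally show ?thesis .
qed

lemma summable_inverse_square_int: "(\<lambda>k::int. 1 / (1 + \<bar>real_of_int k\<bar>)\<^sup>2) summable_on UNIV"
proof -
  let ?g = "\<lambda>k::int. 1 / (1 + \<bar>real_of_int k\<bar>)\<^sup>2"
  have "summable (\<lambda>n. inverse (real (Suc n) ^ 2))"
    using inverse_power_summable[of 2, where 'a = real] by (subst summable_Suc_iff) simp
  then have "summable (\<lambda>n::nat. 1 / (1 + real n)\<^sup>2)"
    by (simp add: inverse_eq_divide)
  then have S: "(\<lambda>n::nat. 1 / (1 + real n)\<^sup>2) summable_on UNIV"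
    by (subst summable_on_UNIV_nonneg_real_iff) auto
  have "?g summable_on range int"
    using S by (subst summable_on_reindex) (auto simp: o_def)
  moreover have "?g summable_on range (\<lambda>n. - int n)"
    using S by (subst summable_on_reindex) (auto simp: o_def inj_on_def)
  ultimately have "?g summable_on (range int \<union> range (\<lambda>n. - int n))"
    by (rule summable_on_union)
  moreover have "range int \<union> range (\<lambda>n. - int n) = UNIV" (is "?R = UNIV")
  proof -
    have "k \<in> ?R" for k by (cases k rule: int_cases2) auto
    then show ?thesis by auto
  qed
  ultimately show ?thesis by simp
qed

text \<open>
  The weight to the eighth power dominates the product over the four coordinates of
  \<open>(1 + \<bar>n\<^sub>j\<bar>)\<^sup>2\<close>, whose reciprocal is summable because it factorises.
\<close>

lemma summable_weight: "(\<lambda>n. 1 / weight n ^ 8) summable_on UNIV"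
proof -
  define g where "g = (\<lambda>k::int. 1 / (1 + \<bar>real_of_int k\<bar>)\<^sup>2)"
  have g: "g summable_on UNIV" "\<And>k. 0 \<le> g k"
    unfolding g_def using summable_inverse_square_int by auto
  have le: "1 / weight n ^ 8 \<le> (\<Prod>j\<in>UNIV. g (n $ j))" for n :: "int^4"
  proof -
    have "(\<Prod>j\<in>UNIV. (1 + \<bar>real_of_int (n $ j)\<bar>)\<^sup>2) \<le> (\<Prod>j\<in>(UNIV::4 set). (weight n)\<^sup>2)"
      by (intro prod_mono conjI power_mono weight_component) auto
    also have "\<dots> = weight n ^ 8" by (simp flip: power_mult)
    finally have "(\<Prod>j\<in>UNIV. (1 + \<bar>real_of_int (n $ j)\<bar>)\<^sup>2) \<le> weight n ^ 8" .
    moreover have "0 < (\<Prod>j\<in>UNIV. (1 + \<bar>real_of_int (n $ j)\<bar>)\<^sup>2)"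
      by (intro prod_pos zero_less_power) (simp add: add_pos_nonneg)
    ultimately have "1 / weight n ^ 8 \<le> 1 / (\<Prod>j\<in>UNIV. (1 + \<bar>real_of_int (n $ j)\<bar>)\<^sup>2)"
      by (intro divide_left_mono mult_pos_pos) (auto simp: weight_pos)
    then show ?thesis by (simp add: g_def prod_dividef)
  qed
  define M where "M = (\<Sum>\<^sub>\<infinity>k. g k)"
  have "(\<Sum>n\<in>F. 1 / weight n ^ 8) \<le> M ^ 4" if "finite F" for F :: "(int^4) set"
  proof -
    let ?B = "\<lambda>j. (\<lambda>n. n $ j) ` F"
    have "(\<Sum>n\<in>F. 1 / weight n ^ 8) \<le> (\<Sum>n\<in>F. \<Prod>j\<in>UNIV. g (n $ j))"
      by (intro sum_mono le)
    also have "\<dots> = (\<Sum>f\<in>vec_nth ` F. \<Prod>j\<in>UNIV. g (f j))"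
      by (subst sum.reindex) (auto simp: inj_on_def vec_nth_inject)
    also have "\<dots> \<le> (\<Sum>f\<in>PiE UNIV ?B. \<Prod>j\<in>UNIV. g (f j))"
      by (intro sum_mono2 finite_PiE prod_nonneg) (auto simp: that g)
    also have "\<dots> = (\<Prod>j\<in>UNIV. \<Sum>k\<in>?B j. g k)"
      by (rule prod_sum_PiE[symmetric]) (auto simp: that)
    also have "\<dots> \<le> (\<Prod>j\<in>(UNIV::4 set). M)"
      unfolding M_def using that g by (intro prod_mono conjI sum_nonneg finite_sum_le_infsum) auto
    finally show ?thesis by simp
  qed
  then show ?thesis
    by (intro nonneg_bounded_partial_sums_imp_summable_on[where C = "M ^ 4"]
        eventually_finite_subsets_at_top_weakI) (auto simp: weight_pos less_imp_le)
qed

abbreviation abs_summable :: "(int^4 \<Rightarrow> complex) \<Rightarrow> bool" where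
  "abs_summable a \<equiv> (\<lambda>n. cmod (a n)) summable_on UNIV"

lemma smooth_abs_summable: assumes "a \<in> smooth" shows "abs_summable a"
proof -
  obtain C where C: "\<And>n. weight n ^ 8 * cmod (a n) \<le> C" using smoothD[OF assms, of 8] by blast
  have "(\<lambda>n. C * (1 / weight n ^ 8)) summable_on UNIV"
    by (intro summable_on_cmult_right summable_weight)
  then show ?thesis
  proof (rule Infinite_Sum.abs_summable_on_comparison_test')
    fix n
    show "cmod (a n) \<le> C * (1 / weight n ^ 8)"
      using C[of n] zero_less_power[OF weight_pos[of n], of 8] by (simp add: pos_le_divide_eq mult.commute)
  qed
qed

lemma bij_uminus: "bij_betw uminus (UNIV :: (int^4) set) UNIV"
  by (rule bij_betw_byWitness[where f' = uminus]) auto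

lemma abs_summable_star: "abs_summable a \<Longrightarrow> abs_summable (star a)"
  using summable_on_reindex_bij_betw[OF bij_uminus, of "\<lambda>n. cmod (a n)"] by (simp add: star_def)

lemma smooth_bounded:
  assumes a: "a \<in> smooth" and le: "\<And>n. cmod (b n) \<le> B * weight n ^ p * cmod (a n)" and "0 \<le> B"
  shows "b \<in> smooth"
  unfolding smooth_iff
proof
  fix k
  obtain C where C: "\<And>n. weight n ^ (k + p) * cmod (a n) \<le> C" using smoothD[OF a, of "k + p"] by blast
  have "weight n ^ k * cmod (b n) \<le> B * C" for n
  proof -
    have "weight n ^ k * cmod (b n) \<le> weight n ^ k * (B * weight n ^ p * cmod (a n))"
      using le weight_pos[of n] by (intro mult_left_mono) auto
    also have "\<dots> = B * (weight n ^ (k + p) * cmod (a n))" by (simp add: power_add)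
    also have "\<dots> \<le> B * C" using C \<open>0 \<le> B\<close> by (intro mult_left_mono)
    finally show ?thesis .
  qed
  then show "\<exists>C. \<forall>n. weight n ^ k * cmod (b n) \<le> C" by blast
qed

lemma smooth_zero: "(\<lambda>n. 0) \<in> smooth"
  by (auto simp: smooth_iff)

lemma smooth_add: assumes "a \<in> smooth" "b \<in> smooth" shows "(\<lambda>n. a n + b n) \<in> smooth"
  unfolding smooth_iff
proof
  fix k
  obtain C D where C: "\<And>n. weight n ^ k * cmod (a n) \<le> C" and D: "\<And>n. weight n ^ k * cmod (b n) \<le> D"
    using smoothD[OF assms(1), of k] smoothD[OF assms(2), of k] by blast
  have "weight n ^ k * cmod (a n + b n) \<le> C + D" for n
  proof -
    have "weight n ^ k * cmod (a n + b n) \<le> weight n ^ k * (cmod (a n) + cmod (b n))"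
      using weight_pos[of n] by (intro mult_left_mono norm_triangle_ineq) auto
    then show ?thesis using C[of n] D[of n] by (simp add: algebra_simps)
  qed
  then show "\<exists>C. \<forall>n. weight n ^ k * cmod (a n + b n) \<le> C" by blast
qed

lemma smooth_cmult: "a \<in> smooth \<Longrightarrow> (\<lambda>n. c * a n) \<in> smooth"
  by (rule smooth_bounded[of a _ "cmod c" 0]) (simp_all add: norm_mult)

lemma smooth_diff: "a \<in> smooth \<Longrightarrow> b \<in> smooth \<Longrightarrow> (\<lambda>n. a n - b n) \<in> smooth"
  using smooth_add[of a "\<lambda>n. (-1) * b n"] smooth_cmult[of b "-1"] by simp

lemma smooth_sum_list:
  "(\<And>x. x \<in> set xs \<Longrightarrow> f x \<in> smooth) \<Longrightarrow> (\<lambda>n. \<Sum>x\<leftarrow>xs. f x n) \<in> smooth"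
  by (induction xs) (auto simp: smooth_zero smooth_add)

lemma smooth_der: assumes "a \<in> smooth" shows "der j a \<in> smooth"
proof (rule smooth_bounded[OF assms, of _ 1 1])
  fix n
  have "\<bar>real_of_int (n $ j)\<bar> \<le> weight n" using weight_component[of n j] by simp
  then show "cmod (der j a n) \<le> 1 * weight n ^ 1 * cmod (a n)"
    by (simp add: der_def norm_mult mult_right_mono)
qed simp

lemma smooth_star: assumes "a \<in> smooth" shows "star a \<in> smooth"
  unfolding smooth_iff
proof
  fix k
  obtain C where C: "\<And>n. weight n ^ k * cmod (a n) \<le> C" using smoothD[OF assms, of k] by blast
  have "weight n ^ k * cmod (star a n) \<le> C" for n
    using C[of "- n"] by (simp add: star_def weight_uminus)
  then show "\<exists>C. \<forall>n. weight n ^ k * cmod (star a n) \<le> C" by blast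
qed

definition monomial :: "int^4 \<Rightarrow> int^4 \<Rightarrow> complex" where
  "monomial m n = (if n = m then 1 else 0)"

lemma smooth_monomial: "monomial m \<in> smooth"
  unfolding smooth_iff
proof
  fix k
  have "weight n ^ k * cmod (monomial m n) \<le> weight m ^ k" for n
    using weight_pos[of m] by (simp add: monomial_def)
  then show "\<exists>C. \<forall>n. weight n ^ k * cmod (monomial m n) \<le> C" by blast
qed

lemma tone_eq_monomial: "tone = monomial 0"
  by (simp add: fun_eq_iff tone_def monomial_def)

lemma gen_eq_monomial: "gen j = monomial (axis j 1)"
  by (simp add: fun_eq_iff gen_def monomial_def)

text \<open>
  The weight is submultiplicative, so a power of it at \<open>n\<close> distributes over the factors at \<open>m\<close>
  and \<open>n - m\<close>: one factor stays bounded and the other one summable.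
\<close>

lemma smooth_tmul: assumes "a \<in> smooth" "b \<in> smooth" shows "tmul \<theta> a b \<in> smooth"
  unfolding smooth_iff
proof
  fix k
  obtain C where C: "\<And>n. weight n ^ k * cmod (b n) \<le> C" using smoothD[OF assms(2), of k] by blast
  have "(\<lambda>m. of_real (weight m ^ k) * a m) \<in> smooth"
    by (rule smooth_bounded[OF assms(1), of _ 1 k]) (simp_all add: norm_mult weight_pos less_imp_le norm_power)
  then have "abs_summable (\<lambda>m. of_real (weight m ^ k) * a m)" by (rule smooth_abs_summable)
  then have wa: "(\<lambda>m. C * (weight m ^ k * cmod (a m))) summable_on UNIV"
    by (intro summable_on_cmult_right) (simp add: norm_mult norm_power weight_pos less_imp_le)
  have "weight n ^ k * cmod (tmul \<theta> a b n) \<le> (\<Sum>\<^sub>\<infinity>m. C * (weight m ^ k * cmod (a m)))" for n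
  proof -
    let ?f = "\<lambda>m. of_real (weight n ^ k) * (cis (pi * theta_form \<theta> m (n - m)) * a m * b (n - m))"
    have le: "norm (?f m) \<le> C * (weight m ^ k * cmod (a m))" for m
    proof -
      have "norm (?f m) = weight n ^ k * (cmod (a m) * cmod (b (n - m)))"
        by (simp add: norm_mult norm_power weight_pos less_imp_le)
      also have "\<dots> \<le> (weight m * weight (n - m)) ^ k * (cmod (a m) * cmod (b (n - m)))"
        using weight_add[of m "n - m"] weight_pos[of n]
        by (intro mult_right_mono power_mono) (auto simp: less_imp_le)
      also have "\<dots> = (weight (n - m) ^ k * cmod (b (n - m))) * (weight m ^ k * cmod (a m))"
        by (simp add: power_mult_distrib mult_ac)
      also have "\<dots> \<le> C * (weight m ^ k * cmod (a m))"
        by (intro mult_right_mono C) (simp add: weight_pos less_imp_le)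
      finally show ?thesis .
    qed
    have s: "(\<lambda>m. norm (?f m)) summable_on UNIV"
      by (rule Infinite_Sum.abs_summable_on_comparison_test'[OF wa le])
    have "weight n ^ k * cmod (tmul \<theta> a b n) = norm (of_real (weight n ^ k) * tmul \<theta> a b n)"
      by (simp add: norm_mult norm_power weight_pos less_imp_le)
    also have "of_real (weight n ^ k) * tmul \<theta> a b n = (\<Sum>\<^sub>\<infinity>m. ?f m)"
      unfolding tmul_def by (simp add: infsum_cmult_right')
    also have "norm \<dots> \<le> (\<Sum>\<^sub>\<infinity>m. norm (?f m))" by (rule norm_infsum_bound[OF s])
    also have "\<dots> \<le> (\<Sum>\<^sub>\<infinity>m. C * (weight m ^ k * cmod (a m)))"
      by (rule infsum_mono[OF s wa le])
    finally show ?thesis .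
  qed
  then show "\<exists>C. \<forall>n. weight n ^ k * cmod (tmul \<theta> a b n) \<le> C" by blast
qed

lemma der_4_eq_iff: "der 4 a = (\<lambda>n. of_int k * a n) \<longleftrightarrow> (\<forall>n. n $ 4 \<noteq> k \<longrightarrow> a n = 0)"
  by (auto simp: der_def fun_eq_iff)

lemma homog_iff: "a \<in> homog k \<longleftrightarrow> a \<in> smooth \<and> (\<forall>n. n $ 4 \<noteq> k \<longrightarrow> a n = 0)"
  by (simp add: homog_def der_4_eq_iff)

lemma homog_smooth: "a \<in> homog k \<Longrightarrow> a \<in> smooth"
  by (simp add: homog_iff)

lemma monomial_homog: "monomial m \<in> homog (m $ 4)"
  by (auto simp: homog_iff smooth_monomial monomial_def)

section \<open>The bilinear phase\<close>

lemma theta_form_add_left: "theta_form \<theta> (m + m') n = theta_form \<theta> m n + theta_form \<theta> m' n"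
  by (simp add: theta_form_def algebra_simps sum.distrib)

lemma theta_form_add_right: "theta_form \<theta> m (n + n') = theta_form \<theta> m n + theta_form \<theta> m n'"
  by (simp add: theta_form_def algebra_simps sum.distrib)

lemma theta_form_uminus_left: "theta_form \<theta> (- m) n = - theta_form \<theta> m n"
  by (simp add: theta_form_def sum_negf)

lemma theta_form_uminus_right: "theta_form \<theta> m (- n) = - theta_form \<theta> m n"
  by (simp add: theta_form_def sum_negf)

lemma theta_form_diff_left: "theta_form \<theta> (m - m') n = theta_form \<theta> m n - theta_form \<theta> m' n"
  using theta_form_add_left[of \<theta> m "- m'" n] by (simp add: theta_form_uminus_left)

lemma theta_form_diff_right: "theta_form \<theta> m (n - n') = theta_form \<theta> m n - theta_form \<theta> m n'"
  using theta_form_add_right[of \<theta> m n "- n'"] by (simp add: theta_form_uminus_right)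

lemma theta_form_zero_left: "theta_form \<theta> 0 n = 0"
  by (simp add: theta_form_def)

lemma theta_form_zero_right: "theta_form \<theta> n 0 = 0"
  by (simp add: theta_form_def)

lemma theta_form_transpose: "theta_form (transpose \<theta>) m n = theta_form \<theta> n m"
  unfolding theta_form_def transpose_def
  by (subst sum.swap) (simp add: mult_ac)

lemma theta_form_skew:
  assumes "transpose \<theta> = - \<theta>" shows "theta_form \<theta> n m = - theta_form \<theta> m n"
  using theta_form_transpose[of \<theta> m n] by (simp add: assms theta_form_def sum_negf)

lemmas theta_form_simps =
  theta_form_add_left theta_form_add_right theta_form_diff_left theta_form_diff_right
  theta_form_uminus_left theta_form_uminus_right theta_form_zero_left theta_form_zero_right

section \<open>Twisted convolution operators\<close>

lemma scaleR_eq_smult: "r *\<^sub>R (v::complex^4) = complex_of_real r *s v"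
  by (simp add: vec_eq_iff) (simp add: scaleR_conv_of_real)

lemma norm_smult: "norm (c *s (v::complex^4)) = cmod c * norm v"
  by (simp add: norm_vec_def norm_mult L2_set_right_distrib)

lemma matrix_vector_scaleR: "(M::complex^4^4) *v (r *\<^sub>R v) = r *\<^sub>R (M *v v)"
  by (simp add: scaleR_eq_smult vector_scalar_commute)

lemma bounded_linear_spin_op: "bounded_linear (spin_op M)"
proof (rule bounded_linear_intro[where K = "onorm ((*v) M)"])
  fix \<psi> \<phi> and r :: real
  show "spin_op M (\<psi> + \<phi>) = spin_op M \<psi> + spin_op M \<phi>"
    by (rule hil_eqI) (simp add: Rep_hil_simps matrix_vector_right_distrib)
  show "spin_op M (r *\<^sub>R \<psi>) = r *\<^sub>R spin_op M \<psi>"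
    by (rule hil_eqI) (simp add: Rep_hil_simps matrix_vector_scaleR)
  have bl: "bounded_linear ((*v) M)" by (simp add: linear_linear)
  have K: "0 \<le> onorm ((*v) M)" by (rule onorm_pos_le[OF bl])
  show "norm (spin_op M \<psi>) \<le> norm \<psi> * onorm ((*v) M)"
  proof (rule norm_hil_leI)
    fix F :: "(int^4) set" assume "finite F"
    have "(\<Sum>n\<in>F. (norm (Rep_hil (spin_op M \<psi>) n))\<^sup>2)
        \<le> (\<Sum>n\<in>F. (onorm ((*v) M))\<^sup>2 * (norm (Rep_hil \<psi> n))\<^sup>2)"
      unfolding power_mult_distrib[symmetric] Rep_hil_simps
      by (intro sum_mono power_mono onorm[OF bl]) auto
    also have "\<dots> = (onorm ((*v) M))\<^sup>2 * (\<Sum>n\<in>F. (norm (Rep_hil \<psi> n))\<^sup>2)"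
      by (simp add: sum_distrib_left)
    also have "\<dots> \<le> (onorm ((*v) M))\<^sup>2 * (norm \<psi>)\<^sup>2"
      by (intro mult_left_mono sum_norm_le_norm_hil[OF \<open>finite F\<close>]) auto
    finally show "(\<Sum>n\<in>F. (norm (Rep_hil (spin_op M \<psi>) n))\<^sup>2) \<le> (norm \<psi> * onorm ((*v) M))\<^sup>2"
      by (simp add: power_mult_distrib mult.commute)
  qed (simp add: K)
qed

lemmas spin_op_linear =
  bounded_linear.linear[OF bounded_linear_spin_op]
lemmas spin_op_add = linear_add[OF spin_op_linear]
lemmas spin_op_diff = linear_diff[OF spin_op_linear]
lemmas spin_op_minus = linear_neg[OF spin_op_linear]
lemmas spin_op_zero = linear_0[OF spin_op_linear]
lemmas spin_op_scaleR = linear_scale[OF spin_op_linear]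
lemmas spin_op_sum = linear_sum[OF spin_op_linear]

lemma spin_op_compose: "spin_op A (spin_op B \<psi>) = spin_op (A ** B) \<psi>"
  by (rule hil_eqI) (simp add: Rep_hil_simps matrix_vector_mul_assoc)

lemma has_sum_translate:
  fixes h :: "int^4 \<Rightarrow> 'a::{comm_monoid_add,topological_space}"
  shows "((\<lambda>n. h (n - m)) has_sum s) UNIV \<longleftrightarrow> (h has_sum s) UNIV"
  by (rule has_sum_reindex_bij_witness[where i = "\<lambda>n. n + m" and j = "\<lambda>n. n - m"]) auto

lift_definition shift :: "real^4^4 \<Rightarrow> complex \<Rightarrow> int^4 \<Rightarrow> hil \<Rightarrow> hil" is
  "\<lambda>\<theta> c m f n. (c * cis (pi * theta_form \<theta> m (n - m))) *s f (n - m)"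
proof -
  fix \<theta> c m and f :: "int^4 \<Rightarrow> complex^4" assume "f \<in> Collect ell2"
  then have "ell2 (\<lambda>n. f (n - m))"
    using has_sum_translate[of "\<lambda>n. (norm (f n))\<^sup>2" m] by (simp add: ell2_def summable_on_def)
  then show "(\<lambda>n. (c * cis (pi * theta_form \<theta> m (n - m))) *s f (n - m)) \<in> Collect ell2"
    by (auto intro: ell2_bounded[where C = "cmod c"] simp: norm_smult norm_mult)
qed

lemma norm_shift: "norm (shift \<theta> c m \<psi>) = cmod c * norm \<psi>"
proof -
  have "((\<lambda>n. (cmod c)\<^sup>2 * (norm (Rep_hil \<psi> (n - m)))\<^sup>2) has_sum (cmod c)\<^sup>2 * (norm \<psi>)\<^sup>2) UNIV"
    using norm_hil_has_sum[of \<psi>] by (intro has_sum_cmult_right) (simp add: has_sum_translate[of "\<lambda>n. (norm (Rep_hil \<psi> n))\<^sup>2"])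
  then have "((\<lambda>n. (norm (Rep_hil (shift \<theta> c m \<psi>) n))\<^sup>2) has_sum (cmod c * norm \<psi>)\<^sup>2) UNIV"
    by (simp add: shift.rep_eq norm_smult norm_mult power_mult_distrib)
  then have "(norm (shift \<theta> c m \<psi>))\<^sup>2 = (cmod c * norm \<psi>)\<^sup>2"
    using has_sum_unique[OF norm_hil_has_sum] by blast
  then show ?thesis by (simp add: power2_eq_iff_nonneg)
qed

lemma bounded_linear_shift: "bounded_linear (shift \<theta> c m)"
  by (rule bounded_linear_intro[where K = "cmod c"])
    (auto intro!: hil_eqI simp: norm_shift Rep_hil_simps shift.rep_eq vector_add_ldistrib
      scaleR_eq_smult vector_smult_assoc mult_ac)

text \<open>
  The defining convolution is a sum of weighted unitary translations that converges in norm;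
  this gives its square-summability, its boundedness, and reduces its algebra to translations.
\<close>

lemma lmult_has_sum:
  assumes "abs_summable a"
  shows "((\<lambda>m. shift \<theta> (a m) m \<psi>) has_sum lmult \<theta> a \<psi>) UNIV"
proof -
  have "(\<lambda>m. norm (shift \<theta> (a m) m \<psi>)) summable_on UNIV"
    unfolding norm_shift by (intro summable_on_cmult_left assms)
  then have S: "((\<lambda>m. shift \<theta> (a m) m \<psi>) has_sum (\<Sum>\<^sub>\<infinity>m. shift \<theta> (a m) m \<psi>)) UNIV" (is "(_ has_sum ?S) _")
    by (rule has_sum_infsum[OF abs_summable_summable])
  have "tmul \<theta> a (\<lambda>m. Rep_hil \<psi> m $ i) n = Rep_hil ?S n $ i" for n i
  proof -
    have "((\<lambda>m. Rep_hil (shift \<theta> (a m) m \<psi>) n $ i) has_sum Rep_hil ?S n $ i) UNIV"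
      by (rule has_sum_bounded_linear[OF _ S])
        (intro bounded_linear_compose[OF bounded_linear_vec_nth bounded_linear_Rep_hil])
    then show ?thesis unfolding tmul_def
      by (intro infsumI) (simp add: shift.rep_eq mult_ac)
  qed
  then have "lmult \<theta> a \<psi> = ?S"
    by (simp add: lmult_def Rep_hil_inverse)
  then show ?thesis using S by simp
qed

lemma Rep_lmult_has_sum:
  assumes "abs_summable a"
  shows "((\<lambda>m. (a m * cis (pi * theta_form \<theta> m (n - m))) *s Rep_hil \<psi> (n - m)) has_sum
    Rep_hil (lmult \<theta> a \<psi>) n) UNIV"
  using has_sum_bounded_linear[OF bounded_linear_Rep_hil lmult_has_sum[OF assms]]
  by (simp add: shift.rep_eq)

lemma norm_lmult_le:
  assumes "abs_summable a"
  shows "norm (lmult \<theta> a \<psi>) \<le> (\<Sum>\<^sub>\<infinity>m. cmod (a m)) * norm \<psi>"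
  by (rule norm_infsum_le[OF lmult_has_sum[OF assms] has_sum_cmult_left[OF has_sum_infsum[OF assms]]])
    (simp add: norm_shift)

lemma bounded_linear_lmult:
  assumes "abs_summable a" shows "bounded_linear (lmult \<theta> a)"
proof (rule bounded_linear_intro[where K = "\<Sum>\<^sub>\<infinity>m. cmod (a m)"])
  fix \<psi> \<phi> and r :: real
  interpret shift: bounded_linear "shift \<theta> c m" for c m by (rule bounded_linear_shift)
  show "lmult \<theta> a (\<psi> + \<phi>) = lmult \<theta> a \<psi> + lmult \<theta> a \<phi>"
    using lmult_has_sum[OF assms, of \<theta> "\<psi> + \<phi>"]
      has_sum_add[OF lmult_has_sum[OF assms, of \<theta> \<psi>] lmult_has_sum[OF assms, of \<theta> \<phi>]]
    by (simp add: shift.add has_sum_unique)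
  show "lmult \<theta> a (r *\<^sub>R \<psi>) = r *\<^sub>R lmult \<theta> a \<psi>"
    using lmult_has_sum[OF assms, of \<theta> "r *\<^sub>R \<psi>"] has_sum_scaleR[OF lmult_has_sum[OF assms, of \<theta> \<psi>], of r]
    by (simp add: shift.scaleR has_sum_unique)
  show "norm (lmult \<theta> a \<psi>) \<le> norm \<psi> * (\<Sum>\<^sub>\<infinity>m. cmod (a m))"
    using norm_lmult_le[OF assms] by (simp add: mult.commute)
qed

lemma Rep_lmult_unit_at:
  assumes "abs_summable a"
  shows "Rep_hil (lmult \<theta> a (unit_at n v)) l = (a (l - n) * cis (pi * theta_form \<theta> (l - n) n)) *s v"
proof -
  have "((\<lambda>m. (a m * cis (pi * theta_form \<theta> m (l - m))) *s Rep_hil (unit_at n v) (l - m)) has_sum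
      (a (l - n) * cis (pi * theta_form \<theta> (l - n) n)) *s v) UNIV"
    by (rule has_sum_finite_neutralI[of "{l - n}"]) (auto simp: Rep_unit_at)
  then show ?thesis using has_sum_unique[OF Rep_lmult_has_sum[OF assms]] by blast
qed

lemma lmult_monomial_unit_at: "lmult \<theta> (monomial m) (unit_at 0 v) = unit_at m v"
  by (rule hil_eqI)
    (simp add: Rep_lmult_unit_at[OF smooth_abs_summable[OF smooth_monomial]] Rep_unit_at monomial_def theta_form_simps)

lemma lmult_zero: "lmult \<theta> (\<lambda>n. 0) \<psi> = 0"
proof -
  have "((\<lambda>m. shift \<theta> 0 m \<psi>) has_sum 0) UNIV"
    by (rule has_sum_0) (simp add: norm_shift flip: norm_eq_zero)
  then show ?thesis
    using has_sum_unique[OF lmult_has_sum[of "\<lambda>n. 0" \<theta> \<psi>]] by simp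
qed

lemma lmult_add_left:
  assumes "abs_summable a" "abs_summable b"
  shows "lmult \<theta> (\<lambda>n. a n + b n) \<psi> = lmult \<theta> a \<psi> + lmult \<theta> b \<psi>"
proof (rule hil_eqI)
  fix n
  have "abs_summable (\<lambda>n. a n + b n)"
    by (rule Infinite_Sum.abs_summable_on_comparison_test'[OF summable_on_add[OF assms]])
      (rule norm_triangle_ineq)
  from has_sum_unique[OF Rep_lmult_has_sum[OF this, of \<theta> n \<psi>]]
    has_sum_add[OF Rep_lmult_has_sum[OF assms(1), of \<theta> n \<psi>] Rep_lmult_has_sum[OF assms(2), of \<theta> n \<psi>]]
  show "Rep_hil (lmult \<theta> (\<lambda>n. a n + b n) \<psi>) n = Rep_hil (lmult \<theta> a \<psi> + lmult \<theta> b \<psi>) n"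
    by (simp add: Rep_hil_simps ring_distribs vector_sadd_rdistrib)
qed

lemma lmult_diff_left:
  assumes "a \<in> smooth" "b \<in> smooth"
  shows "lmult \<theta> (\<lambda>n. a n - b n) \<psi> = lmult \<theta> a \<psi> - lmult \<theta> b \<psi>"
  using lmult_add_left[of "\<lambda>n. a n - b n" b \<theta> \<psi>] assms
  by (simp add: smooth_abs_summable smooth_diff)

lemma lmult_tone: "lmult \<theta> tone \<psi> = \<psi>"
proof -
  have "lmult \<theta> tone = (\<lambda>\<psi>. \<psi>)"
    by (rule bounded_linear_eq_on_unit_at)
      (auto intro!: bounded_linear_lmult[OF smooth_abs_summable[OF smooth_monomial]] bounded_linear_ident hil_eqI
        simp: Rep_lmult_unit_at[OF smooth_abs_summable[OF smooth_monomial]] tone_eq_monomial Rep_unit_at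
          monomial_def theta_form_simps)
  then show ?thesis by simp
qed

lemma lmult_spin_op:
  assumes "abs_summable a"
  shows "lmult \<theta> a (spin_op M \<psi>) = spin_op M (lmult \<theta> a \<psi>)"
proof -
  have "spin_op M (shift \<theta> c m \<psi>) = shift \<theta> c m (spin_op M \<psi>)" for c m
    by (rule hil_eqI) (simp add: Rep_hil_simps shift.rep_eq vector_scalar_commute)
  then have "((\<lambda>m. shift \<theta> (a m) m (spin_op M \<psi>)) has_sum spin_op M (lmult \<theta> a \<psi>)) UNIV"
    using has_sum_bounded_linear[OF bounded_linear_spin_op lmult_has_sum[OF assms, of \<theta> \<psi>], of M] by simp
  then show ?thesis using has_sum_unique[OF lmult_has_sum[OF assms]] by blast
qed

text \<open>
  On the field supported at one lattice point \<open>n\<close>, both sides are the coefficient sum of the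
  twisted product, because the phases satisfy
  \<open>\<theta>(m, l - m) + \<theta>(l - m - n, n) = \<theta>(m, l - n - m) + \<theta>(l - n, n)\<close>.
\<close>

lemma lmult_lmult:
  assumes "p \<in> smooth" "q \<in> smooth"
  shows "lmult \<theta> p (lmult \<theta> q \<psi>) = lmult \<theta> (tmul \<theta> p q) \<psi>"
proof -
  note s = assms[THEN smooth_abs_summable] smooth_tmul[OF assms, THEN smooth_abs_summable]
  have "(\<lambda>\<psi>. lmult \<theta> p (lmult \<theta> q \<psi>)) = lmult \<theta> (tmul \<theta> p q)"
  proof (rule bounded_linear_eq_on_unit_at)
    show "bounded_linear (\<lambda>\<psi>. lmult \<theta> p (lmult \<theta> q \<psi>))"
      by (intro bounded_linear_compose[OF bounded_linear_lmult bounded_linear_lmult] s)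
    show "bounded_linear (lmult \<theta> (tmul \<theta> p q))" by (intro bounded_linear_lmult s)
    fix n v
    show "lmult \<theta> p (lmult \<theta> q (unit_at n v)) = lmult \<theta> (tmul \<theta> p q) (unit_at n v)"
    proof (rule hil_eqI, subst vec_eq_iff, rule allI)
      fix l i
      let ?c = "cis (pi * theta_form \<theta> (l - n) n)"
      have "((\<lambda>m. (p m * cis (pi * theta_form \<theta> m (l - m))) *
            (q (l - m - n) * cis (pi * theta_form \<theta> (l - m - n) n) * v $ i)) has_sum
          Rep_hil (lmult \<theta> p (lmult \<theta> q (unit_at n v))) l $ i) UNIV"
        using has_sum_bounded_linear[OF bounded_linear_vec_nth Rep_lmult_has_sum[OF s(1), of \<theta> l "lmult \<theta> q (unit_at n v)"], of i]
        by (simp add: Rep_lmult_unit_at s mult.assoc)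
      moreover have "(p m * cis (pi * theta_form \<theta> m (l - m))) *
            (q (l - m - n) * cis (pi * theta_form \<theta> (l - m - n) n) * v $ i) =
          (cis (pi * theta_form \<theta> m (l - n - m)) * p m * q (l - n - m)) * (?c * v $ i)" for m
      proof -
        have swap: "l - m - n = l - n - m" by simp
        have phase: "cis (pi * theta_form \<theta> m (l - m)) * cis (pi * theta_form \<theta> (l - n - m) n) =
            cis (pi * theta_form \<theta> m (l - n - m)) * ?c"
          unfolding cis_mult by (simp add: theta_form_simps algebra_simps)
        have "(p m * cis (pi * theta_form \<theta> m (l - m))) *
            (q (l - n - m) * cis (pi * theta_form \<theta> (l - n - m) n) * v $ i) =
          (cis (pi * theta_form \<theta> m (l - m)) * cis (pi * theta_form \<theta> (l - n - m) n)) *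
            (p m * q (l - n - m) * v $ i)"
          by (simp only: mult_ac)
        also have "\<dots> = (cis (pi * theta_form \<theta> m (l - n - m)) * p m * q (l - n - m)) * (?c * v $ i)"
          unfolding phase by (simp only: mult_ac)
        finally show ?thesis unfolding swap .
      qed
      ultimately have "((\<lambda>m. (cis (pi * theta_form \<theta> m (l - n - m)) * p m * q (l - n - m)) * (?c * v $ i)) has_sum
          Rep_hil (lmult \<theta> p (lmult \<theta> q (unit_at n v))) l $ i) UNIV"
        by simp
      then have "Rep_hil (lmult \<theta> p (lmult \<theta> q (unit_at n v))) l $ i = tmul \<theta> p q (l - n) * (?c * v $ i)"
        unfolding tmul_def infsum_cmult_left'[symmetric] by (rule infsumI[symmetric])
      then show "Rep_hil (lmult \<theta> p (lmult \<theta> q (unit_at n v))) l $ i =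
          Rep_hil (lmult \<theta> (tmul \<theta> p q) (unit_at n v)) l $ i"
        by (simp add: Rep_lmult_unit_at s mult_ac)
    qed
  qed
  then show ?thesis by (rule fun_cong)
qed

text \<open>
  Translations for \<open>\<theta>\<close> and for its transpose commute: exchanging them changes the phase by
  \<open>\<theta>(m, k) + \<theta>(k, m) = 0\<close>.
\<close>

lemma lmult_commute_opposite:
  assumes skew: "transpose \<theta> = - \<theta>" and "abs_summable a" "abs_summable b"
  shows "lmult \<theta> a (lmult (transpose \<theta>) b \<psi>) = lmult (transpose \<theta>) b (lmult \<theta> a \<psi>)"
proof -
  have shifts: "shift \<theta> c m (shift (transpose \<theta>) d k \<psi>) = shift (transpose \<theta>) d k (shift \<theta> c m \<psi>)" for c m d k \<psi>
  proof (rule hil_eqI)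
    fix n
    have swap: "n - k - m = n - m - k" by simp
    have phase: "cis (pi * theta_form \<theta> m (n - m)) * cis (pi * theta_form \<theta> (n - m - k) k) =
        cis (pi * theta_form \<theta> (n - k) k) * cis (pi * theta_form \<theta> m (n - k - m))"
      unfolding cis_mult by (simp add: theta_form_simps algebra_simps)
    have "(c * cis (pi * theta_form \<theta> m (n - m))) * (d * cis (pi * theta_form \<theta> (n - m - k) k)) =
        (c * d) * (cis (pi * theta_form \<theta> m (n - m)) * cis (pi * theta_form \<theta> (n - m - k) k))"
      by (simp only: mult_ac)
    also have "\<dots> = (d * cis (pi * theta_form \<theta> (n - k) k)) * (c * cis (pi * theta_form \<theta> m (n - k - m)))"
      unfolding phase by (simp only: mult_ac)
    finally show "Rep_hil (shift \<theta> c m (shift (transpose \<theta>) d k \<psi>)) n =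
        Rep_hil (shift (transpose \<theta>) d k (shift \<theta> c m \<psi>)) n"
      by (simp add: shift.rep_eq theta_form_transpose vector_smult_assoc swap)
  qed
  have sl: "shift \<theta> c m (lmult (transpose \<theta>) b \<psi>) = lmult (transpose \<theta>) b (shift \<theta> c m \<psi>)" for c m \<psi>
    using has_sum_bounded_linear[OF bounded_linear_shift lmult_has_sum[OF assms(3), of "transpose \<theta>" \<psi>], of \<theta> c m]
      lmult_has_sum[OF assms(3), of "transpose \<theta>" "shift \<theta> c m \<psi>"]
    unfolding shifts by (rule has_sum_unique)
  show ?thesis
    using lmult_has_sum[OF assms(2), of \<theta> "lmult (transpose \<theta>) b \<psi>"]
      has_sum_bounded_linear[OF bounded_linear_lmult[OF assms(3), of "transpose \<theta>"] lmult_has_sum[OF assms(2), of \<theta> \<psi>]]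
    unfolding sl by (rule has_sum_unique)
qed

lemma complex_inner_smult: "(c *s v) \<bullet> w = v \<bullet> (cnj c *s (w::complex^4))"
  by (simp add: inner_vec_def inner_complex_def algebra_simps)

text \<open>
  Each translation by \<open>m\<close> is unitary with inverse the translation by \<open>- m\<close>, because
  \<open>\<theta>(m, m) = 0\<close>.
\<close>

lemma inner_lmult:
  assumes skew: "transpose \<theta> = - \<theta>" and a: "abs_summable a"
  shows "lmult \<theta> a \<psi> \<bullet> \<phi> = \<psi> \<bullet> lmult \<theta> (star a) \<phi>"
proof -
  note sa = abs_summable_star[OF a]
  have adj: "shift \<theta> c m \<psi> \<bullet> \<phi> = \<psi> \<bullet> shift \<theta> (cnj c) (- m) \<phi>" for c m
  proof -
    have "((\<lambda>n. Rep_hil \<psi> (n - m) \<bullet> Rep_hil (shift \<theta> (cnj c) (- m) \<phi>) (n - m)) has_sum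
        \<psi> \<bullet> shift \<theta> (cnj c) (- m) \<phi>) UNIV"
      by (subst has_sum_translate) (rule inner_hil_has_sum)
    moreover have "Rep_hil \<psi> (n - m) \<bullet> Rep_hil (shift \<theta> (cnj c) (- m) \<phi>) (n - m) =
        Rep_hil (shift \<theta> c m \<psi>) n \<bullet> Rep_hil \<phi> n" for n
    proof -
      have "theta_form \<theta> m m = 0" using theta_form_skew[OF skew, of m m] by simp
      then show ?thesis
        by (simp add: shift.rep_eq complex_inner_smult theta_form_simps cis_cnj)
    qed
    ultimately show ?thesis using has_sum_unique[OF inner_hil_has_sum] by simp
  qed
  have "((\<lambda>m. \<psi> \<bullet> shift \<theta> (star a (- m)) (- m) \<phi>) has_sum lmult \<theta> a \<psi> \<bullet> \<phi>) UNIV"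
    using has_sum_bounded_linear[OF bounded_linear_inner_left lmult_has_sum[OF a, of \<theta> \<psi>], of \<phi>]
    by (simp add: adj star_def)
  then have "((\<lambda>m. \<psi> \<bullet> shift \<theta> (star a m) m \<phi>) has_sum lmult \<theta> a \<psi> \<bullet> \<phi>) UNIV"
    using has_sum_reindex_bij_betw[OF bij_uminus, of "\<lambda>m. \<psi> \<bullet> shift \<theta> (star a m) m \<phi>"] by simp
  moreover have "((\<lambda>m. \<psi> \<bullet> shift \<theta> (star a m) m \<phi>) has_sum \<psi> \<bullet> lmult \<theta> (star a) \<phi>) UNIV"
    by (rule has_sum_bounded_linear[OF bounded_linear_inner_right lmult_has_sum[OF sa]])
  ultimately show ?thesis by (rule has_sum_unique)
qed

section \<open>Gamma matrices\<close>

lemma UNIV_4_eq: "(UNIV :: 4 set) = insert 4 {1, 2, 3}"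
  using exhaust_4 by auto

lemma sum_UNIV_4: "(\<Sum>j\<in>(UNIV :: 4 set). f j) = f 4 + (\<Sum>j\<in>{1, 2, 3}. f j)"
  unfolding UNIV_4_eq by (subst sum.insert) auto

lemma gamma_gamma: "gamma j ** gamma j = mat 1"
proof -
  have "(gamma j ** gamma j) $ k $ l = (mat 1 :: complex^4^4) $ k $ l" for k l
  proof -
    have "2 * (gamma j ** gamma j) $ k $ l = (mat 2 :: complex^4^4) $ k $ l"
      using arg_cong[OF gamma_clifford[of j j], of "\<lambda>M. M $ k $ l"] by simp
    then show ?thesis by (cases "k = l") (simp_all add: mat_nth)
  qed
  then show ?thesis by (simp add: vec_eq_iff)
qed

lemma spin_gamma_square: "spin_op (gamma j) (spin_op (gamma j) \<psi>) = \<psi>"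
  by (rule hil_eqI) (simp add: Rep_hil_simps matrix_vector_mul_assoc gamma_gamma)

lemma gamma_anticommute:
  assumes "i \<noteq> j" shows "gamma i *v (gamma j *v v) = - (gamma j *v (gamma i *v v))"
proof -
  have "(gamma i ** gamma j + gamma j ** gamma i) *v v = 0"
    using assms by (simp add: gamma_clifford)
  then show ?thesis
    by (simp add: matrix_vector_mult_add_rdistrib matrix_vector_mul_assoc eq_neg_iff_add_eq_0)
qed

lemma spin_gamma_anticommute:
  "i \<noteq> j \<Longrightarrow> spin_op (gamma i) (spin_op (gamma j) \<psi>) = - spin_op (gamma j) (spin_op (gamma i) \<psi>)"
  by (rule hil_eqI) (simp add: Rep_hil_simps gamma_anticommute[of i j])

lemma inner_matrix_adjoint:
  fixes A B :: "complex^4^4"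
  assumes "\<And>k l. cnj (A $ k $ l) = B $ l $ k"
  shows "(A *v v) \<bullet> w = v \<bullet> (B *v w)"
proof -
  have "(A *v v) \<bullet> w = (\<Sum>k\<in>UNIV. \<Sum>l\<in>UNIV. (A $ k $ l * v $ l) \<bullet> w $ k)"
    by (simp add: inner_vec_def matrix_vector_mult_def inner_sum_left)
  also have "\<dots> = (\<Sum>l\<in>UNIV. \<Sum>k\<in>UNIV. (A $ k $ l * v $ l) \<bullet> w $ k)" by (rule sum.swap)
  also have "\<dots> = (\<Sum>l\<in>UNIV. \<Sum>k\<in>UNIV. v $ l \<bullet> (cnj (A $ k $ l) * w $ k))"
    by (intro sum.cong refl) (simp add: inner_complex_def algebra_simps)
  also have "\<dots> = v \<bullet> (B *v w)"
    by (simp add: inner_vec_def matrix_vector_mult_def inner_sum_right assms)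
  finally show ?thesis .
qed

lemma inner_gamma: "(gamma j *v v) \<bullet> w = v \<bullet> (gamma j *v w)"
  by (rule inner_matrix_adjoint) (rule gamma_hermitian)

lemma inner_spin_gamma: "spin_op (gamma j) \<psi> \<bullet> \<phi> = \<psi> \<bullet> spin_op (gamma j) \<phi>"
  using inner_hil_has_sum[of "spin_op (gamma j) \<psi>" \<phi>] inner_hil_has_sum[of \<psi> "spin_op (gamma j) \<phi>"]
  by (simp add: Rep_hil_simps inner_gamma has_sum_unique)

text \<open>The matrix \<open>\<Sum>\<^sub>j c\<^sub>j \<gamma>\<^sup>j\<close> displays every \<open>c\<^sub>j\<close> in its first two rows.\<close>

lemma gamma_independent:
  assumes "\<And>v. (\<Sum>j\<in>UNIV. c j *s (gamma j *v v)) = 0"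
  shows "c j = 0"
proof -
  have e: "(\<Sum>j\<in>UNIV. c j * gamma j $ k $ l) = 0" for k l
  proof -
    have "(\<Sum>j\<in>UNIV. c j * gamma j $ k $ l) = (\<Sum>j\<in>UNIV. c j *s (gamma j *v axis l 1)) $ k"
      by (simp add: matrix_vector_mult_def axis_def if_distrib cong: if_cong)
    then show ?thesis by (simp only: assms zero_index)
  qed
  have "c 4 = 0" using e[of 1 1]
    by (simp add: sum_4 gamma_def block_def pauli_def vector_4_nth mat_mult_nth mat_nth)
  moreover have "c 3 = 0" using e[of 1 3]
    by (simp add: sum_4 gamma_def block_def pauli_def vector_4_nth mat_mult_nth mat_nth)
  moreover have p: "c 1 * \<i> + c 2 = 0" using e[of 1 4]
    by (simp add: sum_4 gamma_def block_def pauli_def vector_4_nth mat_mult_nth mat_nth)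
  moreover have m: "c 1 * \<i> - c 2 = 0" using e[of 2 3]
    by (simp add: sum_4 gamma_def block_def pauli_def vector_4_nth mat_mult_nth mat_nth)
  moreover have "c 2 = 0"
  proof -
    have "2 * c 2 = (c 1 * \<i> + c 2) - (c 1 * \<i> - c 2)" by simp
    then show ?thesis unfolding p m by simp
  qed
  moreover have "c 1 = 0" using p \<open>c 2 = 0\<close> by simp
  ultimately show ?thesis using exhaust_4[of j] by auto
qed

section \<open>Right multiplication\<close>

definition conj_vec :: "complex^4 \<Rightarrow> complex^4" where
  "conj_vec v = (\<chi> i. cnj (v $ i))"

lemma Rep_J: "Rep_hil (J \<psi>) n = (gamma 4 ** gamma 2) *v conj_vec (Rep_hil \<psi> (- n))"
  by (simp add: J.rep_eq conj_vec_def star_def)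

lemma conj_vec_smult: "conj_vec (c *s v) = cnj c *s conj_vec v"
  by (simp add: conj_vec_def vec_eq_iff)

lemma bounded_linear_conj_vec: "bounded_linear conj_vec"
  by (rule bounded_linear_intro[where K = 1])
    (simp_all add: conj_vec_def vec_eq_iff complex_eq_iff norm_vec_def)

text \<open>
  The matrix \<open>\<gamma>\<^sup>4 \<gamma>\<^sup>2\<close> has real entries and squares to \<open>-1\<close>.
\<close>

lemma J_J: "J (J \<psi>) = - \<psi>"
proof (rule hil_eqI)
  fix n
  let ?N = "gamma 4 ** gamma 2"
  have real: "cnj (?N $ k $ l) = ?N $ k $ l" for k l
  proof -
    have "\<forall>k l. cnj (?N $ k $ l) = ?N $ k $ l"
      by (simp add: forall_4 gamma_def block_def pauli_def vector_4_nth mat_mult_nth mult4_nth four_neq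
          four_neq[symmetric] mat_nth)
    then show ?thesis by simp
  qed
  have "conj_vec (?N *v v) = ?N *v conj_vec v" for v
    by (simp add: vec_eq_iff conj_vec_def matrix_vector_mult_def real)
  moreover have "conj_vec (conj_vec v) = v" for v by (simp add: conj_vec_def)
  moreover have "?N *v (?N *v v) = - v" for v
  proof -
    have "?N *v (?N *v v) = gamma 4 *v (gamma 2 *v (gamma 4 *v (gamma 2 *v v)))"
      by (simp add: matrix_vector_mul_assoc matrix_mul_assoc)
    also have "gamma 2 *v (gamma 4 *v (gamma 2 *v v)) = - (gamma 4 *v (gamma 2 *v (gamma 2 *v v)))"
      by (rule gamma_anticommute) simp
    also have "gamma 4 *v (- (gamma 4 *v (gamma 2 *v (gamma 2 *v v)))) =
        - ((gamma 4 ** gamma 4) *v ((gamma 2 ** gamma 2) *v v))"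
      using matrix_vector_mult_diff_distrib[of "gamma 4" 0] by (simp add: matrix_vector_mul_assoc matrix_mul_assoc)
    finally show ?thesis by (simp add: gamma_gamma)
  qed
  ultimately show "Rep_hil (J (J \<psi>)) n = Rep_hil (- \<psi>) n"
    by (simp add: Rep_J Rep_hil_simps)
qed

lemma J_inv_J: "J (inv J h) = h"
proof -
  have "surj J" by (rule surjI[of J "\<lambda>h. J (J (J h))"]) (simp add: J_J)
  then show ?thesis by (rule surj_f_inv_f)
qed

text \<open>
  Conjugation with the involution turns the twisted convolution by \<open>\<theta>\<close> into the one by the
  transposed form, so every property of the left action carries over to the right action.
\<close>

lemma rmult_eq_lmult:
  assumes skew: "transpose \<theta> = - \<theta>" and a: "abs_summable a"
  shows "rmult \<theta> a h = lmult (transpose \<theta>) a h"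
proof (rule hil_eqI)
  fix n
  let ?N = "(*v) (gamma 4 ** gamma 2)" and ?g = "inv J h"
  note sa = abs_summable_star[OF a]
  have "bounded_linear (\<lambda>v. ?N (conj_vec v))"
    by (rule bounded_linear_compose[OF _ bounded_linear_conj_vec, of ?N]) (simp add: linear_linear)
  from has_sum_bounded_linear[OF this Rep_lmult_has_sum[OF sa, of \<theta> "- n" ?g]]
  have "((\<lambda>m. ?N (conj_vec ((star a m * cis (pi * theta_form \<theta> m (- n - m))) *s Rep_hil ?g (- n - m))))
      has_sum Rep_hil (rmult \<theta> a h) n) UNIV"
    by (simp add: rmult_def Rep_J)
  moreover have "?N (conj_vec ((star a m * cis (pi * theta_form \<theta> m (- n - m))) *s Rep_hil ?g (- n - m))) =
      (a (- m) * cis (pi * theta_form (transpose \<theta>) (- m) (n - - m))) *s Rep_hil h (n - - m)" for m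
  proof -
    have "?N (conj_vec (Rep_hil ?g (- n - m))) = Rep_hil (J ?g) (n + m)" by (simp add: Rep_J)
    then have "?N (conj_vec (Rep_hil ?g (- n - m))) = Rep_hil h (n + m)" by (simp only: J_inv_J)
    moreover have "theta_form \<theta> m m = 0" using theta_form_skew[OF skew, of m m] by simp
    ultimately show ?thesis
      by (simp add: conj_vec_smult vector_scalar_commute star_def cis_cnj theta_form_transpose
          theta_form_skew[OF skew, of n m] theta_form_simps algebra_simps)
  qed
  ultimately have "((\<lambda>m. (a (- m) * cis (pi * theta_form (transpose \<theta>) (- m) (n - - m))) *s Rep_hil h (n - - m))
      has_sum Rep_hil (rmult \<theta> a h) n) UNIV" by simp
  then have "((\<lambda>m. (a m * cis (pi * theta_form (transpose \<theta>) m (n - m))) *s Rep_hil h (n - m))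
      has_sum Rep_hil (rmult \<theta> a h) n) UNIV"
    using has_sum_reindex_bij_betw[OF bij_uminus,
        of "\<lambda>m. (a m * cis (pi * theta_form (transpose \<theta>) m (n - m))) *s Rep_hil h (n - m)"] by simp
  then show "Rep_hil (rmult \<theta> a h) n = Rep_hil (lmult (transpose \<theta>) a h) n"
    by (rule has_sum_unique[OF _ Rep_lmult_has_sum[OF a]])
qed

lemma rmult_eq_lmult_fun:
  "transpose \<theta> = - \<theta> \<Longrightarrow> a \<in> smooth \<Longrightarrow> rmult \<theta> a = lmult (transpose \<theta>) a"
  by (intro ext rmult_eq_lmult smooth_abs_summable)

lemma tmul_transpose: "tmul (transpose \<theta>) a b = tmul \<theta> b a"
proof
  fix n
  show "tmul (transpose \<theta>) a b n = tmul \<theta> b a n"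
    unfolding tmul_def
    by (rule infsum_reindex_bij_witness[where i = "\<lambda>m. n - m" and j = "\<lambda>m. n - m"])
      (auto simp: theta_form_transpose)
qed

lemma tmul_tone_left: "tmul \<theta> tone a = a"
proof
  fix n
  have "tmul \<theta> tone a n = (\<Sum>\<^sub>\<infinity>m\<in>{0}. cis (pi * theta_form \<theta> m (n - m)) * tone m * a (n - m))"
    unfolding tmul_def by (rule infsum_cong_neutral) (auto simp: tone_def)
  then show "tmul \<theta> tone a n = a n" by (simp add: tone_def theta_form_zero_left)
qed

lemma tmul_tone_right: "tmul \<theta> a tone = a"
  using tmul_tone_left[of "transpose \<theta>" a] by (simp add: tmul_transpose)

lemma tmul_zero: "tmul \<theta> (\<lambda>n. 0) a = (\<lambda>n. 0)" "tmul \<theta> a (\<lambda>n. 0) = (\<lambda>n. 0)"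
  by (simp_all add: tmul_def fun_eq_iff)

section \<open>The derivations and the first Sobolev space\<close>

lemma delta_eq_Some_iff:
  "delta j \<psi> = Some \<phi> \<longleftrightarrow> (\<forall>n. Rep_hil \<phi> n = real_of_int (n $ j) *\<^sub>R Rep_hil \<psi> n)"
proof
  assume "delta j \<psi> = Some \<phi>"
  then show "\<forall>n. Rep_hil \<phi> n = real_of_int (n $ j) *\<^sub>R Rep_hil \<psi> n"
    by (auto simp: delta_def Let_def Rep_Abs_hil split: if_splits)
next
  assume "\<forall>n. Rep_hil \<phi> n = real_of_int (n $ j) *\<^sub>R Rep_hil \<psi> n"
  then have "(\<lambda>n. real_of_int (n $ j) *\<^sub>R Rep_hil \<psi> n) = Rep_hil \<phi>" by auto
  then show "delta j \<psi> = Some \<phi>"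
    by (simp add: delta_def ell2_Rep Rep_hil_inverse)
qed

text \<open>
  The Leibniz rule: in the convolution \<open>n\<^sub>j\<close> splits into \<open>m\<^sub>j\<close> and \<open>(n - m)\<^sub>j\<close>.
\<close>

lemma delta_lmult:
  assumes a: "a \<in> smooth" and \<psi>: "delta j \<psi> = Some \<phi>"
  shows "delta j (lmult \<theta> a \<psi>) = Some (lmult \<theta> a \<phi> + lmult \<theta> (der j a) \<psi>)"
  unfolding delta_eq_Some_iff
proof
  fix n
  note s = a[THEN smooth_abs_summable] smooth_der[OF a, THEN smooth_abs_summable]
  let ?c = "\<lambda>m. a m * cis (pi * theta_form \<theta> m (n - m))"
  have "((\<lambda>m. ?c m *s Rep_hil \<phi> (n - m) +
      (der j a m * cis (pi * theta_form \<theta> m (n - m))) *s Rep_hil \<psi> (n - m)) has_sum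
      Rep_hil (lmult \<theta> a \<phi> + lmult \<theta> (der j a) \<psi>) n) UNIV"
    unfolding Rep_hil_simps by (intro has_sum_add Rep_lmult_has_sum s)
  moreover have "?c m *s Rep_hil \<phi> (n - m) +
      (der j a m * cis (pi * theta_form \<theta> m (n - m))) *s Rep_hil \<psi> (n - m) =
      real_of_int (n $ j) *\<^sub>R (?c m *s Rep_hil \<psi> (n - m))" for m
    using \<psi> by (simp add: delta_eq_Some_iff der_def vec_eq_iff) (simp add: scaleR_conv_of_real algebra_simps)
  ultimately have "((\<lambda>m. real_of_int (n $ j) *\<^sub>R (?c m *s Rep_hil \<psi> (n - m))) has_sum
      Rep_hil (lmult \<theta> a \<phi> + lmult \<theta> (der j a) \<psi>) n) UNIV" by simp
  moreover have "((\<lambda>m. real_of_int (n $ j) *\<^sub>R (?c m *s Rep_hil \<psi> (n - m))) has_sum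
      real_of_int (n $ j) *\<^sub>R Rep_hil (lmult \<theta> a \<psi>) n) UNIV"
    by (intro has_sum_scaleR Rep_lmult_has_sum s)
  ultimately show "Rep_hil (lmult \<theta> a \<phi> + lmult \<theta> (der j a) \<psi>) n =
      real_of_int (n $ j) *\<^sub>R Rep_hil (lmult \<theta> a \<psi>) n"
    by (rule has_sum_unique)
qed

lemma delta_spin_op: "delta j \<psi> = Some \<phi> \<Longrightarrow> delta j (spin_op M \<psi>) = Some (spin_op M \<phi>)"
  by (simp add: delta_eq_Some_iff Rep_hil_simps matrix_vector_scaleR)

lemma delta_add: "delta j \<psi> = Some \<phi> \<Longrightarrow> delta j \<psi>' = Some \<phi>' \<Longrightarrow> delta j (\<psi> + \<psi>') = Some (\<phi> + \<phi>')"
  by (simp add: delta_eq_Some_iff Rep_hil_simps scaleR_add_right)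

lemma delta_scaleR: "delta j \<psi> = Some \<phi> \<Longrightarrow> delta j (r *\<^sub>R \<psi>) = Some (r *\<^sub>R \<phi>)"
  by (simp add: delta_eq_Some_iff Rep_hil_simps)

text \<open>
  The common domain of the derivations, which is the domain of the flat Dirac operator and of all
  its perturbations considered here.
\<close>

definition sobolev :: "hil set" where
  "sobolev = {\<psi>. \<forall>j. \<psi> \<in> dom (delta j)}"

definition grad :: "4 \<Rightarrow> hil \<Rightarrow> hil" where
  "grad j \<psi> = the (delta j \<psi>)"

lemma delta_sobolev: "\<psi> \<in> sobolev \<Longrightarrow> delta j \<psi> = Some (grad j \<psi>)"
  by (auto simp: sobolev_def grad_def dom_def dest: spec[of _ j])

lemma grad_eqI: "delta j \<psi> = Some \<phi> \<Longrightarrow> grad j \<psi> = \<phi>"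
  by (simp add: grad_def)

lemma sobolevI: "(\<And>j. delta j \<psi> = Some (f j)) \<Longrightarrow> \<psi> \<in> sobolev"
  by (simp add: sobolev_def dom_def)

lemma Rep_grad: "\<psi> \<in> sobolev \<Longrightarrow> Rep_hil (grad j \<psi>) n = real_of_int (n $ j) *\<^sub>R Rep_hil \<psi> n"
  using delta_sobolev[of \<psi> j] by (simp add: delta_eq_Some_iff)

lemma sobolev_lmult:
  assumes "a \<in> smooth" "\<psi> \<in> sobolev"
  shows "lmult \<theta> a \<psi> \<in> sobolev"
    and "grad j (lmult \<theta> a \<psi>) = lmult \<theta> a (grad j \<psi>) + lmult \<theta> (der j a) \<psi>"
  using delta_lmult[OF assms(1) delta_sobolev[OF assms(2)]] by (auto intro: sobolevI grad_eqI)

lemma sobolev_spin_op: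
  assumes "\<psi> \<in> sobolev"
  shows "spin_op M \<psi> \<in> sobolev" and "grad j (spin_op M \<psi>) = spin_op M (grad j \<psi>)"
  using delta_spin_op[OF delta_sobolev[OF assms]] by (auto intro: sobolevI grad_eqI)

lemma sobolev_add:
  assumes "\<psi> \<in> sobolev" "\<phi> \<in> sobolev"
  shows "\<psi> + \<phi> \<in> sobolev" and "grad j (\<psi> + \<phi>) = grad j \<psi> + grad j \<phi>"
  using delta_add[OF assms[THEN delta_sobolev]] by (auto intro: sobolevI grad_eqI)

lemma sobolev_scaleR:
  assumes "\<psi> \<in> sobolev"
  shows "r *\<^sub>R \<psi> \<in> sobolev" and "grad j (r *\<^sub>R \<psi>) = r *\<^sub>R grad j \<psi>"
  using delta_scaleR[OF delta_sobolev[OF assms]] by (auto intro: sobolevI grad_eqI)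

lemma sobolev_zero: "0 \<in> sobolev" and grad_zero: "grad j 0 = 0"
proof -
  have "delta j 0 = Some 0" for j by (simp add: delta_eq_Some_iff Rep_hil_simps)
  then show "0 \<in> sobolev" "grad j 0 = 0" by (auto intro: sobolevI grad_eqI)
qed

lemma sobolev_diff:
  assumes "\<psi> \<in> sobolev" "\<phi> \<in> sobolev"
  shows "\<psi> - \<phi> \<in> sobolev" and "grad j (\<psi> - \<phi>) = grad j \<psi> - grad j \<phi>"
  using sobolev_add[OF assms(1) sobolev_scaleR(1)[OF assms(2), of "-1"]] sobolev_scaleR(2)[OF assms(2), of j "-1"]
  by simp_all

lemma sobolev_unit_at: "unit_at n v \<in> sobolev"
proof (rule sobolevI)
  show "delta j (unit_at n v) = Some (real_of_int (n $ j) *\<^sub>R unit_at n v)" for j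
    by (simp add: delta_eq_Some_iff Rep_hil_simps Rep_unit_at)
qed

lemma sobolev_sum: "(\<And>i. i \<in> I \<Longrightarrow> f i \<in> sobolev) \<Longrightarrow> sum f I \<in> sobolev"
  by (induction I rule: infinite_finite_induct) (auto simp: sobolev_zero sobolev_add)

lemma closure_sobolev: "closure sobolev = UNIV"
  by (rule closure_eq_UNIV_if_truncations) (intro sobolev_sum sobolev_unit_at)

section \<open>One-forms\<close>

definition one_form :: "real^4^4 \<Rightarrow> (4 \<Rightarrow> int^4 \<Rightarrow> complex) \<Rightarrow> hil \<Rightarrow> hil" where
  "one_form \<theta> c \<psi> = (\<Sum>j\<in>UNIV. spin_op (gamma j) (lmult \<theta> (c j) \<psi>))"

lemma linear_lmult: "a \<in> smooth \<Longrightarrow> linear (lmult \<theta> a)"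
  by (intro bounded_linear.linear bounded_linear_lmult smooth_abs_summable)

lemma bounded_linear_one_form:
  assumes "\<And>j. c j \<in> smooth" shows "bounded_linear (one_form \<theta> c)"
proof -
  have "bounded_linear (\<lambda>\<psi>. \<Sum>j\<in>UNIV. spin_op (gamma j) (lmult \<theta> (c j) \<psi>))"
    by (intro bounded_linear_sum bounded_linear_compose[OF bounded_linear_spin_op bounded_linear_lmult]
        smooth_abs_summable assms)
  then show ?thesis by (simp add: one_form_def[abs_def])
qed

lemma one_form_sum_list:
  assumes "\<And>x j. x \<in> set xs \<Longrightarrow> f x j \<in> smooth"
  shows "(\<Sum>x\<leftarrow>xs. one_form \<theta> (f x) \<psi>) = one_form \<theta> (\<lambda>j n. \<Sum>x\<leftarrow>xs. f x j n) \<psi>"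
  using assms
proof (induction xs)
  case Nil
  show ?case by (simp add: one_form_def lmult_zero spin_op_zero)
next
  case (Cons x xs)
  have "lmult \<theta> (\<lambda>n. f x j n + (\<Sum>x\<leftarrow>xs. f x j n)) \<psi> = lmult \<theta> (f x j) \<psi> + lmult \<theta> (\<lambda>n. \<Sum>x\<leftarrow>xs. f x j n) \<psi>" for j
    using Cons.prems by (intro lmult_add_left smooth_abs_summable smooth_sum_list) auto
  then show ?case using Cons by (simp add: one_form_def spin_op_add sum.distrib)
qed

lemma lmult_one_form:
  assumes "p \<in> smooth" "\<And>j. c j \<in> smooth"
  shows "lmult \<theta> p (one_form \<theta> c \<psi>) = one_form \<theta> (\<lambda>j. tmul \<theta> p (c j)) \<psi>"
  by (simp add: one_form_def linear_sum[OF linear_lmult[OF assms(1)]] lmult_spin_op[OF smooth_abs_summable[OF assms(1)]] lmult_lmult assms)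

lemma one_form_lmult:
  assumes "a \<in> smooth" "\<And>j. c j \<in> smooth"
  shows "one_form \<theta> c (lmult \<theta> a \<psi>) = one_form \<theta> (\<lambda>j. tmul \<theta> (c j) a) \<psi>"
  by (simp add: one_form_def lmult_lmult assms)

lemma Rep_one_form_unit_at:
  assumes "\<And>j. c j \<in> smooth"
  shows "Rep_hil (one_form \<theta> c (unit_at p v)) n =
    (\<Sum>j\<in>UNIV. (c j (n - p) * cis (pi * theta_form \<theta> (n - p) p)) *s (gamma j *v v))"
  by (simp add: one_form_def Rep_hil_simps Rep_lmult_unit_at[OF smooth_abs_summable[OF assms]]
      vector_scalar_commute)

text \<open>
  On a field supported at the origin a one-form returns its coefficients, each paired with its
  gamma matrix.
\<close>

lemma one_form_injective:
  assumes c: "\<And>j. c j \<in> smooth" and d: "\<And>j. d j \<in> smooth" and eq: "one_form \<theta> c = one_form \<theta> d"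
  shows "c = d"
proof (intro ext)
  fix j n
  have "c j n - d j n = 0"
  proof (rule gamma_independent[of "\<lambda>j. c j n - d j n"])
    fix v
    have "(\<Sum>j\<in>UNIV. c j n *s (gamma j *v v)) = (\<Sum>j\<in>UNIV. d j n *s (gamma j *v v))"
      using Rep_one_form_unit_at[of c \<theta> 0 v n, OF c] Rep_one_form_unit_at[of d \<theta> 0 v n, OF d]
      by (simp add: eq theta_form_simps)
    then show "(\<Sum>j\<in>UNIV. (c j n - d j n) *s (gamma j *v v)) = 0"
      by (simp add: vector_sub_rdistrib sum_subtractf)
  qed
  then show "c j n = d j n" by simp
qed

lemma flatD_eq:
  "flatD \<psi> = (if \<psi> \<in> sobolev then Some (\<Sum>j\<in>UNIV. spin_op (gamma j) (grad j \<psi>)) else None)"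
proof -
  have U: "{1, 2, 3, 4} = (UNIV :: 4 set)" using exhaust_4 by auto
  show ?thesis
    unfolding flatD_def op_sum_def U
    by (auto simp: sobolev_def grad_def option.map_sel domIff intro!: sum.cong)
qed

lemma dom_flatD: "dom flatD = sobolev"
  by (auto simp: flatD_eq dom_def split: if_splits)

lemma comm_eqI:
  assumes "has_comm T A X" "closure (dom T) = UNIV"
  shows "comm T A = X"
  unfolding comm_def
proof (rule the_equality)
  fix Y assume Y: "has_comm T A Y"
  show "Y = X"
  proof (rule bounded_linear_eq_on_dense[OF _ _ assms(2)])
    show "bounded_linear Y" "bounded_linear X" using Y assms(1) by (auto simp: has_comm_def)
    fix \<psi> assume "\<psi> \<in> dom T"
    then obtain \<phi> where "T \<psi> = Some \<phi>" by auto
    then have "Some (A \<phi> + X \<psi>) = Some (A \<phi> + Y \<psi>)"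
      using Y assms(1) by (metis has_comm_def)
    then show "Y \<psi> = X \<psi>" by simp
  qed
qed (rule assms(1))

lemma comm_flatD_lmult:
  assumes a: "a \<in> smooth"
  shows "comm flatD (lmult \<theta> a) = one_form \<theta> (\<lambda>j. der j a)"
proof (rule comm_eqI)
  have "flatD (lmult \<theta> a \<psi>) = Some (lmult \<theta> a \<phi> + one_form \<theta> (\<lambda>j. der j a) \<psi>)" if "flatD \<psi> = Some \<phi>" for \<psi> \<phi>
  proof -
    have \<psi>: "\<psi> \<in> sobolev" "\<phi> = (\<Sum>j\<in>UNIV. spin_op (gamma j) (grad j \<psi>))"
      using that by (auto simp: flatD_eq split: if_splits)
    have "lmult \<theta> a \<phi> = (\<Sum>j\<in>UNIV. spin_op (gamma j) (lmult \<theta> a (grad j \<psi>)))"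
      unfolding \<psi>(2) linear_sum[OF linear_lmult[OF a]]
      by (simp add: lmult_spin_op[OF smooth_abs_summable[OF a]])
    then show ?thesis
      by (simp add: flatD_eq sobolev_lmult[OF a \<psi>(1)] one_form_def spin_op_add sum.distrib)
  qed
  then show "has_comm flatD (lmult \<theta> a) (one_form \<theta> (\<lambda>j. der j a))"
    unfolding has_comm_def by (auto intro: bounded_linear_one_form smooth_der a)
qed (simp add: dom_flatD closure_sobolev)

definition form_coeff ::
  "real^4^4 \<Rightarrow> ((int^4 \<Rightarrow> complex) \<times> (int^4 \<Rightarrow> complex)) list \<Rightarrow> 4 \<Rightarrow> int^4 \<Rightarrow> complex" where
  "form_coeff \<theta> xs j n = (\<Sum>(p, q)\<leftarrow>xs. tmul \<theta> p (der j q) n)"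

lemma form_coeff_eq: "form_coeff \<theta> xs j = (\<lambda>n. \<Sum>x\<leftarrow>xs. tmul \<theta> (fst x) (der j (snd x)) n)"
  by (simp add: fun_eq_iff form_coeff_def split_def)

lemma smooth_form_coeff: "xs \<in> lists (smooth \<times> smooth) \<Longrightarrow> form_coeff \<theta> xs j \<in> smooth"
  unfolding form_coeff_eq by (intro smooth_sum_list smooth_tmul smooth_der) (auto simp: in_lists_conv_set)

lemma form_eq_one_form:
  assumes "xs \<in> lists (smooth \<times> smooth)"
  shows "form \<theta> xs = one_form \<theta> (form_coeff \<theta> xs)"
proof
  fix \<psi>
  have sm: "fst x \<in> smooth \<and> snd x \<in> smooth" if "x \<in> set xs" for x
    using assms that by (auto simp: in_lists_conv_set)
  have "form \<theta> xs \<psi> = (\<Sum>x\<leftarrow>xs. lmult \<theta> (fst x) (one_form \<theta> (\<lambda>j. der j (snd x)) \<psi>))"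
    unfolding form_def using sm
    by (intro arg_cong[where f = sum_list] map_cong) (auto simp: comm_flatD_lmult case_prod_beta)
  also have "\<dots> = (\<Sum>x\<leftarrow>xs. one_form \<theta> (\<lambda>j. tmul \<theta> (fst x) (der j (snd x))) \<psi>)"
    using sm by (intro arg_cong[where f = sum_list] map_cong) (auto simp: lmult_one_form smooth_der)
  also have "\<dots> = one_form \<theta> (form_coeff \<theta> xs) \<psi>"
    unfolding form_coeff_eq[abs_def] using sm by (intro one_form_sum_list smooth_tmul smooth_der) auto
  finally show "form \<theta> xs \<psi> = one_form \<theta> (form_coeff \<theta> xs) \<psi>" .
qed

lemma smooth_gen: "gen j \<in> smooth" "star (gen j) \<in> smooth"
  by (simp_all add: gen_eq_monomial smooth_monomial smooth_star)

lemma base_gen: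
  assumes "j \<noteq> 4" shows "gen j \<in> base" "star (gen j) \<in> base"
proof -
  have "star (gen j) = monomial (- axis j 1)"
    by (auto simp: fun_eq_iff star_def gen_def monomial_def minus_equation_iff[of _ "axis j 1"])
  then show "gen j \<in> base" "star (gen j) \<in> base"
    using monomial_homog[of "axis j 1"] monomial_homog[of "- axis j 1"] assms
    by (simp_all add: gen_eq_monomial axis_def)
qed

lemma tmul_star_gen_der_gen:
  assumes "transpose \<theta> = - \<theta>"
  shows "tmul \<theta> (star (gen j)) (der i (gen j)) = (if i = j then tone else (\<lambda>n. 0))"
  by (simp add: der_gen tmul_zero gen_unitary[OF assms])

lemma form_gen:
  assumes "transpose \<theta> = - \<theta>"
  shows "form \<theta> [(star (gen j), gen j)] = spin_op (gamma j)"
proof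
  fix \<psi>
  have "form_coeff \<theta> [(star (gen j), gen j)] i = (if i = j then tone else (\<lambda>n. 0))" for i
    by (simp add: form_coeff_eq tmul_star_gen_der_gen[OF assms])
  moreover have "spin_op (gamma i) (lmult \<theta> (if i = j then tone else (\<lambda>n. 0)) \<psi>) =
      (if i = j then spin_op (gamma i) \<psi> else 0)" for i
    by (simp add: lmult_tone lmult_zero spin_op_zero)
  ultimately show "form \<theta> [(star (gen j), gen j)] \<psi> = spin_op (gamma j) \<psi>"
    by (simp add: form_eq_one_form smooth_gen one_form_def)
qed

section \<open>Strong connections\<close>

lemma connection_form_eq: "connection_form \<theta> w = one_form \<theta> (w(4 := tone))"
proof
  fix \<psi>
  have "(\<Sum>j\<in>{1, 2, 3}. spin_op (gamma j) (lmult \<theta> ((w(4 := tone)) j) \<psi>)) =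
      (\<Sum>j\<in>{1, 2, 3}. spin_op (gamma j) (lmult \<theta> (w j) \<psi>))"
    by (intro sum.cong) auto
  then show "connection_form \<theta> w \<psi> = one_form \<theta> (w(4 := tone)) \<psi>"
    by (simp only: connection_form_def one_form_def sum_UNIV_4) (simp add: lmult_tone)
qed

lemma gamma_4_eq_connection_form: "spin_op (gamma 4) = connection_form \<theta> (\<lambda>_ _. 0)"
  by (rule ext) (simp add: connection_form_def lmult_zero spin_op_zero)

lemma smooth_tone: "tone \<in> smooth"
  by (simp add: tone_eq_monomial smooth_monomial)

text \<open>
  The vertical component of a strong connection is normalised by its second axiom; invariance
  under \<open>\<delta>\<^sub>4\<close>, tested on the cyclic vector, puts the other components into the base algebra.
\<close>

lemma strong_connectionD:
  assumes "strong_connection \<theta> \<omega>"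
  obtains w where "\<And>j. w j \<in> base" "\<omega> = connection_form \<theta> w"
proof -
  obtain xs where xs: "xs \<in> lists (smooth \<times> smooth)" "\<omega> = form \<theta> xs"
    using assms by (auto simp: strong_connection_def Omega1_def)
  define c where "c = form_coeff \<theta> xs"
  have c: "c j \<in> smooth" for j unfolding c_def by (rule smooth_form_coeff[OF xs(1)])
  have \<omega>: "\<omega> = one_form \<theta> c" unfolding c_def xs(2) by (rule form_eq_one_form[OF xs(1)])
  have "c 4 = tone"
    using assms xs by (simp add: strong_connection_def c_def form_coeff_def[abs_def])
  have "c j n = 0" if "n $ 4 \<noteq> 0" for j n
  proof (rule gamma_independent[of "\<lambda>j. c j n"])
    fix v
    have "delta 4 (unit_at 0 v) = Some 0"
      by (simp add: delta_eq_Some_iff Rep_hil_simps Rep_unit_at)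
    then have "delta 4 (\<omega> (unit_at 0 v)) = Some (\<omega> 0)"
      using assms by (auto simp: strong_connection_def has_comm_def)
    moreover have "\<omega> 0 = 0"
      unfolding \<omega> by (rule linear_0[OF bounded_linear.linear[OF bounded_linear_one_form[OF c]]])
    ultimately have "Rep_hil (\<omega> (unit_at 0 v)) n = 0"
      using that by (auto simp: delta_eq_Some_iff Rep_hil_simps dest: spec[of _ n])
    then show "(\<Sum>j\<in>UNIV. c j n *s (gamma j *v v)) = 0"
      unfolding \<omega> by (simp add: Rep_one_form_unit_at[of c, OF c] theta_form_simps)
  qed
  then have "c j \<in> base" for j using c by (simp add: homog_iff)
  moreover have "\<omega> = connection_form \<theta> c"
    unfolding \<omega> connection_form_eq using \<open>c 4 = tone\<close> by (simp add: fun_upd_idem)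
  ultimately show ?thesis by (rule that)
qed

text \<open>
  The normalisation of the vertical coefficient cancels the vertical part of \<open>[D, a]\<close>.
\<close>

lemma nabla_connection_form:
  assumes w: "\<And>j. w j \<in> smooth" and a: "a \<in> smooth"
  shows "nabla \<theta> (connection_form \<theta> w) a =
    one_form \<theta> (\<lambda>j n. if j = 4 then 0 else der j a n - tmul \<theta> (der 4 a) (w j) n)"
proof
  fix \<psi>
  let ?c = "w(4 := tone)"
  have c: "?c j \<in> smooth" for j using w smooth_tone by auto
  have "nabla \<theta> (connection_form \<theta> w) a \<psi> =
      one_form \<theta> (\<lambda>j. der j a) \<psi> - one_form \<theta> (\<lambda>j. tmul \<theta> (der 4 a) (?c j)) \<psi>"
    unfolding nabla_def connection_form_eq
    by (simp only: comm_flatD_lmult[OF a] lmult_one_form[OF smooth_der[OF a] c])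
  also have "\<dots> = one_form \<theta> (\<lambda>j n. der j a n - tmul \<theta> (der 4 a) (?c j) n) \<psi>"
    unfolding one_form_def
    by (simp only: lmult_diff_left[OF smooth_der[OF a] smooth_tmul[OF smooth_der[OF a] c]]
        spin_op_diff sum_subtractf)
  also have "(\<lambda>j n. der j a n - tmul \<theta> (der 4 a) (?c j) n) =
      (\<lambda>j n. if j = 4 then 0 else der j a n - tmul \<theta> (der 4 a) (w j) n)"
    by (auto simp: fun_eq_iff tmul_tone_right)
  finally show "nabla \<theta> (connection_form \<theta> w) a \<psi> =
    one_form \<theta> (\<lambda>j n. if j = 4 then 0 else der j a n - tmul \<theta> (der 4 a) (w j) n) \<psi>" .
qed

lemma strong_connection_gamma_4:
  assumes skew: "transpose \<theta> = - \<theta>"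
  shows "strong_connection \<theta> (spin_op (gamma 4))"
  unfolding strong_connection_def
proof (intro conjI ballI impI)
  show "spin_op (gamma 4) \<in> Omega1 \<theta> smooth"
    unfolding Omega1_def form_gen[OF skew, symmetric] by (rule imageI) (simp add: smooth_gen)
  show "has_comm (delta 4) (spin_op (gamma 4)) (\<lambda>_. 0)"
    by (auto simp: has_comm_def bounded_linear_zero intro: delta_spin_op)
next
  fix xs assume xs: "xs \<in> lists (smooth \<times> smooth)" "spin_op (gamma 4) = form \<theta> xs"
  have "form_coeff \<theta> xs = (\<lambda>_ _. 0)(4 := tone)"
  proof (rule one_form_injective)
    show "one_form \<theta> (form_coeff \<theta> xs) = one_form \<theta> ((\<lambda>_ _. 0)(4 := tone))"
      unfolding form_eq_one_form[OF xs(1), symmetric] xs(2)[symmetric]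
      by (simp only: gamma_4_eq_connection_form[of \<theta>] connection_form_eq)
  qed (auto simp: smooth_form_coeff[OF xs(1)] smooth_tone smooth_zero)
  then have "form_coeff \<theta> xs 4 = tone" by simp
  then show "(\<lambda>n. \<Sum>(p, q)\<leftarrow>xs. tmul \<theta> p (der 4 q) n) = tone"
    by (simp add: form_coeff_def[abs_def])
next
  fix a :: "int^4 \<Rightarrow> complex" assume a: "a \<in> smooth"
  let ?xs = "map (\<lambda>j. (form \<theta> [(star (gen j), gen j)], der j a)) [1, 2, 3]"
  have "nabla \<theta> (spin_op (gamma 4)) a = (\<lambda>\<psi>. \<Sum>(\<eta>, a)\<leftarrow>?xs. \<eta> (lmult \<theta> a \<psi>))"
  proof
    fix \<psi>
    have "nabla \<theta> (spin_op (gamma 4)) a =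
        one_form \<theta> (\<lambda>j n. if j = 4 then 0 else der j a n - tmul \<theta> (der 4 a) (\<lambda>n. 0) n)"
      unfolding gamma_4_eq_connection_form[of \<theta>] by (rule nabla_connection_form[OF smooth_zero a])
    then show "nabla \<theta> (spin_op (gamma 4)) a \<psi> = (\<Sum>(\<eta>, a)\<leftarrow>?xs. \<eta> (lmult \<theta> a \<psi>))"
      by (simp add: form_gen[OF skew] one_form_def sum_UNIV_4 tmul_zero lmult_zero spin_op_zero)
  qed
  moreover have "?xs \<in> lists (Omega1 \<theta> base \<times> smooth)"
    by (auto simp: Omega1_def smooth_der a intro!: imageI) (simp_all add: base_gen)
  ultimately show "nabla \<theta> (spin_op (gamma 4)) a \<in> Omega1_base_smooth \<theta>"
    unfolding Omega1_base_smooth_def by (intro image_eqI[of _ _ ?xs])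
qed

section \<open>The twisted Dirac operator\<close>

text \<open>
  Every representation of the one-form as \<open>\<Sum> b' [D, b] a\<close> has the same coefficients by
  injectivity, and the right action only depends on them: the three right multiplications compose,
  in reversed order, to the right multiplication by \<open>b' \<delta>\<^sub>j(b) a\<close>.  A representation exists since
  \<open>U\<^sub>j\<^sup>* [D, U\<^sub>j] = \<gamma>\<^sup>j\<close>.
\<close>

lemma form_right_one_form:
  assumes skew: "transpose \<theta> = - \<theta>" and c: "\<And>j. c j \<in> smooth" and c4: "c 4 = (\<lambda>n. 0)"
  shows "form_right \<theta> h (one_form \<theta> c) = one_form (transpose \<theta>) c h"
  unfolding form_right_def
proof (rule the_equality)
  let ?L = "lists (base \<times> base \<times> smooth)"
  let ?l = "\<lambda>xs \<psi>. \<Sum>(b', b, a)\<leftarrow>xs. lmult \<theta> b' (comm flatD (lmult \<theta> b) (lmult \<theta> a \<psi>))"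
  let ?r = "\<lambda>xs. \<Sum>(b', b, a)\<leftarrow>xs. rmult \<theta> a (comm flatD (rmult \<theta> b) (rmult \<theta> b' h))"
  define k where "k = (\<lambda>x j. case x of (b', b, a) \<Rightarrow> tmul \<theta> (tmul \<theta> b' (der j b)) a)"
  define K where "K = (\<lambda>xs j n. \<Sum>x\<leftarrow>xs. k x j n)"
  have elem: "\<exists>b' b a. x = (b', b, a) \<and> b' \<in> smooth \<and> b \<in> smooth \<and> a \<in> smooth"
    if "x \<in> set xs" "xs \<in> ?L" for x xs
  proof -
    obtain b' b a where x: "x = (b', b, a)" by (cases x)
    then have "b' \<in> base" "b \<in> base" "a \<in> smooth" using that by (auto simp: lists_eq_set)
    then show ?thesis using x homog_smooth by blast
  qed
  have k: "k x j \<in> smooth" if "x \<in> set xs" "xs \<in> ?L" for x j xs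
    using elem[OF that] by (auto simp: k_def intro!: smooth_tmul smooth_der)
  have K: "K xs j \<in> smooth" if "xs \<in> ?L" for xs j
    unfolding K_def using k that by (intro smooth_sum_list) auto
  have l: "?l xs = one_form \<theta> (K xs)" if xs: "xs \<in> ?L" for xs
  proof
    fix \<psi>
    have "?l xs \<psi> = (\<Sum>x\<leftarrow>xs. one_form \<theta> (k x) \<psi>)"
    proof (intro arg_cong[where f = sum_list] map_cong refl)
      fix x assume "x \<in> set xs"
      then obtain b' b a where x: "x = (b', b, a)" "b' \<in> smooth" "b \<in> smooth" "a \<in> smooth"
        using elem[OF _ xs] by blast
      then show "(case x of (b', b, a) \<Rightarrow> lmult \<theta> b' (comm flatD (lmult \<theta> b) (lmult \<theta> a \<psi>))) = one_form \<theta> (k x) \<psi>"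
        by (simp add: k_def comm_flatD_lmult lmult_one_form one_form_lmult smooth_der smooth_tmul)
    qed
    then show "?l xs \<psi> = one_form \<theta> (K xs) \<psi>"
      unfolding K_def using k[OF _ xs] by (simp add: one_form_sum_list)
  qed
  have r: "?r xs = one_form (transpose \<theta>) (K xs) h" if xs: "xs \<in> ?L" for xs
  proof -
    have "?r xs = (\<Sum>x\<leftarrow>xs. one_form (transpose \<theta>) (k x) h)"
    proof (intro arg_cong[where f = sum_list] map_cong refl)
      fix x assume "x \<in> set xs"
      then obtain b' b a where x: "x = (b', b, a)" "b' \<in> smooth" "b \<in> smooth" "a \<in> smooth"
        using elem[OF _ xs] by blast
      then show "(case x of (b', b, a) \<Rightarrow> rmult \<theta> a (comm flatD (rmult \<theta> b) (rmult \<theta> b' h))) =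
          one_form (transpose \<theta>) (k x) h"
        by (simp add: k_def rmult_eq_lmult_fun[OF skew] comm_flatD_lmult lmult_one_form one_form_lmult
            smooth_der smooth_tmul tmul_transpose)
    qed
    then show ?thesis
      unfolding K_def using k[OF _ xs] by (simp add: one_form_sum_list)
  qed
  {
    fix v assume "\<exists>xs\<in>?L. one_form \<theta> c = ?l xs \<and> v = ?r xs"
    then obtain xs where xs: "xs \<in> ?L" "one_form \<theta> c = ?l xs" "v = ?r xs" by blast
    have "c = K xs"
      by (rule one_form_injective[OF c K[OF xs(1)]]) (use xs l in simp)
    then show "v = one_form (transpose \<theta>) c h" using xs r by simp
  }
  let ?xs = "map (\<lambda>j. (star (gen j), gen j, c j)) [1, 2, 3]"
  have xs: "?xs \<in> ?L" by (simp add: base_gen c)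
  have "K ?xs = c"
  proof (intro ext)
    fix j n
    show "K ?xs j n = c j n"
      using exhaust_4[of j]
      by (auto simp: K_def k_def tmul_star_gen_der_gen[OF skew] tmul_tone_left tmul_zero c4)
  qed
  then have "one_form \<theta> c = ?l ?xs" "one_form (transpose \<theta>) c h = ?r ?xs"
    using l[OF xs] r[OF xs] by simp_all
  then show "\<exists>xs\<in>?L. one_form \<theta> c = ?l xs \<and> one_form (transpose \<theta>) c h = ?r xs"
    using xs by blast
qed

text \<open>
  The expected closed form \<open>\<Sum>\<^sub>j \<gamma>\<^sup>j (\<delta>\<^sub>j - R\<^sub>j \<delta>\<^sub>4)\<close> of the twisted Dirac operator, and below its
  completion by the vertical part.  Both are meaningful on \<open>sobolev\<close> only.
\<close>

definition horizontal :: "real^4^4 \<Rightarrow> (4 \<Rightarrow> int^4 \<Rightarrow> complex) \<Rightarrow> hil \<Rightarrow> hil" where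
  "horizontal \<theta> w \<psi> =
     (\<Sum>j\<in>{1, 2, 3}. spin_op (gamma j) (grad j \<psi> - rmult \<theta> (w j) (grad 4 \<psi>)))"

definition full_dirac :: "real^4^4 \<Rightarrow> (4 \<Rightarrow> int^4 \<Rightarrow> complex) \<Rightarrow> hil \<Rightarrow> hil" where
  "full_dirac \<theta> w \<psi> = horizontal \<theta> w \<psi> + spin_op (gamma 4) (grad 4 \<psi>)"

lemma rmult_zero: "transpose \<theta> = - \<theta> \<Longrightarrow> rmult \<theta> (\<lambda>n. 0) h = 0"
  by (simp add: rmult_eq_lmult_fun smooth_zero lmult_zero)

lemma flatD_eq_full_dirac:
  assumes "transpose \<theta> = - \<theta>"
  shows "flatD \<psi> = (if \<psi> \<in> sobolev then Some (full_dirac \<theta> (\<lambda>_ _. 0) \<psi>) else None)"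
  unfolding flatD_eq by (simp add: full_dirac_def horizontal_def sum_UNIV_4 rmult_zero[OF assms])

lemma connection_dirac_eq:
  assumes "\<And>j. j \<in> {1, 2, 3} \<Longrightarrow> star (w j) = w j"
  shows "connection_dirac \<theta> w \<psi> = (if \<psi> \<in> sobolev then Some (full_dirac \<theta> w \<psi>) else None)"
proof -
  let ?V = "op_sum (\<lambda>j. map_option (\<lambda>\<phi>. spin_op (gamma j) (J (lmult \<theta> (w j) (inv J \<phi>)))) \<circ> delta 4) {1, 2, 3}"
  have "?V \<psi> = Some (\<Sum>j\<in>{1, 2, 3}. spin_op (gamma j) (rmult \<theta> (w j) (grad 4 \<psi>)))" if "\<psi> \<in> sobolev"
    using delta_sobolev[OF that, of 4] assms
    by (simp add: op_sum_def rmult_def dom_def)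
  then show ?thesis
    by (simp add: connection_dirac_def op_diff_def dom_flatD domIff flatD_eq full_dirac_def horizontal_def
        sum_UNIV_4 spin_op_diff algebra_simps)
qed

lemma horizontal_gamma_4:
  assumes skew: "transpose \<theta> = - \<theta>" and w: "\<And>j. j \<in> {1, 2, 3} \<Longrightarrow> w j \<in> smooth" and \<psi>: "\<psi> \<in> sobolev"
  shows "horizontal \<theta> w (spin_op (gamma 4) \<psi>) = - spin_op (gamma 4) (horizontal \<theta> w \<psi>)"
proof -
  have "spin_op (gamma j) (spin_op (gamma 4) \<phi>) = - spin_op (gamma 4) (spin_op (gamma j) \<phi>)"
    if "j \<in> {1, 2, 3}" for j \<phi>
    by (rule spin_gamma_anticommute) (use that in auto)
  then show ?thesis
    unfolding horizontal_def spin_op_sum sum_negf[symmetric]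
    by (intro sum.cong refl)
      (simp add: sobolev_spin_op[OF \<psi>] rmult_eq_lmult_fun[OF skew w] lmult_spin_op[OF smooth_abs_summable[OF w]]
        flip: spin_op_diff)
qed

text \<open>
  Half of \<open>\<Gamma> [\<Gamma>, \<cdot>]\<close> projects onto the part that anticommutes with \<open>\<Gamma> = \<gamma>\<^sup>4\<close>.
\<close>

lemma hor_eq_horizontal:
  assumes skew: "transpose \<theta> = - \<theta>" and w: "\<And>j. j \<in> {1, 2, 3} \<Longrightarrow> w j \<in> smooth"
    and T: "\<And>\<psi>. T \<psi> = (if \<psi> \<in> sobolev then Some (full_dirac \<theta> w \<psi>) else None)"
  shows "hor T \<psi> = (if \<psi> \<in> sobolev then Some (horizontal \<theta> w \<psi>) else None)"
proof (cases "\<psi> \<in> sobolev")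
  case True
  let ?G = "spin_op (gamma 4)" and ?h = "horizontal \<theta> w \<psi>"
  have hG: "horizontal \<theta> w (?G \<psi>) = - ?G ?h"
    by (rule horizontal_gamma_4[OF skew _ True]) (rule w)
  have "?G (full_dirac \<theta> w \<psi>) - full_dirac \<theta> w (?G \<psi>) = 2 *\<^sub>R ?G ?h"
    by (simp add: full_dirac_def hG sobolev_spin_op[OF True] spin_op_add scaleR_2)
  then show ?thesis
    using True sobolev_spin_op(1)[OF True]
    by (simp add: hor_def op_diff_def T dom_def spin_op_scaleR spin_gamma_square)
next
  case False
  then show ?thesis by (simp add: hor_def op_diff_def T domIff)
qed

text \<open>
  The computation behind the twisted Dirac operator: for \<open>h\<close> of degree zero the Leibniz rule
  gives \<open>\<delta>\<^sub>j (h a) - (\<delta>\<^sub>4 (h a)) \<omega>\<^sub>j = (\<delta>\<^sub>j h) a + h (\<delta>\<^sub>j(a) - \<delta>\<^sub>4(a) \<omega>\<^sub>j)\<close>, and the last bracket is the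
  coefficient of \<open>\<gamma>\<^sup>j\<close> in the covariant derivative of \<open>a\<close>.
\<close>

lemma horizontal_rmult:
  assumes skew: "transpose \<theta> = - \<theta>" and w: "\<And>j. w j \<in> smooth"
    and h: "h \<in> hil_deg 0" "h \<in> sobolev" and a: "a \<in> smooth"
  shows "rmult \<theta> a h \<in> sobolev"
    and "horizontal \<theta> w (rmult \<theta> a h) =
      rmult \<theta> a (horizontal \<theta> (\<lambda>_ _. 0) h) + form_right \<theta> h (nabla \<theta> (connection_form \<theta> w) a)"
proof -
  let ?R = "lmult (transpose \<theta>)"
  note sm = a w smooth_der smooth_tmul
  show S: "rmult \<theta> a h \<in> sobolev"
    by (simp add: rmult_eq_lmult_fun[OF skew] sm sobolev_lmult h)
  have g4: "grad 4 h = 0" using h(1) by (simp add: hil_deg_def grad_def)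
  let ?c = "\<lambda>j n. if j = (4::4) then 0 else der j a n - tmul \<theta> (der 4 a) (w j) n"
  have "form_right \<theta> h (nabla \<theta> (connection_form \<theta> w) a) = one_form (transpose \<theta>) ?c h"
    unfolding nabla_connection_form[OF w a]
  proof (rule form_right_one_form[OF skew])
    show "?c j \<in> smooth" for j
      by (cases "j = 4") (simp_all add: smooth_zero smooth_diff sm)
  qed simp
  also have "\<dots> = (\<Sum>j\<in>{1, 2, 3}. spin_op (gamma j) (?R (der j a) h - ?R (w j) (?R (der 4 a) h)))"
    by (simp add: one_form_def sum_UNIV_4 lmult_zero spin_op_zero lmult_diff_left sm lmult_lmult tmul_transpose)
  finally have f: "form_right \<theta> h (nabla \<theta> (connection_form \<theta> w) a) =
      (\<Sum>j\<in>{1, 2, 3}. spin_op (gamma j) (?R (der j a) h - ?R (w j) (?R (der 4 a) h)))" .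
  have r1: "rmult \<theta> a (horizontal \<theta> (\<lambda>_ _. 0) h) = (\<Sum>j\<in>{1, 2, 3}. spin_op (gamma j) (?R a (grad j h)))"
    by (simp add: horizontal_def rmult_eq_lmult_fun[OF skew] sm smooth_zero lmult_zero
        linear_add[OF linear_lmult[OF a]] lmult_spin_op smooth_abs_summable[OF a])
  have r2: "horizontal \<theta> w (rmult \<theta> a h) =
      (\<Sum>j\<in>{1, 2, 3}. spin_op (gamma j) (?R a (grad j h) + (?R (der j a) h - ?R (w j) (?R (der 4 a) h))))"
    by (simp add: horizontal_def rmult_eq_lmult_fun[OF skew] sm sobolev_lmult h g4 linear_0[OF linear_lmult[OF a]] algebra_simps)
  show "horizontal \<theta> w (rmult \<theta> a h) =
      rmult \<theta> a (horizontal \<theta> (\<lambda>_ _. 0) h) + form_right \<theta> h (nabla \<theta> (connection_form \<theta> w) a)"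
    unfolding f r1 r2 by (simp only: spin_op_add sum.distrib)
qed

lemma horizontal_add:
  assumes skew: "transpose \<theta> = - \<theta>" and w: "\<And>j. w j \<in> smooth" and "\<psi> \<in> sobolev" "\<phi> \<in> sobolev"
  shows "horizontal \<theta> w (\<psi> + \<phi>) = horizontal \<theta> w \<psi> + horizontal \<theta> w \<phi>"
  by (simp add: horizontal_def rmult_eq_lmult_fun[OF skew w] sobolev_add assms linear_add[OF linear_lmult[OF w]]
      spin_op_add spin_op_diff algebra_simps)

text \<open>
  The right-hand side does not depend on how the vector is decomposed, which makes the definite
  description in the definition meaningful.  A field supported at \<open>n\<close> is the right translate of one
  supported at the origin by the monomial of index \<open>n\<close>, so the domain contains all finitely
  supported fields.
\<close>

lemma twisted_dirac_eq:
  assumes skew: "transpose \<theta> = - \<theta>" and w: "\<And>j. w j \<in> base"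
  shows "twisted_dirac \<theta> (connection_form \<theta> w) \<psi> = Some \<phi> \<Longrightarrow> \<psi> \<in> sobolev \<and> \<phi> = horizontal \<theta> w \<psi>"
    and "finite F \<Longrightarrow> (\<Sum>n\<in>F. unit_at n (f n)) \<in> dom (twisted_dirac \<theta> (connection_form \<theta> w))"
proof -
  let ?X = "(hil_deg 0 \<inter> dom (hor flatD)) \<times> (\<Union>k. homog k)"
  let ?v = "\<lambda>(h, a). rmult \<theta> a (the (hor flatD h)) + form_right \<theta> h (nabla \<theta> (connection_form \<theta> w) a)"
  let ?u = "\<lambda>(h, a). rmult \<theta> a h"
  have hor: "hor flatD \<psi> = (if \<psi> \<in> sobolev then Some (horizontal \<theta> (\<lambda>_ _. 0) \<psi>) else None)" for \<psi>
    by (rule hor_eq_horizontal[OF skew smooth_zero flatD_eq_full_dirac[OF skew]])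
  have one: "?u x \<in> sobolev \<and> horizontal \<theta> w (?u x) = ?v x" if "x \<in> ?X" for x
  proof -
    obtain h a k where x: "x = (h, a)" "h \<in> hil_deg 0" "h \<in> sobolev" "a \<in> homog k"
      using \<open>x \<in> ?X\<close> by (auto simp: hor split: if_splits)
    show ?thesis
      using horizontal_rmult[OF skew homog_smooth[OF w] x(2,3) homog_smooth[OF x(4)]] x(3)
      by (simp add: x(1) hor)
  qed
  have list: "(\<Sum>x\<leftarrow>xs. ?u x) \<in> sobolev \<and> horizontal \<theta> w (\<Sum>x\<leftarrow>xs. ?u x) = (\<Sum>x\<leftarrow>xs. ?v x)"
    if "xs \<in> lists ?X" for xs
    using that
  proof (induction xs)
    case Nil
    then show ?case
      by (simp add: sobolev_zero horizontal_def grad_zero rmult_eq_lmult_fun[OF skew homog_smooth[OF w]]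
          linear_0[OF linear_lmult[OF homog_smooth[OF w]]] spin_op_zero)
  next
    case (Cons x xs)
    then show ?case
      using one[of x] by (simp add: sobolev_add horizontal_add[OF skew homog_smooth[OF w]])
  qed
  {
    assume "twisted_dirac \<theta> (connection_form \<theta> w) \<psi> = Some \<phi>"
    then obtain xs0 where xs0: "xs0 \<in> lists ?X" "\<psi> = (\<Sum>x\<leftarrow>xs0. ?u x)"
      and \<phi>: "\<phi> = (THE v. \<exists>xs\<in>{xs \<in> lists ?X. \<psi> = (\<Sum>x\<leftarrow>xs. ?u x)}. v = (\<Sum>x\<leftarrow>xs. ?v x))"
      by (auto simp: twisted_dirac_def Let_def split: if_splits)
    have "\<phi> = horizontal \<theta> w \<psi>"
      unfolding \<phi>
    proof (rule the_equality)
      show "\<exists>xs\<in>{xs \<in> lists ?X. \<psi> = (\<Sum>x\<leftarrow>xs. ?u x)}. horizontal \<theta> w \<psi> = (\<Sum>x\<leftarrow>xs. ?v x)"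
        using xs0 list[OF xs0(1)] by (intro bexI[of _ xs0]) simp_all
      show "v = horizontal \<theta> w \<psi>"
        if "\<exists>xs\<in>{xs \<in> lists ?X. \<psi> = (\<Sum>x\<leftarrow>xs. ?u x)}. v = (\<Sum>x\<leftarrow>xs. ?v x)" for v
      proof -
        from that obtain xs where xs: "xs \<in> {xs \<in> lists ?X. \<psi> = (\<Sum>x\<leftarrow>xs. ?u x)}"
          and v: "v = (\<Sum>x\<leftarrow>xs. ?v x)" by (rule bexE)
        then have "xs \<in> lists ?X" "\<psi> = (\<Sum>x\<leftarrow>xs. ?u x)" by (simp_all only: mem_Collect_eq)
        then show ?thesis using list[of xs] v by simp
      qed
    qed
    then show "\<psi> \<in> sobolev \<and> \<phi> = horizontal \<theta> w \<psi>" using list[OF xs0(1)] xs0(2) by simp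
  }
  assume "finite F"
  then obtain ns where ns: "set ns = F" "distinct ns" using finite_distinct_list by blast
  let ?xs = "map (\<lambda>n. (unit_at 0 (f n), monomial n)) ns"
  have "unit_at 0 v \<in> hil_deg 0" for v
    by (simp add: hil_deg_def delta_eq_Some_iff Rep_hil_simps Rep_unit_at)
  then have "?xs \<in> lists ?X"
    using monomial_homog by (auto simp: in_lists_conv_set hor sobolev_unit_at dom_def)
  moreover have "(\<Sum>n\<in>F. unit_at n (f n)) = (\<Sum>x\<leftarrow>?xs. ?u x)"
    by (simp add: rmult_eq_lmult_fun[OF skew smooth_monomial] lmult_monomial_unit_at o_def
        sum_list_distinct_conv_sum_set[OF ns(2)] ns(1))
  ultimately have "{xs \<in> lists ?X. (\<Sum>n\<in>F. unit_at n (f n)) = (\<Sum>x\<leftarrow>xs. ?u x)} \<noteq> {}" by blast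
  then show "(\<Sum>n\<in>F. unit_at n (f n)) \<in> dom (twisted_dirac \<theta> (connection_form \<theta> w))"
    by (simp add: twisted_dirac_def Let_def dom_def)
qed

lemma closure_dom_twisted_dirac:
  assumes "transpose \<theta> = - \<theta>" "\<And>j. w j \<in> base"
  shows "closure (dom (twisted_dirac \<theta> (connection_form \<theta> w))) = UNIV"
  using twisted_dirac_eq(2)[OF assms] by (rule closure_eq_UNIV_if_truncations)

text \<open>
  The dense set is the whole domain of the twisted operator.  On vectors of degree zero the terms
  with \<open>\<delta>\<^sub>4\<close> vanish, so the horizontal parts of the perturbed and the flat operator agree there.
\<close>

lemma compatible_connection_form:
  assumes skew: "transpose \<theta> = - \<theta>" and w: "\<And>j. w j \<in> base" and "dirac_operator \<theta> T"
    and T: "\<And>\<psi>. T \<psi> = (if \<psi> \<in> sobolev then Some (full_dirac \<theta> w \<psi>) else None)"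
  shows "compatible \<theta> T (connection_form \<theta> w)"
  unfolding compatible_def
proof (intro conjI ballI exI[of _ "dom (twisted_dirac \<theta> (connection_form \<theta> w))"])
  let ?t = "twisted_dirac \<theta> (connection_form \<theta> w)"
  have hor: "hor T \<psi> = (if \<psi> \<in> sobolev then Some (horizontal \<theta> w \<psi>) else None)" for \<psi>
    by (rule hor_eq_horizontal[OF skew homog_smooth[OF w] T])
  have horD: "hor flatD \<psi> = (if \<psi> \<in> sobolev then Some (horizontal \<theta> (\<lambda>_ _. 0) \<psi>) else None)" for \<psi>
    by (rule hor_eq_horizontal[OF skew smooth_zero flatD_eq_full_dirac[OF skew]])
  show "dirac_operator \<theta> T" by fact
  show "closure (dom ?t) = UNIV" by (rule closure_dom_twisted_dirac[OF skew w])
  show "dom ?t \<subseteq> dom ?t" ..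
  show "dom ?t \<subseteq> dom (hor T)"
    using twisted_dirac_eq(1)[OF skew w] by (fastforce simp: hor dom_def)
  show "?t \<psi> = hor T \<psi>" if "\<psi> \<in> dom ?t" for \<psi>
    using that twisted_dirac_eq(1)[OF skew w] by (auto simp: hor)
  fix h assume "h \<in> hil_deg 0"
  then have "grad 4 h = 0" by (simp add: hil_deg_def grad_def)
  then show "hor T h = hor flatD h"
    by (simp add: hor horD horizontal_def rmult_eq_lmult_fun[OF skew] homog_smooth[OF w] smooth_zero
        linear_0[OF linear_lmult[OF homog_smooth[OF w]]] lmult_zero)
qed

text \<open>
  Compatibility makes \<open>T \<circ> \<delta>\<^sub>4\<close> vanish on a dense set, for the bounded operator
  \<open>T = \<Sum>\<^sub>j \<gamma>\<^sup>j \<circ> (right multiplication by w\<^sub>j)\<close>.  It has degree zero, so \<open>T \<circ> \<delta>\<^sub>4 = \<delta>\<^sub>4 \<circ> T\<close>,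
  and the components of \<open>T \<psi>\<close> of nonzero degree vanish on a dense set, hence everywhere.
  Testing on a vector of degree one gives \<open>w = 0\<close>.
\<close>

lemma compatible_flatD_imp_zero:
  assumes skew: "transpose \<theta> = - \<theta>" and w: "\<And>j. w j \<in> base"
    and comp: "compatible \<theta> flatD (connection_form \<theta> w)" and j: "j \<in> {1, 2, 3}"
  shows "w j = (\<lambda>n. 0)"
proof
  fix m
  let ?R = "\<lambda>j. lmult (transpose \<theta>) (w j)"
  define T where "T = (\<lambda>\<psi>. \<Sum>j\<in>{1, 2, 3}. spin_op (gamma j) (?R j \<psi>))"
  note ws = homog_smooth[OF w]
  have T: "bounded_linear T"
    unfolding T_def by (intro bounded_linear_sum bounded_linear_compose[OF bounded_linear_spin_op bounded_linear_lmult]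
        smooth_abs_summable ws)
  obtain S where S: "closure S = UNIV" "S \<subseteq> dom (twisted_dirac \<theta> (connection_form \<theta> w))"
    "\<And>\<psi>. \<psi> \<in> S \<Longrightarrow> twisted_dirac \<theta> (connection_form \<theta> w) \<psi> = hor flatD \<psi>"
    using comp by (auto simp: compatible_def)
  have zero: "Rep_hil (T \<psi>) n = 0" if "n $ 4 \<noteq> 0" for \<psi> n
  proof -
    have "(\<lambda>\<psi>. Rep_hil (T \<psi>) n) = (\<lambda>\<psi>. 0)"
    proof (rule bounded_linear_eq_on_dense[OF bounded_linear_compose[OF bounded_linear_Rep_hil T] bounded_linear_zero S(1)])
      fix \<psi> assume "\<psi> \<in> S"
      then obtain \<phi> where \<phi>: "twisted_dirac \<theta> (connection_form \<theta> w) \<psi> = Some \<phi>" using S(2) by blast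
      have \<psi>: "\<psi> \<in> sobolev" "\<phi> = horizontal \<theta> w \<psi>" using twisted_dirac_eq(1)[OF skew w \<phi>] by auto
      have "hor flatD \<psi> = Some (horizontal \<theta> (\<lambda>_ _. 0) \<psi>)"
        using hor_eq_horizontal[OF skew smooth_zero flatD_eq_full_dirac[OF skew], of \<psi>] \<psi>(1) by simp
      then have "horizontal \<theta> w \<psi> = horizontal \<theta> (\<lambda>_ _. 0) \<psi>"
        using S(3)[OF \<open>\<psi> \<in> S\<close>] \<phi> \<psi>(2) by simp
      then have T0: "T (grad 4 \<psi>) = 0"
        by (simp add: horizontal_def T_def rmult_eq_lmult_fun[OF skew] ws smooth_zero lmult_zero spin_op_diff algebra_simps)
      have der0: "der 4 (w j) = (\<lambda>n. 0)" for j using w[of j] by (simp add: homog_def)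
      have "delta 4 (spin_op (gamma j) (?R j \<psi>)) = Some (spin_op (gamma j) (?R j (grad 4 \<psi>)))" for j
        using delta_spin_op[OF delta_lmult[OF ws[of j] delta_sobolev[OF \<psi>(1), of 4], of "transpose \<theta>"], of "gamma j"]
        by (simp add: der0 lmult_zero)
      then have "delta 4 (T \<psi>) = Some (T (grad 4 \<psi>))"
        unfolding T_def by (simp add: delta_add)
      then have "real_of_int (n $ 4) *\<^sub>R Rep_hil (T \<psi>) n = 0"
        by (simp add: T0 delta_eq_Some_iff Rep_hil_simps)
      then show "Rep_hil (T \<psi>) n = 0" using that by simp
    qed
    then show ?thesis by (rule fun_cong)
  qed
  show "w j m = 0"
  proof (cases "m $ 4 = 0")
    case True
    let ?p = "axis 4 1 :: int^4"
    let ?c = "(\<lambda>j. w j m * cis (pi * theta_form (transpose \<theta>) m ?p))(4 := 0)"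
    have "?c j = 0"
    proof (rule gamma_independent)
      fix v
      have "(m + ?p) $ 4 \<noteq> 0" using True by simp
      then have "Rep_hil (T (unit_at ?p v)) (m + ?p) = 0" by (rule zero)
      then show "(\<Sum>j\<in>UNIV. ?c j *s (gamma j *v v)) = 0"
        by (simp add: T_def Rep_hil_simps Rep_lmult_unit_at[OF smooth_abs_summable[OF ws]] vector_scalar_commute sum_UNIV_4)
    qed
    then show ?thesis using j by auto
  next
    case False
    then show ?thesis using w[of j] by (simp add: homog_iff)
  qed
qed

section \<open>The symbol of the flat Dirac operator\<close>

definition symbol :: "int^4 \<Rightarrow> complex^4 \<Rightarrow> complex^4" where
  "symbol n v = (\<Sum>j\<in>UNIV. real_of_int (n $ j) *\<^sub>R (gamma j *v v))"

definition sq_weight :: "int^4 \<Rightarrow> real" where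
  "sq_weight n = 1 + (\<Sum>j\<in>UNIV. (real_of_int (n $ j))\<^sup>2)"

lemma sq_weight_ge_1: "1 \<le> sq_weight n"
  by (simp add: sq_weight_def sum_nonneg)

lemma sq_weight_pos: "0 < sq_weight n"
  using sq_weight_ge_1[of n] by linarith

lemma sq_weight_component: "(real_of_int (n $ j))\<^sup>2 \<le> sq_weight n"
  using member_le_sum[of j UNIV "\<lambda>j. (real_of_int (n $ j))\<^sup>2"] by (simp add: sq_weight_def)

lemma symbol_add: "symbol n (v + u) = symbol n v + symbol n u"
  by (simp add: symbol_def matrix_vector_right_distrib scaleR_add_right sum.distrib)

lemma symbol_scaleR: "symbol n (r *\<^sub>R v) = r *\<^sub>R symbol n v"
  by (simp add: symbol_def matrix_vector_scaleR scaleR_sum_right mult.commute)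

lemma smult_scaleR: "c *s (r *\<^sub>R v) = r *\<^sub>R (c *s (v::complex^4))"
  by (simp add: scaleR_eq_smult vector_smult_assoc mult.commute)

lemma symbol_smult: "symbol n (c *s v) = c *s symbol n v"
proof -
  have "linear (\<lambda>v::complex^4. c *s v)"
    by (rule linearI) (simp_all add: vector_add_ldistrib smult_scaleR)
  then show ?thesis
    by (simp add: linear_sum symbol_def vector_scalar_commute scaleR_eq_smult vector_smult_assoc mult.commute)
qed

lemma inner_symbol: "symbol n v \<bullet> u = v \<bullet> symbol n u"
  by (simp add: symbol_def inner_sum_left inner_sum_right inner_gamma)

text \<open>
  In the double sum the terms for \<open>(i, j)\<close> and \<open>(j, i)\<close> add up to an anticommutator.
\<close>

lemma symbol_symbol: "symbol n (symbol n v) = (sq_weight n - 1) *\<^sub>R v"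
proof -
  let ?x = "\<lambda>j. real_of_int (n $ j)"
  let ?g = "\<lambda>i j. gamma i *v (gamma j *v v)"
  have "symbol n (symbol n v) = (\<Sum>i\<in>UNIV. ?x i *\<^sub>R (gamma i *v (\<Sum>j\<in>UNIV. ?x j *\<^sub>R (gamma j *v v))))"
    by (simp add: symbol_def)
  also have "\<dots> = (\<Sum>i\<in>UNIV. \<Sum>j\<in>UNIV. (?x i * ?x j) *\<^sub>R ?g i j)"
    by (intro sum.cong refl)
      (simp add: linear_sum[OF matrix_vector_mul_linear] matrix_vector_scaleR scaleR_sum_right)
  finally have 1: "symbol n (symbol n v) = (\<Sum>i\<in>UNIV. \<Sum>j\<in>UNIV. (?x i * ?x j) *\<^sub>R ?g i j)" .
  then have 2: "symbol n (symbol n v) = (\<Sum>i\<in>UNIV. \<Sum>j\<in>UNIV. (?x i * ?x j) *\<^sub>R ?g j i)"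
    by (subst (asm) sum.swap) (simp add: mult.commute)
  have g: "?g i j + ?g j i = (if i = j then 2 *\<^sub>R v else 0)" for i j
    using gamma_anticommute[of i j v] by (auto simp: matrix_vector_mul_assoc gamma_gamma scaleR_2)
  have "2 *\<^sub>R symbol n (symbol n v) = (\<Sum>i\<in>UNIV. \<Sum>j\<in>UNIV. (?x i * ?x j) *\<^sub>R (?g i j + ?g j i))"
    unfolding scaleR_2 scaleR_add_right sum.distrib using 1 2 by simp
  also have "\<dots> = (\<Sum>i\<in>UNIV. (2 * (?x i)\<^sup>2) *\<^sub>R v)"
    unfolding g by (simp add: if_distrib power2_eq_square mult_ac cong: if_cong)
  also have "\<dots> = 2 *\<^sub>R ((sq_weight n - 1) *\<^sub>R v)"
    by (simp add: sq_weight_def scaleR_sum_left scaleR_sum_right)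
  finally show ?thesis by (simp only: scaleR_cancel_left) simp
qed

lemma inner_imaginary: "(\<i> *s v) \<bullet> u = - (v \<bullet> (\<i> *s (u::complex^4)))"
  by (simp add: complex_inner_smult vector_smult_lneg)

text \<open>
  The symbol is hermitian, so \<open>symbol n v\<close> is orthogonal to \<open>\<i> v\<close> for the real inner product.
\<close>

lemma norm_symbol_imaginary:
  assumes "c = \<i> \<or> c = - \<i>"
  shows "(norm (symbol n v + c *s v))\<^sup>2 = sq_weight n * (norm v)\<^sup>2"
proof -
  have "symbol n v \<bullet> (\<i> *s v) = 0"
    using inner_symbol[of n v "\<i> *s v"] inner_imaginary[of v "symbol n v"]
    by (simp add: symbol_smult inner_commute)
  then have "symbol n v \<bullet> (c *s v) = 0"
    using assms by (auto simp: vector_smult_lneg)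
  moreover have "symbol n v \<bullet> symbol n v = (sq_weight n - 1) * (v \<bullet> v)"
    by (simp add: inner_symbol symbol_symbol)
  moreover have "(c *s v) \<bullet> (c *s v) = v \<bullet> v"
    using assms norm_smult[of c v] by (auto simp: dot_square_norm)
  ultimately show ?thesis
    by (simp add: power2_norm_eq_inner inner_add_left inner_add_right inner_commute algebra_simps)
qed

lemma symbol_imaginary_inverse:
  "symbol n (symbol n v + \<i> *s v) - \<i> *s (symbol n v + \<i> *s v) = sq_weight n *\<^sub>R v"
  by (simp add: symbol_add symbol_symbol symbol_smult vector_add_ldistrib vector_smult_assoc
      vector_smult_lneg algebra_simps)

definition flat :: "hil \<Rightarrow> hil" where
  "flat \<psi> = (\<Sum>j\<in>UNIV. spin_op (gamma j) (grad j \<psi>))"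

abbreviation imag :: "hil \<Rightarrow> hil" where
  "imag \<equiv> spin_op (mat \<i>)"

lemma mat_vector: "mat c *v v = c *s (v::complex^4)"
  by (simp add: vec_eq_iff matrix_vector_mult_def mat_def if_distrib if_distribR cong: if_cong)

lemma Rep_imag: "Rep_hil (imag \<psi>) n = \<i> *s Rep_hil \<psi> n"
  by (simp add: Rep_hil_simps mat_vector)

lemma Rep_flat: "\<psi> \<in> sobolev \<Longrightarrow> Rep_hil (flat \<psi>) n = symbol n (Rep_hil \<psi> n)"
  by (simp add: flat_def symbol_def Rep_hil_simps Rep_grad matrix_vector_scaleR)

lemma norm_Rep_flat_imag:
  assumes "\<psi> \<in> sobolev"
  shows "(norm (Rep_hil (flat \<psi> - imag \<psi>) n))\<^sup>2 = sq_weight n * (norm (Rep_hil \<psi> n))\<^sup>2"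
  using norm_symbol_imaginary[of "- \<i>" n "Rep_hil \<psi> n"]
  by (simp add: Rep_hil_simps(5) Rep_flat[OF assms] Rep_imag vector_smult_lneg)

text \<open>
  The resolvent of the flat operator at the imaginary unit: \<open>(p - \<i>) (p + \<i>) = p\<^sup>2 + 1\<close> is the
  scalar \<open>sq_weight n\<close> for the symbol \<open>p\<close>.
\<close>

lift_definition flat_resolvent :: "hil \<Rightarrow> hil" is
  "\<lambda>f n. (1 / sq_weight n) *\<^sub>R (symbol n (f n) + \<i> *s f n)"
proof -
  fix f :: "int^4 \<Rightarrow> complex^4" assume f: "f \<in> Collect ell2"
  have "norm ((1 / sq_weight n) *\<^sub>R (symbol n (f n) + \<i> *s f n)) \<le> 1 * norm (f n)" for n
  proof (rule power2_le_imp_le)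
    have "(norm ((1 / sq_weight n) *\<^sub>R (symbol n (f n) + \<i> *s f n)))\<^sup>2 = (norm (f n))\<^sup>2 / sq_weight n"
      using sq_weight_pos[of n]
      by (simp add: power_divide norm_symbol_imaginary; simp add: power2_eq_square)
    also have "\<dots> \<le> (norm (f n))\<^sup>2"
      using sq_weight_ge_1[of n] by (simp add: divide_le_eq mult_le_cancel_left1)
    finally show "(norm ((1 / sq_weight n) *\<^sub>R (symbol n (f n) + \<i> *s f n)))\<^sup>2 \<le> (1 * norm (f n))\<^sup>2"
      by simp
  qed simp
  then have "ell2 (\<lambda>n. (1 / sq_weight n) *\<^sub>R (symbol n (f n) + \<i> *s f n))"
    by (rule ell2_bounded[rotated]) (use f in simp)
  then show "(\<lambda>n. (1 / sq_weight n) *\<^sub>R (symbol n (f n) + \<i> *s f n)) \<in> Collect ell2"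
    by simp
qed

lemma norm_Rep_flat_resolvent:
  "sq_weight n * (norm (Rep_hil (flat_resolvent \<phi>) n))\<^sup>2 = (norm (Rep_hil \<phi> n))\<^sup>2"
  using sq_weight_pos[of n]
  by (simp add: flat_resolvent.rep_eq power_divide norm_symbol_imaginary; simp add: power2_eq_square)

lemma sobolev_flat_resolvent: "flat_resolvent \<phi> \<in> sobolev"
proof -
  have "\<exists>\<xi>. delta j (flat_resolvent \<phi>) = Some \<xi>" for j
  proof -
    let ?f = "\<lambda>n. real_of_int (n $ j) *\<^sub>R Rep_hil (flat_resolvent \<phi>) n"
    have "ell2 ?f"
    proof (rule ell2_bounded[OF ell2_Rep[of \<phi>], of _ 1])
      fix n
      show "norm (?f n) \<le> 1 * norm (Rep_hil \<phi> n)"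
      proof (rule power2_le_imp_le)
        have "(norm (?f n))\<^sup>2 = (real_of_int (n $ j))\<^sup>2 * (norm (Rep_hil (flat_resolvent \<phi>) n))\<^sup>2"
          by (simp add: power_mult_distrib)
        also have "\<dots> \<le> sq_weight n * (norm (Rep_hil (flat_resolvent \<phi>) n))\<^sup>2"
          by (intro mult_right_mono sq_weight_component) simp
        finally show "(norm (?f n))\<^sup>2 \<le> (1 * norm (Rep_hil \<phi> n))\<^sup>2"
          by (simp add: norm_Rep_flat_resolvent)
      qed simp
    qed
    then show ?thesis by (simp add: delta_def Let_def)
  qed
  then show ?thesis by (auto simp: sobolev_def dom_def)
qed

lemma flat_resolvent_inverse: "flat (flat_resolvent \<phi>) - imag (flat_resolvent \<phi>) = \<phi>"
proof (rule hil_eqI)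
  fix n
  let ?v = "Rep_hil \<phi> n"
  have "Rep_hil (flat (flat_resolvent \<phi>) - imag (flat_resolvent \<phi>)) n =
      (1 / sq_weight n) *\<^sub>R (symbol n (symbol n ?v + \<i> *s ?v) - \<i> *s (symbol n ?v + \<i> *s ?v))"
    unfolding minus_hil.rep_eq Rep_flat[OF sobolev_flat_resolvent] Rep_imag flat_resolvent.rep_eq
    by (simp only: symbol_scaleR smult_scaleR scaleR_diff_right)
  then show "Rep_hil (flat (flat_resolvent \<phi>) - imag (flat_resolvent \<phi>)) n = ?v"
    unfolding symbol_imaginary_inverse using sq_weight_pos[of n] by simp
qed

lemma norm_grad_flat_resolvent: "norm (grad j (flat_resolvent \<phi>)) \<le> norm \<phi>"
proof (rule norm_hil_leI)
  fix F :: "(int^4) set" assume F: "finite F"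
  have "(\<Sum>n\<in>F. (norm (Rep_hil (grad j (flat_resolvent \<phi>)) n))\<^sup>2) \<le> (\<Sum>n\<in>F. (norm (Rep_hil \<phi> n))\<^sup>2)"
  proof (rule sum_mono)
    fix n
    have "(norm (Rep_hil (grad j (flat_resolvent \<phi>)) n))\<^sup>2 =
        (real_of_int (n $ j))\<^sup>2 * (norm (Rep_hil (flat_resolvent \<phi>) n))\<^sup>2"
      by (simp add: Rep_grad[OF sobolev_flat_resolvent] power_mult_distrib)
    also have "\<dots> \<le> sq_weight n * (norm (Rep_hil (flat_resolvent \<phi>) n))\<^sup>2"
      by (intro mult_right_mono sq_weight_component) simp
    finally show "(norm (Rep_hil (grad j (flat_resolvent \<phi>)) n))\<^sup>2 \<le> (norm (Rep_hil \<phi> n))\<^sup>2"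
      by (simp add: norm_Rep_flat_resolvent)
  qed
  also have "\<dots> \<le> (norm \<phi>)\<^sup>2" by (rule sum_norm_le_norm_hil[OF F])
  finally show "(\<Sum>n\<in>F. (norm (Rep_hil (grad j (flat_resolvent \<phi>)) n))\<^sup>2) \<le> (norm \<phi>)\<^sup>2" .
qed simp

lemma flat_resolvent_add: "flat_resolvent (\<psi> + \<phi>) = flat_resolvent \<psi> + flat_resolvent \<phi>"
  by (rule hil_eqI)
    (simp add: flat_resolvent.rep_eq Rep_hil_simps symbol_add vector_add_ldistrib scaleR_add_right algebra_simps)

lemma flat_resolvent_scaleR: "flat_resolvent (r *\<^sub>R \<psi>) = r *\<^sub>R flat_resolvent \<psi>"
  by (rule hil_eqI)
    (simp add: flat_resolvent.rep_eq Rep_hil_simps symbol_scaleR smult_scaleR scaleR_add_right)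

lemma inner_hil_cong:
  assumes "\<And>n. Rep_hil \<psi> n \<bullet> Rep_hil \<phi> n = Rep_hil \<psi>' n \<bullet> Rep_hil \<phi>' n"
  shows "\<psi> \<bullet> \<phi> = \<psi>' \<bullet> \<phi>'"
  using inner_hil_has_sum[of \<psi> \<phi>] inner_hil_has_sum[of \<psi>' \<phi>'] unfolding assms by (rule has_sum_unique)

lemma inner_hil_zeroI:
  assumes "\<And>n. Rep_hil \<psi> n \<bullet> Rep_hil \<phi> n = 0"
  shows "\<psi> \<bullet> \<phi> = 0"
  using inner_hil_cong[of \<psi> \<phi> 0 0] assms by (simp add: Rep_hil_simps)

lemma inner_imag: "imag \<psi> \<bullet> \<phi> = - (\<psi> \<bullet> imag \<phi>)"
proof -
  have "imag \<psi> \<bullet> \<phi> = \<psi> \<bullet> (- imag \<phi>)"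
    by (rule inner_hil_cong) (simp add: Rep_imag Rep_hil_simps(4) inner_imaginary)
  then show ?thesis by simp
qed

lemma spin_op_imag: "spin_op M (imag \<psi>) = imag (spin_op M \<psi>)"
  by (rule hil_eqI) (simp add: Rep_hil_simps mat_vector vector_scalar_commute)

lemma norm_spin_gamma: "norm (spin_op (gamma j) \<psi>) = norm \<psi>"
  by (simp add: norm_eq_sqrt_inner inner_spin_gamma spin_gamma_square)

lemma inner_gamma_gamma:
  assumes "i \<noteq> j" shows "(gamma i *v v) \<bullet> (gamma j *v v) = 0"
proof -
  have "(gamma i *v v) \<bullet> (gamma j *v v) = v \<bullet> (gamma i *v (gamma j *v v))" by (rule inner_gamma)
  also have "\<dots> = - (v \<bullet> (gamma j *v (gamma i *v v)))" by (simp add: gamma_anticommute[OF assms])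
  also have "\<dots> = - ((gamma i *v v) \<bullet> (gamma j *v v))" 
    by (subst inner_commute[of "gamma i *v v"]) (simp only: inner_gamma)
  finally show ?thesis by simp
qed

section \<open>Compactness of energy balls\<close>

lemma finite_sq_weight_le: "finite {n. sq_weight n \<le> L}"
proof -
  let ?A = "{k::int. \<bar>k\<bar> \<le> \<lfloor>L\<rfloor>}"
  have "finite (vec_nth -` (PiE UNIV (\<lambda>_::4. ?A)))"
  proof (rule finite_vimageI)
    have "?A \<subseteq> {- \<lfloor>L\<rfloor>..\<lfloor>L\<rfloor>}" by auto
    then show "finite (PiE UNIV (\<lambda>_::4. ?A))" by (intro finite_PiE) (auto intro: finite_subset)
    show "inj (vec_nth :: int^4 \<Rightarrow> 4 \<Rightarrow> int)" by (simp add: inj_on_def vec_nth_inject)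
  qed
  moreover have "{n. sq_weight n \<le> L} \<subseteq> vec_nth -` (PiE UNIV (\<lambda>_::4. ?A))"
  proof
    fix n assume n: "n \<in> {n. sq_weight n \<le> L}"
    have "\<bar>real_of_int (n $ j)\<bar> \<le> L" for j
    proof -
      have "\<bar>n $ j\<bar> \<le> \<bar>n $ j\<bar> * \<bar>n $ j\<bar>"
      proof (cases "n $ j = 0")
        case False
        then have "\<bar>n $ j\<bar> * 1 \<le> \<bar>n $ j\<bar> * \<bar>n $ j\<bar>" by (intro mult_left_mono) auto
        then show ?thesis by simp
      qed simp
      then have "real_of_int \<bar>n $ j\<bar> \<le> real_of_int (\<bar>n $ j\<bar> * \<bar>n $ j\<bar>)"
        by (simp only: of_int_le_iff)
      then have "\<bar>real_of_int (n $ j)\<bar> \<le> (real_of_int (n $ j))\<^sup>2"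
        by (simp add: power2_eq_square)
      then show ?thesis using sq_weight_component[of n j] n by simp
    qed
    then show "n \<in> vec_nth -` (PiE UNIV (\<lambda>_::4. ?A))"
      by (auto simp: PiE_iff le_floor_iff)
  qed
  ultimately show ?thesis by (rule rev_finite_subset)
qed

text \<open>
  For \<open>\<psi>\<close> in the domain of the flat operator \<open>D\<close>, membership amounts to \<open>\<parallel>(D - \<i>) \<psi>\<parallel>\<^sup>2 \<le> C\<close>.  Finite
  partial sums make the condition stable under coefficientwise limits.
\<close>

definition energy_ball :: "real \<Rightarrow> hil set" where
  "energy_ball C = {\<psi>. \<forall>F. finite F \<longrightarrow> (\<Sum>n\<in>F. sq_weight n * (norm (Rep_hil \<psi> n))\<^sup>2) \<le> C}"

text \<open>
  A sequence of bounded energy has a coefficientwise convergent subsequence by Tychonoff's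
  theorem; the energy bound makes the tails uniformly small, so it converges in norm.
\<close>

lemma compact_energy_ball: "compact (energy_ball C)"
  unfolding compact_eq_seq_compact_metric seq_compact_def
proof (intro allI impI)
  fix X :: "nat \<Rightarrow> hil" assume "\<forall>k. X k \<in> energy_ball C"
  then have X: "(\<Sum>n\<in>F. sq_weight n * (norm (Rep_hil (X k) n))\<^sup>2) \<le> C" if "finite F" for F k
    using that by (simp add: energy_ball_def)
  have "0 \<le> C" using X[of "{}" 0] by simp
  let ?P = "PiE (UNIV :: (int^4) set) (\<lambda>_. cball (0::complex^4) (sqrt C))"
  have "compactin (product_topology (\<lambda>_. euclidean) UNIV) ?P"
    by (simp add: compactin_PiE)
  then have "compact ?P" by (simp add: euclidean_product_topology)
  then have "seq_compact ?P" by (simp add: compact_eq_seq_compact_metric)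
  moreover have "Rep_hil (X k) \<in> ?P" for k
  proof -
    have "norm (Rep_hil (X k) n) \<le> sqrt C" for n
    proof (rule real_le_rsqrt)
      have "(norm (Rep_hil (X k) n))\<^sup>2 \<le> sq_weight n * (norm (Rep_hil (X k) n))\<^sup>2"
        using sq_weight_ge_1[of n] by (simp add: mult_le_cancel_right1)
      then show "(norm (Rep_hil (X k) n))\<^sup>2 \<le> C" using X[of "{n}" k] by simp
    qed
    then show ?thesis by (auto simp: PiE_iff)
  qed
  ultimately obtain l r where r: "strict_mono r" and lim: "((\<lambda>k. Rep_hil (X k)) \<circ> r) \<longlonglongrightarrow> l"
    using seq_compactE[of ?P "\<lambda>k. Rep_hil (X k)"] by metis
  have l: "(\<lambda>k. Rep_hil (X (r k)) n) \<longlonglongrightarrow> l n" for n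
    by (rule continuous_on_tendsto_compose[OF continuous_on_product_coordinates lim[unfolded o_def]]) auto
  have l_le: "(\<Sum>n\<in>F. sq_weight n * (norm (l n))\<^sup>2) \<le> C" if "finite F" for F
  proof (rule tendsto_upperbound)
    show "(\<lambda>k. \<Sum>n\<in>F. sq_weight n * (norm (Rep_hil (X (r k)) n))\<^sup>2) \<longlonglongrightarrow> (\<Sum>n\<in>F. sq_weight n * (norm (l n))\<^sup>2)"
      by (intro tendsto_intros l)
  qed (simp_all add: X[OF that])
  have "ell2 l"
  proof (rule ell2_partial_sumsI)
    fix F :: "(int^4) set" assume "finite F"
    have "(\<Sum>n\<in>F. (norm (l n))\<^sup>2) \<le> (\<Sum>n\<in>F. sq_weight n * (norm (l n))\<^sup>2)"
      using sq_weight_ge_1 by (intro sum_mono) (simp add: mult_le_cancel_right1)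
    then show "(\<Sum>n\<in>F. (norm (l n))\<^sup>2) \<le> C" using l_le[OF \<open>finite F\<close>] by linarith
  qed
  define g where "g = Abs_hil l"
  have g: "Rep_hil g = l" unfolding g_def using \<open>ell2 l\<close> by (rule Rep_Abs_hil)
  have "(\<lambda>k. X (r k)) \<longlonglongrightarrow> g"
  proof (rule LIMSEQ_I)
    fix e :: real assume "0 < e"
    \<comment> \<open>The energy of a difference is at most \<open>4 * C\<close>, so its tail beyond \<open>L\<close> is at most \<open>e\<^sup>2 / 2\<close>.\<close>
    define L where "L = 8 * (C + 1) / e\<^sup>2"
    have "0 < L" using \<open>0 < e\<close> \<open>0 \<le> C\<close> by (simp add: L_def)
    let ?S = "{n. sq_weight n \<le> L}"
    have "(\<lambda>k. \<Sum>n\<in>?S. (norm (Rep_hil (X (r k)) n - l n))\<^sup>2) \<longlonglongrightarrow> (\<Sum>n\<in>?S. (norm (l n - l n))\<^sup>2)"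
      by (intro tendsto_intros l)
    then have "(\<lambda>k. \<Sum>n\<in>?S. (norm (Rep_hil (X (r k)) n - l n))\<^sup>2) \<longlonglongrightarrow> 0" by simp
    from LIMSEQ_D[OF this, of "e\<^sup>2 / 4"] obtain N where
      N: "\<And>k. k \<ge> N \<Longrightarrow> (\<Sum>n\<in>?S. (norm (Rep_hil (X (r k)) n - l n))\<^sup>2) < e\<^sup>2 / 4"
      using \<open>0 < e\<close> by (auto simp: sum_nonneg)
    have "norm (X (r k) - g) < e" if "k \<ge> N" for k
    proof -
      let ?d = "\<lambda>n. (norm (Rep_hil (X (r k)) n - l n))\<^sup>2"
      have "norm (X (r k) - g) \<le> sqrt (3/4) * e"
      proof (rule norm_hil_leI)
        fix F :: "(int^4) set" assume F: "finite F"
        have wd: "(\<Sum>n\<in>F - ?S. sq_weight n * ?d n) \<le> 4 * C"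
        proof -
          have "?d n \<le> 2 * (norm (Rep_hil (X (r k)) n))\<^sup>2 + 2 * (norm (l n))\<^sup>2" for n
          proof -
            have "?d n \<le> (norm (Rep_hil (X (r k)) n) + norm (l n))\<^sup>2"
              by (intro power_mono norm_triangle_ineq4) simp
            also have "\<dots> \<le> 2 * (norm (Rep_hil (X (r k)) n))\<^sup>2 + 2 * (norm (l n))\<^sup>2"
              using zero_le_power2[of "norm (Rep_hil (X (r k)) n) - norm (l n)"]
              by (simp add: power2_eq_square algebra_simps)
            finally show ?thesis .
          qed
          then have "(\<Sum>n\<in>F - ?S. sq_weight n * ?d n) \<le>
              (\<Sum>n\<in>F - ?S. sq_weight n * (2 * (norm (Rep_hil (X (r k)) n))\<^sup>2 + 2 * (norm (l n))\<^sup>2))"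
            by (intro sum_mono mult_left_mono) (simp_all add: sq_weight_pos less_imp_le)
          also have "\<dots> = 2 * (\<Sum>n\<in>F - ?S. sq_weight n * (norm (Rep_hil (X (r k)) n))\<^sup>2) +
              2 * (\<Sum>n\<in>F - ?S. sq_weight n * (norm (l n))\<^sup>2)"
            by (simp add: sum_distrib_left sum.distrib algebra_simps)
          also have "\<dots> \<le> 4 * C" using X[of "F - ?S" "r k"] l_le[of "F - ?S"] F by simp
          finally show ?thesis .
        qed
        have "L * (\<Sum>n\<in>F - ?S. ?d n) \<le> (\<Sum>n\<in>F - ?S. sq_weight n * ?d n)"
          unfolding sum_distrib_left by (intro sum_mono mult_right_mono) auto
        then have "L * (\<Sum>n\<in>F - ?S. ?d n) \<le> L * (e\<^sup>2 / 2)"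
          using wd \<open>0 < e\<close> \<open>0 \<le> C\<close> by (simp add: L_def)
        then have tail: "(\<Sum>n\<in>F - ?S. ?d n) \<le> e\<^sup>2 / 2" using \<open>0 < L\<close> by simp
        have "(\<Sum>n\<in>F. ?d n) = (\<Sum>n\<in>F \<inter> ?S. ?d n) + (\<Sum>n\<in>F - ?S. ?d n)"
          by (rule sum.Int_Diff[OF F])
        also have "(\<Sum>n\<in>F \<inter> ?S. ?d n) \<le> (\<Sum>n\<in>?S. ?d n)"
          by (rule sum_mono2[OF finite_sq_weight_le]) auto
        finally have "(\<Sum>n\<in>F. ?d n) \<le> 3 / 4 * e\<^sup>2" using tail N[OF that] by linarith
        then show "(\<Sum>n\<in>F. (norm (Rep_hil (X (r k) - g) n))\<^sup>2) \<le> (sqrt (3/4) * e)\<^sup>2"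
          by (simp add: Rep_hil_simps(5) g power_mult_distrib)
      qed (use \<open>0 < e\<close> in simp)
      also have "\<dots> < 1 * e"
        using \<open>0 < e\<close> by (intro mult_strict_right_mono) (simp_all add: real_sqrt_lt_1_iff)
      finally show ?thesis by simp
    qed
    then show "\<exists>no. \<forall>k\<ge>no. norm (X (r k) - g) < e" by blast
  qed
  moreover have "g \<in> energy_ball C" using l_le by (simp add: energy_ball_def g)
  ultimately show "\<exists>l\<in>energy_ball C. \<exists>r. strict_mono r \<and> (X \<circ> r) \<longlonglongrightarrow> l"
    using r by (auto simp: o_def)
qed

section \<open>Selfadjointness and compact resolvent\<close>

text \<open>
  A bounded replacement for \<open>\<delta>\<^sub>4\<close>: the operator \<open>B \<delta>\<^sub>4\<close> need not be defined on \<open>\<delta>\<^sub>4 \<psi>\<close>, so the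
  symmetry argument of the a priori estimate is run with truncations.
\<close>

lift_definition truncated_degree :: "nat \<Rightarrow> hil \<Rightarrow> hil" is
  "\<lambda>N f n. (if \<bar>n $ 4\<bar> \<le> int N then real_of_int (n $ 4) else 0) *\<^sub>R f n"
proof -
  fix N and f :: "int^4 \<Rightarrow> complex^4" assume "f \<in> Collect ell2"
  then have "ell2 f" by simp
  then have "ell2 (\<lambda>n. (if \<bar>n $ 4\<bar> \<le> int N then real_of_int (n $ 4) else 0) *\<^sub>R f n)"
  proof (rule ell2_bounded[where C = "real N"])
    fix n :: "int^4"
    have "\<bar>real_of_int (n $ 4)\<bar> \<le> real N" if "\<bar>n $ 4\<bar> \<le> int N"
      using that by linarith
    then show "norm ((if \<bar>n $ 4\<bar> \<le> int N then real_of_int (n $ 4) else 0) *\<^sub>R f n) \<le> real N * norm (f n)"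
      by (auto intro: mult_right_mono)
  qed
  then show "(\<lambda>n. (if \<bar>n $ 4\<bar> \<le> int N then real_of_int (n $ 4) else 0) *\<^sub>R f n) \<in> Collect ell2"
    by simp
qed

lemma grading_eq: "grading \<psi> = spin_op (gamma 1) (spin_op (gamma 2) (spin_op (gamma 3) (spin_op (gamma 4) \<psi>)))"
  by (simp add: grading_def spin_op_compose matrix_mul_assoc)

lemmas spin_gamma_sort =
  spin_gamma_anticommute[of 2 1] spin_gamma_anticommute[of 3 1] spin_gamma_anticommute[of 4 1]
  spin_gamma_anticommute[of 3 2] spin_gamma_anticommute[of 4 2] spin_gamma_anticommute[of 4 3]

lemma grading_gamma: "grading (spin_op (gamma j) \<psi>) = - spin_op (gamma j) (grading \<psi>)"
  using exhaust_4[of j]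
  by (elim disjE; hypsubst) (simp_all add: grading_eq spin_gamma_sort spin_gamma_square spin_op_minus)

lemma grading_grading: "grading (grading \<psi>) = \<psi>"
  by (simp add: grading_eq spin_gamma_sort spin_gamma_square spin_op_minus)

lemma grading_spin_linear: "linear grading"
  unfolding grading_def by (rule spin_op_linear)

lemma sobolev_grading:
  assumes "\<psi> \<in> sobolev"
  shows "grading \<psi> \<in> sobolev" and "grad j (grading \<psi>) = grading (grad j \<psi>)"
  using sobolev_spin_op[OF assms] by (simp_all add: grading_def)

lemma energy_ballI: "\<psi> \<in> sobolev \<Longrightarrow> norm (flat \<psi> - imag \<psi>) \<le> C \<Longrightarrow> \<psi> \<in> energy_ball (C\<^sup>2)"
proof -
  assume \<psi>: "\<psi> \<in> sobolev" and C: "norm (flat \<psi> - imag \<psi>) \<le> C"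
  have "(\<Sum>n\<in>F. sq_weight n * (norm (Rep_hil \<psi> n))\<^sup>2) \<le> C\<^sup>2" if "finite F" for F
    using sum_norm_le_norm_hil[OF that, of "flat \<psi> - imag \<psi>"] power_mono[OF C, of 2]
    by (simp add: norm_Rep_flat_imag[OF \<psi>])
  then show ?thesis by (simp add: energy_ball_def)
qed

lemma flat_sobolev_diff: "\<psi> \<in> sobolev \<Longrightarrow> \<phi> \<in> sobolev \<Longrightarrow> flat (\<psi> - \<phi>) = flat \<psi> - flat \<phi>"
  by (simp add: flat_def sobolev_diff spin_op_diff sum_subtractf)

lemma flat_grading: "\<psi> \<in> sobolev \<Longrightarrow> flat (grading \<psi>) = - grading (flat \<psi>)"
  by (simp add: flat_def sobolev_grading linear_sum[OF grading_spin_linear] grading_gamma sum_negf)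

lemma flat_imag: "\<psi> \<in> sobolev \<Longrightarrow> flat (imag \<psi>) = imag (flat \<psi>)"
  by (simp add: flat_def sobolev_spin_op spin_op_imag spin_op_sum)

lemma inner_flat:
  assumes "\<psi> \<in> sobolev" "\<phi> \<in> sobolev" shows "flat \<psi> \<bullet> \<phi> = \<psi> \<bullet> flat \<phi>"
  by (rule inner_hil_cong) (simp add: Rep_flat assms inner_symbol)

text \<open>
  Symmetry with respect to the real inner product suffices for operators that commute with \<open>\<i>\<close>.
\<close>

lemma cinner_eq: "cinner \<psi> \<phi> = Complex (\<psi> \<bullet> \<phi>) (imag \<psi> \<bullet> \<phi>)"
proof -
  have "(\<Sum>i\<in>UNIV. cnj (v $ i) * u $ i) = of_real (v \<bullet> u) + \<i> * of_real ((\<i> *s v) \<bullet> u)" for v u :: "complex^4"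
    by (rule complex_eqI)
      (auto simp: inner_vec_def inner_complex_def algebra_simps intro!: sum.cong)
  moreover have "((\<lambda>n. of_real (Rep_hil \<psi> n \<bullet> Rep_hil \<phi> n) + \<i> * of_real (Rep_hil (imag \<psi>) n \<bullet> Rep_hil \<phi> n))
      has_sum (of_real (\<psi> \<bullet> \<phi>) + \<i> * of_real (imag \<psi> \<bullet> \<phi>))) UNIV"
    by (intro has_sum_add has_sum_cmult_right has_sum_of_real inner_hil_has_sum)
  ultimately have "cinner \<psi> \<phi> = of_real (\<psi> \<bullet> \<phi>) + \<i> * of_real (imag \<psi> \<bullet> \<phi>)"
    unfolding cinner_def by (intro infsumI) (simp add: Rep_imag)
  then show ?thesis by (simp add: complex_eq_iff)
qed

text \<open>
  The properties of \<open>B = \<Sum>\<^sub>j \<gamma>\<^sup>j R\<^sub>j\<close> from which selfadjointness of \<open>D - B \<delta>\<^sub>4\<close> follows.  The last one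
  says that \<open>B\<close> commutes with every function of \<open>\<delta>\<^sub>4\<close>; it is stated coefficientwise so that it also
  covers the unbounded \<open>\<delta>\<^sub>4\<close> itself.  All of them pass to \<open>s B\<close> with real \<open>s\<close>.
\<close>

locale degree_zero_potential =
  fixes B :: "hil \<Rightarrow> hil"
  assumes bounded: "bounded_linear B"
    and symmetric: "B \<psi> \<bullet> \<phi> = \<psi> \<bullet> B \<phi>"
    and anticommutes: "B (spin_op (gamma 4) \<psi>) = - spin_op (gamma 4) (B \<psi>)"
    and odd: "B (grading \<psi>) = - grading (B \<psi>)"
    and complex_linear: "B (imag \<psi>) = imag (B \<psi>)"
    and degree_zero: "(\<And>n. Rep_hil \<phi> n = f (n $ 4) *\<^sub>R Rep_hil \<psi> n) \<Longrightarrow>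
      Rep_hil (B \<phi>) n = (f (n $ 4) :: real) *\<^sub>R Rep_hil (B \<psi>) n"
begin

interpretation B: bounded_linear B by (rule bounded)

definition twisted :: "hil \<Rightarrow> hil" where
  "twisted \<psi> = flat \<psi> - B (grad 4 \<psi>)"

lemma scale: "degree_zero_potential (\<lambda>\<psi>. s *\<^sub>R B \<psi>)"
proof (rule degree_zero_potential.intro)
  show "bounded_linear (\<lambda>\<psi>. s *\<^sub>R B \<psi>)"
    by (rule bounded_linear_compose[OF bounded_linear_scaleR_right bounded])
  show "s *\<^sub>R B (grading \<psi>) = - grading (s *\<^sub>R B \<psi>)" for \<psi>
    by (simp add: odd linear_scale[OF grading_spin_linear])
  fix \<phi> \<psi> n and f :: "int \<Rightarrow> real"
  assume "\<And>n. Rep_hil \<phi> n = f (n $ 4) *\<^sub>R Rep_hil \<psi> n"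
  then have "Rep_hil (B \<phi>) n = f (n $ 4) *\<^sub>R Rep_hil (B \<psi>) n" by (rule degree_zero)
  then show "Rep_hil (s *\<^sub>R B \<phi>) n = f (n $ 4) *\<^sub>R Rep_hil (s *\<^sub>R B \<psi>) n"
    by (simp add: Rep_hil_simps)
qed (simp_all add: symmetric anticommutes complex_linear spin_op_scaleR)

lemma Rep_B_grad_4: "\<psi> \<in> sobolev \<Longrightarrow> Rep_hil (B (grad 4 \<psi>)) n = real_of_int (n $ 4) *\<^sub>R Rep_hil (B \<psi>) n"
  by (rule degree_zero) (rule Rep_grad)

text \<open>
  The a priori estimate pairs \<open>(twisted - \<i>) \<psi>\<close> with \<open>\<gamma>\<^sup>4 \<zeta>\<close>, where \<open>\<zeta>\<close> is a truncation of
  \<open>\<delta>\<^sub>4 \<psi>\<close>.  The horizontal part anticommutes with \<open>\<gamma>\<^sup>4\<close> and preserves the degree, so it drops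
  out, as does the imaginary unit; the vertical part contributes the square of the norm of \<open>\<zeta>\<close>.
\<close>

lemma norm_truncated_degree_le:
  assumes \<psi>: "\<psi> \<in> sobolev"
  shows "norm (truncated_degree N \<psi>) \<le> norm (twisted \<psi> - imag \<psi>)"
proof -
  let ?c = "\<lambda>k::int. if \<bar>k\<bar> \<le> int N then real_of_int k else 0"
  define \<zeta> where "\<zeta> = truncated_degree N \<psi>"
  let ?G = "spin_op (gamma 4)"
  have \<zeta>: "Rep_hil \<zeta> n = ?c (n $ 4) *\<^sub>R Rep_hil \<psi> n" for n
    by (simp add: \<zeta>_def truncated_degree.rep_eq)
  have G: "Rep_hil (?G \<zeta>) n = ?c (n $ 4) *\<^sub>R (gamma 4 *v Rep_hil \<psi> n)" for n
    by (simp add: Rep_hil_simps(6) \<zeta> matrix_vector_scaleR)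
  have sq: "?c k * real_of_int k = ?c k * ?c k" for k by simp
  have "flat \<psi> \<bullet> ?G \<zeta> = \<zeta> \<bullet> \<zeta>"
  proof (rule inner_hil_cong)
    fix n
    let ?v = "Rep_hil \<psi> n"
    have "(gamma 4 *v ?v) \<bullet> (gamma 4 *v ?v) = ?v \<bullet> ?v"
      by (simp add: inner_gamma matrix_vector_mul_assoc gamma_gamma)
    then have "symbol n ?v \<bullet> (gamma 4 *v ?v) = real_of_int (n $ 4) * (?v \<bullet> ?v)"
      by (simp add: symbol_def sum_UNIV_4 inner_add_left inner_gamma_gamma)
    then have "Rep_hil (flat \<psi>) n \<bullet> Rep_hil (?G \<zeta>) n = (?c (n $ 4) * real_of_int (n $ 4)) * (?v \<bullet> ?v)"
      by (simp only: Rep_flat[OF \<psi>] G inner_scaleR_right mult.assoc)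
    then show "Rep_hil (flat \<psi>) n \<bullet> Rep_hil (?G \<zeta>) n = Rep_hil \<zeta> n \<bullet> Rep_hil \<zeta> n"
      unfolding sq by (simp only: \<zeta> inner_scaleR_right inner_scaleR_left mult.assoc)
  qed
  moreover have "B (grad 4 \<psi>) \<bullet> ?G \<zeta> = 0"
  proof -
    have B\<zeta>: "Rep_hil (B \<zeta>) n = ?c (n $ 4) *\<^sub>R Rep_hil (B \<psi>) n" for n
      by (rule degree_zero) (rule \<zeta>)
    have "B (grad 4 \<psi>) \<bullet> ?G \<zeta> = B \<zeta> \<bullet> ?G \<zeta>"
    proof (rule inner_hil_cong)
      fix n
      have "Rep_hil (B (grad 4 \<psi>)) n \<bullet> Rep_hil (?G \<zeta>) n =
          (?c (n $ 4) * real_of_int (n $ 4)) * (Rep_hil (B \<psi>) n \<bullet> (gamma 4 *v Rep_hil \<psi> n))"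
        by (simp only: Rep_B_grad_4[OF \<psi>] G inner_scaleR_right inner_scaleR_left mult.assoc)
      then show "Rep_hil (B (grad 4 \<psi>)) n \<bullet> Rep_hil (?G \<zeta>) n = Rep_hil (B \<zeta>) n \<bullet> Rep_hil (?G \<zeta>) n"
        unfolding sq by (simp only: B\<zeta> G inner_scaleR_right inner_scaleR_left mult.assoc)
    qed
    also have "B \<zeta> \<bullet> ?G \<zeta> = 0"
    proof -
      have "B \<zeta> \<bullet> ?G \<zeta> = \<zeta> \<bullet> B (?G \<zeta>)" by (rule symmetric)
      also have "\<dots> = - (?G \<zeta> \<bullet> B \<zeta>)" by (simp add: anticommutes inner_spin_gamma)
      finally show ?thesis by (simp add: inner_commute)
    qed
    finally show ?thesis .
  qed
  moreover have "imag \<psi> \<bullet> ?G \<zeta> = 0"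
  proof (rule inner_hil_zeroI)
    fix n
    let ?v = "Rep_hil \<psi> n"
    have "(\<i> *s ?v) \<bullet> (gamma 4 *v ?v) = - (?v \<bullet> (\<i> *s (gamma 4 *v ?v)))" by (rule inner_imaginary)
    moreover have "(\<i> *s ?v) \<bullet> (gamma 4 *v ?v) = (\<i> *s (gamma 4 *v ?v)) \<bullet> ?v"
      using inner_gamma[of 4 "\<i> *s ?v" ?v] by (simp add: vector_scalar_commute)
    ultimately have "(\<i> *s ?v) \<bullet> (gamma 4 *v ?v) = 0" by (simp add: inner_commute)
    then show "Rep_hil (imag \<psi>) n \<bullet> Rep_hil (?G \<zeta>) n = 0"
      by (simp only: Rep_imag G inner_scaleR_right)
  qed
  ultimately have "(norm \<zeta>)\<^sup>2 = (twisted \<psi> - imag \<psi>) \<bullet> ?G \<zeta>"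
    by (simp add: twisted_def inner_diff_left power2_norm_eq_inner)
  also have "\<dots> \<le> norm (twisted \<psi> - imag \<psi>) * norm \<zeta>"
    using norm_cauchy_schwarz[of "twisted \<psi> - imag \<psi>" "?G \<zeta>"] by (simp add: norm_spin_gamma)
  finally have "norm \<zeta> * norm \<zeta> \<le> norm (twisted \<psi> - imag \<psi>) * norm \<zeta>"
    by (simp add: power2_eq_square)
  then show ?thesis
    unfolding \<zeta>_def[symmetric] by (cases "norm \<zeta> = 0") (simp_all add: mult_le_cancel_right)
qed

lemma norm_grad_4_le:
  assumes \<psi>: "\<psi> \<in> sobolev"
  shows "norm (grad 4 \<psi>) \<le> norm (twisted \<psi> - imag \<psi>)"
proof (rule norm_hil_leI)
  fix F :: "(int^4) set" assume F: "finite F"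
  define N where "N = (\<Sum>n\<in>F. nat \<bar>n $ 4\<bar>)"
  have N: "\<bar>n $ 4\<bar> \<le> int N" if "n \<in> F" for n
  proof -
    have "nat \<bar>n $ 4\<bar> \<le> N" unfolding N_def using that F by (intro member_le_sum) auto
    then show ?thesis by linarith
  qed
  have "(\<Sum>n\<in>F. (norm (Rep_hil (grad 4 \<psi>) n))\<^sup>2) = (\<Sum>n\<in>F. (norm (Rep_hil (truncated_degree N \<psi>) n))\<^sup>2)"
    by (intro sum.cong refl) (simp add: Rep_grad[OF \<psi>] truncated_degree.rep_eq N)
  also have "\<dots> \<le> (norm (truncated_degree N \<psi>))\<^sup>2" by (rule sum_norm_le_norm_hil[OF F])
  also have "\<dots> \<le> (norm (twisted \<psi> - imag \<psi>))\<^sup>2"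
    by (intro power_mono norm_truncated_degree_le \<psi>) simp
  finally show "(\<Sum>n\<in>F. (norm (Rep_hil (grad 4 \<psi>) n))\<^sup>2) \<le> (norm (twisted \<psi> - imag \<psi>))\<^sup>2" .
qed simp

lemma norm_flat_le:
  assumes \<psi>: "\<psi> \<in> sobolev" and C: "\<And>\<phi>. norm (B \<phi>) \<le> C * norm \<phi>" "0 \<le> C"
  shows "norm (flat \<psi> - imag \<psi>) \<le> (1 + C) * norm (twisted \<psi> - imag \<psi>)"
proof -
  have "flat \<psi> - imag \<psi> = (twisted \<psi> - imag \<psi>) + B (grad 4 \<psi>)" by (simp add: twisted_def)
  then have "norm (flat \<psi> - imag \<psi>) \<le> norm (twisted \<psi> - imag \<psi>) + norm (B (grad 4 \<psi>))"
    by (metis norm_triangle_ineq)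
  also have "norm (B (grad 4 \<psi>)) \<le> C * norm (twisted \<psi> - imag \<psi>)"
    using C(1)[of "grad 4 \<psi>"] mult_left_mono[OF norm_grad_4_le[OF \<psi>] C(2)] by linarith
  finally show ?thesis by (simp add: algebra_simps)
qed

lemma ex_bound: "\<exists>C. (\<forall>\<phi>. norm (B \<phi>) \<le> C * norm \<phi>) \<and> 0 \<le> C"
  using B.nonneg_bounded by (auto simp: mult.commute)

text \<open>
  Composing with the flat resolvent turns the family \<open>flat - s B \<delta>\<^sub>4\<close> into \<open>1 - s K\<close> with \<open>K\<close>
  bounded; the a priori estimate is uniform in \<open>s\<close>.
\<close>

lemma twisted_surjective:
  obtains \<psi> where "\<psi> \<in> sobolev" "twisted \<psi> - imag \<psi> = y"
proof -
  obtain C where C: "\<And>\<phi>. norm (B \<phi>) \<le> C * norm \<phi>" "0 \<le> C" using ex_bound by blast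
  define K where "K = (\<lambda>\<phi>. B (grad 4 (flat_resolvent \<phi>)))"
  have "bounded_linear K"
  proof (rule bounded_linear_intro[where K = C])
    fix \<psi> \<phi> and r :: real
    show "K (\<psi> + \<phi>) = K \<psi> + K \<phi>"
      by (simp add: K_def flat_resolvent_add sobolev_add sobolev_flat_resolvent B.add)
    show "K (r *\<^sub>R \<psi>) = r *\<^sub>R K \<psi>"
      by (simp add: K_def flat_resolvent_scaleR sobolev_scaleR sobolev_flat_resolvent B.scaleR)
    show "norm (K \<psi>) \<le> norm \<psi> * C"
      using C(1)[of "grad 4 (flat_resolvent \<psi>)"] mult_left_mono[OF norm_grad_flat_resolvent[of 4 \<psi>] C(2)]
      by (simp add: K_def mult.commute)
  qed
  moreover have "norm \<phi> \<le> (1 + C) * norm (\<phi> - s *\<^sub>R K \<phi>)" if s: "0 \<le> s" "s \<le> 1" for s \<phi>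
  proof -
    interpret s: degree_zero_potential "\<lambda>\<psi>. s *\<^sub>R B \<psi>" by (rule scale)
    let ?\<psi> = "flat_resolvent \<phi>"
    have "norm (s *\<^sub>R B \<xi>) \<le> C * norm \<xi>" for \<xi>
    proof -
      have "s * norm (B \<xi>) \<le> 1 * norm (B \<xi>)" using s by (intro mult_right_mono) auto
      then show ?thesis using C(1)[of \<xi>] s by simp
    qed
    from s.norm_flat_le[OF sobolev_flat_resolvent this C(2)]
    have "norm (flat ?\<psi> - imag ?\<psi>) \<le> (1 + C) * norm (s.twisted ?\<psi> - imag ?\<psi>)" .
    moreover have "s.twisted ?\<psi> - imag ?\<psi> = (flat ?\<psi> - imag ?\<psi>) - s *\<^sub>R K \<phi>"
      by (simp add: s.twisted_def K_def)
    ultimately show ?thesis by (simp only: flat_resolvent_inverse)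
  qed
  ultimately obtain \<phi> where \<phi>: "\<phi> - K \<phi> = y"
    using method_of_continuity[of K "1 + C" y] C(2) by auto
  have "twisted (flat_resolvent \<phi>) - imag (flat_resolvent \<phi>) =
      (flat (flat_resolvent \<phi>) - imag (flat_resolvent \<phi>)) - K \<phi>"
    by (simp add: twisted_def K_def)
  then have "twisted (flat_resolvent \<phi>) - imag (flat_resolvent \<phi>) = y"
    by (simp only: flat_resolvent_inverse \<phi>)
  then show ?thesis using that sobolev_flat_resolvent by blast
qed

lemma twisted_grading: "\<psi> \<in> sobolev \<Longrightarrow> twisted (grading \<psi>) = - grading (twisted \<psi>)"
  by (simp add: twisted_def flat_grading sobolev_grading odd linear_diff[OF grading_spin_linear])

lemma twisted_diff: "\<psi> \<in> sobolev \<Longrightarrow> \<phi> \<in> sobolev \<Longrightarrow> twisted (\<psi> - \<phi>) = twisted \<psi> - twisted \<phi>"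
  by (simp add: twisted_def flat_sobolev_diff sobolev_diff B.diff)

text \<open>
  The grading anticommutes with the operator and commutes with \<open>\<i>\<close>, so it exchanges the two
  imaginary shifts.
\<close>

lemma twisted_surjective_conjugate:
  obtains \<psi> where "\<psi> \<in> sobolev" "twisted \<psi> + imag \<psi> = y"
proof -
  obtain \<psi> where \<psi>: "\<psi> \<in> sobolev" "twisted \<psi> - imag \<psi> = - grading y" by (rule twisted_surjective)
  have "imag (grading \<psi>) = grading (imag \<psi>)" by (simp add: grading_def spin_op_imag)
  then have "twisted (grading \<psi>) + imag (grading \<psi>) = - grading (twisted \<psi> - imag \<psi>)"
    by (simp add: twisted_grading[OF \<psi>(1)] linear_diff[OF grading_spin_linear])
  also have "\<dots> = y"
    by (simp add: \<psi>(2) linear_neg[OF grading_spin_linear] grading_grading)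
  finally show ?thesis using that sobolev_grading(1)[OF \<psi>(1)] by blast
qed

lemma twisted_injective:
  assumes "\<psi> \<in> sobolev" "\<phi> \<in> sobolev" "twisted \<psi> - imag \<psi> = twisted \<phi> - imag \<phi>"
  shows "\<psi> = \<phi>"
proof -
  let ?d = "\<psi> - \<phi>"
  have d: "?d \<in> sobolev" using assms by (simp add: sobolev_diff)
  have z: "twisted ?d - imag ?d = 0"
    using assms by (simp add: twisted_diff spin_op_diff algebra_simps)
  obtain C where C: "\<And>\<phi>. norm (B \<phi>) \<le> C * norm \<phi>" "0 \<le> C" using ex_bound by blast
  from norm_flat_le[OF d C] have "flat ?d - imag ?d = 0" by (simp add: z)
  then have "sq_weight n * (norm (Rep_hil ?d n))\<^sup>2 = 0" for n
    using norm_Rep_flat_imag[OF d, of n] by (simp add: Rep_hil_simps(1))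
  then have "Rep_hil ?d n = 0" for n
    using sq_weight_pos[of n] by (metis less_irrefl mult_eq_0_iff norm_eq_zero power_eq_0_iff)
  then have "?d = 0" by (intro hil_eqI) (simp add: Rep_hil_simps(1))
  then show ?thesis by simp
qed

lemma inner_twisted:
  assumes \<psi>: "\<psi> \<in> sobolev" and \<phi>: "\<phi> \<in> sobolev"
  shows "twisted \<psi> \<bullet> \<phi> = \<psi> \<bullet> twisted \<phi>"
proof -
  have "B (grad 4 \<psi>) \<bullet> \<phi> = grad 4 \<psi> \<bullet> B \<phi>" by (rule symmetric)
  also have "\<dots> = \<psi> \<bullet> B (grad 4 \<phi>)"
    by (rule inner_hil_cong) (simp add: Rep_grad[OF \<psi>] Rep_B_grad_4[OF \<phi>])
  finally show ?thesis by (simp add: twisted_def inner_diff_left inner_diff_right inner_flat \<psi> \<phi>)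
qed

lemma twisted_imag: "\<psi> \<in> sobolev \<Longrightarrow> twisted (imag \<psi>) = imag (twisted \<psi>)"
  by (simp add: twisted_def flat_imag sobolev_spin_op complex_linear spin_op_diff)

definition twisted_op :: "hil \<rightharpoonup> hil" where
  "twisted_op \<psi> = (if \<psi> \<in> sobolev then Some (twisted \<psi>) else None)"

text \<open>
  Given \<open>(\<phi>, \<xi>)\<close> in the graph of the adjoint, choose \<open>\<zeta>\<close> in the domain with
  \<open>(T - \<i>) \<zeta> = \<xi> - \<i> \<phi>\<close>.  Then \<open>\<phi> - \<zeta>\<close> is orthogonal to the range of \<open>T + \<i>\<close>, which is everything.
\<close>

lemma selfadjoint_twisted_op: "selfadjoint twisted_op"
  unfolding selfadjoint_def
proof (intro conjI allI iffI)
  have "dom twisted_op = sobolev" by (auto simp: twisted_op_def dom_def split: if_splits)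
  then show "closure (dom twisted_op) = UNIV" by (simp add: closure_sobolev)
next
  fix \<phi> \<xi> \<psi> \<kappa>
  assume "twisted_op \<phi> = Some \<xi>"
  then have \<phi>: "\<phi> \<in> sobolev" "\<xi> = twisted \<phi>" by (auto simp: twisted_op_def split: if_splits)
  show "twisted_op \<psi> = Some \<kappa> \<longrightarrow> cinner \<phi> \<kappa> = cinner \<xi> \<psi>"
  proof
    assume "twisted_op \<psi> = Some \<kappa>"
    then have \<psi>: "\<psi> \<in> sobolev" "\<kappa> = twisted \<psi>" by (auto simp: twisted_op_def split: if_splits)
    show "cinner \<phi> \<kappa> = cinner \<xi> \<psi>"
      using inner_twisted[OF \<phi>(1) \<psi>(1)] inner_twisted[OF sobolev_spin_op(1)[OF \<phi>(1)] \<psi>(1), of "mat \<i>"]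
      by (simp add: cinner_eq \<phi>(2) \<psi>(2) twisted_imag[OF \<phi>(1)])
  qed
next
  fix \<phi> \<xi>
  assume adj: "\<forall>\<psi> \<kappa>. twisted_op \<psi> = Some \<kappa> \<longrightarrow> cinner \<phi> \<kappa> = cinner \<xi> \<psi>"
  have adj: "\<phi> \<bullet> twisted \<psi> = \<xi> \<bullet> \<psi>" if "\<psi> \<in> sobolev" for \<psi>
    using adj[rule_format, of \<psi> "twisted \<psi>"] that by (simp add: twisted_op_def cinner_eq)
  obtain \<zeta> where \<zeta>: "\<zeta> \<in> sobolev" "twisted \<zeta> - imag \<zeta> = \<xi> - imag \<phi>" by (rule twisted_surjective)
  obtain \<psi> where \<psi>: "\<psi> \<in> sobolev" "twisted \<psi> + imag \<psi> = \<phi> - \<zeta>" by (rule twisted_surjective_conjugate)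
  have im: "\<alpha> \<bullet> imag \<psi> = - (imag \<alpha> \<bullet> \<psi>)" for \<alpha> by (simp add: inner_imag)
  have "(\<phi> - \<zeta>) \<bullet> (\<phi> - \<zeta>) = (\<phi> - \<zeta>) \<bullet> (twisted \<psi> + imag \<psi>)" by (simp only: \<psi>(2))
  also have "\<dots> = ((\<xi> - imag \<phi>) - (twisted \<zeta> - imag \<zeta>)) \<bullet> \<psi>"
    by (simp add: inner_diff_left inner_add_right adj[OF \<psi>(1)] inner_twisted[OF \<zeta>(1) \<psi>(1)] im spin_op_diff)
  also have "\<dots> = 0" by (simp add: \<zeta>(2))
  finally have "\<phi> = \<zeta>" by simp
  then show "twisted_op \<phi> = Some \<xi>" using \<zeta> by (simp add: twisted_op_def)
qed

lemma compact_resolvent_twisted_op: "compact_resolvent twisted_op"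
proof -
  define R where "R = (\<lambda>\<phi>. THE \<psi>. \<psi> \<in> sobolev \<and> twisted \<psi> - imag \<psi> = \<phi>)"
  have R: "R \<phi> = \<psi> \<longleftrightarrow> \<psi> \<in> sobolev \<and> twisted \<psi> - imag \<psi> = \<phi>" for \<phi> \<psi>
  proof -
    obtain \<psi>' where \<psi>': "\<psi>' \<in> sobolev" "twisted \<psi>' - imag \<psi>' = \<phi>" by (rule twisted_surjective)
    then have "R \<phi> = \<psi>'" unfolding R_def using twisted_injective by (intro the_equality) auto
    then show ?thesis using \<psi>' twisted_injective by auto
  qed
  obtain C where C: "\<And>\<phi>. norm (B \<phi>) \<le> C * norm \<phi>" "0 \<le> C" using ex_bound by blast
  have "R ` cball 0 1 \<subseteq> energy_ball ((1 + C)\<^sup>2)"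
  proof
    fix \<psi> assume "\<psi> \<in> R ` cball 0 1"
    then obtain \<phi> where \<phi>: "norm \<phi> \<le> 1" "R \<phi> = \<psi>" by auto
    then have \<psi>: "\<psi> \<in> sobolev" "twisted \<psi> - imag \<psi> = \<phi>" using R by auto
    have "norm (flat \<psi> - imag \<psi>) \<le> (1 + C) * norm \<phi>"
      using norm_flat_le[OF \<psi>(1) C] by (simp only: \<psi>(2))
    also have "\<dots> \<le> (1 + C) * 1" using \<phi>(1) C(2) by (intro mult_left_mono) auto
    finally show "\<psi> \<in> energy_ball ((1 + C)\<^sup>2)" using energy_ballI[OF \<psi>(1)] by simp
  qed
  then have "closure (R ` cball 0 1) \<subseteq> energy_ball ((1 + C)\<^sup>2)"
    by (intro closure_minimal compact_imp_closed compact_energy_ball)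
  then have "energy_ball ((1 + C)\<^sup>2) \<inter> closure (R ` cball 0 1) = closure (R ` cball 0 1)" by auto
  moreover have "compact (energy_ball ((1 + C)\<^sup>2) \<inter> closure (R ` cball 0 1))"
    by (intro compact_Int_closed compact_energy_ball closed_closure)
  ultimately have "compact (closure (R ` cball 0 1))" by simp
  moreover have "\<forall>\<phi> \<psi>. R \<phi> = \<psi> \<longleftrightarrow> (\<exists>\<kappa>. twisted_op \<psi> = Some \<kappa> \<and> \<kappa> - imag \<psi> = \<phi>)"
    unfolding R by (auto simp: twisted_op_def)
  ultimately show ?thesis unfolding compact_resolvent_def by blast
qed

end

section \<open>The Dirac operators of selfadjoint connections\<close>

context
  fixes \<theta> :: "real^4^4" and w :: "4 \<Rightarrow> int^4 \<Rightarrow> complex"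
  assumes skew: "transpose \<theta> = - \<theta>"
    and w: "\<And>j. w j \<in> base" and selfadj: "\<And>j. star (w j) = w j"
begin

definition potential :: "hil \<Rightarrow> hil" where
  "potential \<psi> = (\<Sum>j\<in>{1, 2, 3}. spin_op (gamma j) (lmult (transpose \<theta>) (w j) \<psi>))"

lemma abs_summable_w: "abs_summable (w j)"
  by (rule smooth_abs_summable[OF homog_smooth[OF w]])

text \<open>
  A base element is supported in degree zero, so its translations do not change the degree.
\<close>

lemma lmult_degree_zero:
  assumes "\<And>n. Rep_hil \<phi> n = f (n $ 4) *\<^sub>R Rep_hil \<psi> n"
  shows "Rep_hil (lmult \<theta>' (w j) \<phi>) n = f (n $ 4) *\<^sub>R Rep_hil (lmult \<theta>' (w j) \<psi>) n"
proof (rule has_sum_unique[OF Rep_lmult_has_sum[OF abs_summable_w]])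
  have "(w j m * cis (pi * theta_form \<theta>' m (n - m))) *s Rep_hil \<phi> (n - m) =
      f (n $ 4) *\<^sub>R ((w j m * cis (pi * theta_form \<theta>' m (n - m))) *s Rep_hil \<psi> (n - m))" for m
  proof (cases "m $ 4 = 0")
    case True
    then show ?thesis by (simp add: assms smult_scaleR)
  next
    case False
    then have "w j m = 0" using w[of j] by (simp add: homog_iff)
    then show ?thesis by simp
  qed
  then show "((\<lambda>m. (w j m * cis (pi * theta_form \<theta>' m (n - m))) *s Rep_hil \<phi> (n - m)) has_sum
      f (n $ 4) *\<^sub>R Rep_hil (lmult \<theta>' (w j) \<psi>) n) UNIV"
    using has_sum_scaleR[OF Rep_lmult_has_sum[OF abs_summable_w[of j], of \<theta>' n \<psi>], of "f (n $ 4)"] by simp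
qed

lemma degree_zero_potential: "degree_zero_potential potential"
proof (rule degree_zero_potential.intro)
  show "bounded_linear potential"
    unfolding potential_def[abs_def]
    by (intro bounded_linear_sum bounded_linear_compose[OF bounded_linear_spin_op bounded_linear_lmult] abs_summable_w)
  have skew': "transpose (transpose \<theta>) = - transpose \<theta>"
    by (simp only: transpose_transpose) (simp add: skew)
  fix \<psi> \<phi> n
  show "potential \<psi> \<bullet> \<phi> = \<psi> \<bullet> potential \<phi>"
    using inner_lmult[OF skew' abs_summable_w]
    by (simp add: potential_def inner_sum_left inner_sum_right inner_spin_gamma selfadj lmult_spin_op abs_summable_w
        inner_add_left inner_add_right)
  have "spin_op (gamma j) (spin_op (gamma 4) \<xi>) = - spin_op (gamma 4) (spin_op (gamma j) \<xi>)"
    if "j \<in> {1, 2, 3}" for j \<xi>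
    by (rule spin_gamma_anticommute) (use that in auto)
  then show "potential (spin_op (gamma 4) \<psi>) = - spin_op (gamma 4) (potential \<psi>)"
    by (simp add: potential_def lmult_spin_op[OF abs_summable_w] spin_op_add spin_op_minus)
  show "potential (grading \<psi>) = - grading (potential \<psi>)"
  proof -
    have "lmult (transpose \<theta>) (w j) (grading \<psi>) = grading (lmult (transpose \<theta>) (w j) \<psi>)" for j
      unfolding grading_def by (rule lmult_spin_op[OF abs_summable_w])
    moreover have "spin_op (gamma j) (grading \<xi>) = - grading (spin_op (gamma j) \<xi>)" for j \<xi>
      by (simp add: grading_gamma)
    ultimately show ?thesis
      by (simp add: potential_def linear_add[OF grading_spin_linear])
  qed
  show "potential (imag \<psi>) = imag (potential \<psi>)"
    by (simp add: potential_def lmult_spin_op[OF abs_summable_w] spin_op_imag spin_op_add)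
  fix f :: "int \<Rightarrow> real"
  assume "\<And>n. Rep_hil \<phi> n = f (n $ 4) *\<^sub>R Rep_hil \<psi> n"
  then have "Rep_hil (lmult (transpose \<theta>) (w j) \<phi>) n = f (n $ 4) *\<^sub>R Rep_hil (lmult (transpose \<theta>) (w j) \<psi>) n" for j
    by (rule lmult_degree_zero)
  then show "Rep_hil (potential \<phi>) n = f (n $ 4) *\<^sub>R Rep_hil (potential \<psi>) n"
    by (simp add: potential_def Rep_hil_simps matrix_vector_scaleR scaleR_add_right)
qed

interpretation P: degree_zero_potential potential by (rule degree_zero_potential)

lemma full_dirac_eq_twisted: "full_dirac \<theta> w \<psi> = P.twisted \<psi>"
  by (simp add: full_dirac_def horizontal_def P.twisted_def flat_def sum_UNIV_4 potential_def
      rmult_eq_lmult_fun[OF skew homog_smooth[OF w]] spin_op_diff algebra_simps)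

lemma dirac_operator_full_dirac:
  "dirac_operator \<theta> (\<lambda>\<psi>. if \<psi> \<in> sobolev then Some (full_dirac \<theta> w \<psi>) else None)"
proof -
  have "dirac_operator \<theta> P.twisted_op"
    unfolding dirac_operator_def
  proof (intro conjI ballI allI impI)
    show "selfadjoint P.twisted_op" by (rule P.selfadjoint_twisted_op)
    show "compact_resolvent P.twisted_op" by (rule P.compact_resolvent_twisted_op)
    show "P.twisted_op (grading \<psi>) = Some (- grading \<phi>)" if "P.twisted_op \<psi> = Some \<phi>" for \<psi> \<phi>
      using that by (auto simp: P.twisted_op_def sobolev_grading P.twisted_grading split: if_splits)
    fix a :: "int^4 \<Rightarrow> complex" assume a: "a \<in> smooth"
    note sa = smooth_abs_summable[OF a]
    let ?X = "\<lambda>\<psi>. one_form \<theta> (\<lambda>j. der j a) \<psi> - potential (lmult \<theta> (der 4 a) \<psi>)"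
    have "bounded_linear ?X"
      by (intro bounded_linear_sub bounded_linear_one_form smooth_der a
          bounded_linear_compose[OF P.bounded bounded_linear_lmult] smooth_abs_summable)
    moreover have "P.twisted_op (lmult \<theta> a \<psi>) = Some (lmult \<theta> a \<phi> + ?X \<psi>)" if "P.twisted_op \<psi> = Some \<phi>" for \<psi> \<phi>
    proof -
      have \<psi>: "\<psi> \<in> sobolev" "\<phi> = P.twisted \<psi>" using that by (auto simp: P.twisted_op_def split: if_splits)
      have pot: "potential (lmult \<theta> a \<xi>) = lmult \<theta> a (potential \<xi>)" for \<xi>
        by (simp add: potential_def linear_add[OF linear_lmult[OF a]] lmult_spin_op[OF sa]
            lmult_commute_opposite[OF skew sa abs_summable_w])
      have fl: "flat (lmult \<theta> a \<psi>) = lmult \<theta> a (flat \<psi>) + one_form \<theta> (\<lambda>j. der j a) \<psi>"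
        by (simp add: flat_def one_form_def sobolev_lmult[OF a \<psi>(1)] spin_op_add sum.distrib
            linear_sum[OF linear_lmult[OF a]] lmult_spin_op[OF sa])
      show ?thesis
        using sobolev_lmult[OF a \<psi>(1)]
        by (simp add: P.twisted_op_def P.twisted_def \<psi>(2) fl pot linear_diff[OF linear_lmult[OF a]]
            linear_add[OF bounded_linear.linear[OF P.bounded]])
    qed
    ultimately show "\<exists>X. has_comm P.twisted_op (lmult \<theta> a) X"
      unfolding has_comm_def by (intro exI[of _ ?X]) simp
  qed
  moreover have "P.twisted_op = (\<lambda>\<psi>. if \<psi> \<in> sobolev then Some (full_dirac \<theta> w \<psi>) else None)"
    by (simp add: fun_eq_iff P.twisted_op_def full_dirac_eq_twisted)
  ultimately show ?thesis by simp
qed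

end

theorem corollary6p10:
  fixes \<theta> :: "real^4^4"
  assumes "generic_theta \<theta>"
  shows "(\<forall>\<omega>. strong_connection \<theta> \<omega> \<and> compatible \<theta> flatD \<omega> \<longleftrightarrow> \<omega> = spin_op (gamma 4)) \<and>
    (\<forall>w :: 4 \<Rightarrow> int^4 \<Rightarrow> complex.
       (\<forall>j\<in>{1, 2, 3}. w j \<in> base \<and> star (w j) = w j) \<longrightarrow>
       strong_connection \<theta> (connection_form \<theta> w) \<longrightarrow>
       selfadjoint (Some \<circ> connection_form \<theta> w) \<longrightarrow>
       compatible \<theta> (connection_dirac \<theta> w) (connection_form \<theta> w))"
proof (intro conjI allI impI iffI; (elim conjE)?)
  have skew: "transpose \<theta> = - \<theta>" using assms by (simp add: generic_theta_def)
  have zero: "(\<lambda>n. 0) \<in> base" "star (\<lambda>n. 0) = (\<lambda>n. 0)"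
    by (simp_all add: homog_iff smooth_zero star_def fun_eq_iff)
  {
    fix \<omega> assume "strong_connection \<theta> \<omega>" "compatible \<theta> flatD \<omega>"
    then obtain w where w: "\<And>j. w j \<in> base" "\<omega> = connection_form \<theta> w" by (auto elim: strong_connectionD)
    then have "w j = (\<lambda>n. 0)" if "j \<in> {1, 2, 3}" for j
      using compatible_flatD_imp_zero[OF skew w(1) _ that] \<open>compatible \<theta> flatD \<omega>\<close> by simp
    then show "\<omega> = spin_op (gamma 4)"
      by (intro ext) (simp add: w(2) connection_form_def lmult_zero spin_op_zero)
  }
  {
    fix \<omega> assume \<omega>: "\<omega> = spin_op (gamma 4)"
    show "strong_connection \<theta> \<omega>" unfolding \<omega> by (rule strong_connection_gamma_4[OF skew])
    have "dirac_operator \<theta> flatD"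
      using dirac_operator_full_dirac[OF skew zero] by (simp flip: flatD_eq_full_dirac[OF skew])
    then show "compatible \<theta> flatD \<omega>"
      unfolding \<omega> gamma_4_eq_connection_form[of \<theta>]
      by (intro compatible_connection_form[OF skew zero(1)] flatD_eq_full_dirac[OF skew])
  }
  fix w :: "4 \<Rightarrow> int^4 \<Rightarrow> complex"
  assume w: "\<forall>j\<in>{1, 2, 3}. w j \<in> base \<and> star (w j) = w j"
  \<comment> \<open>All four coefficients become selfadjoint base elements; the connection form and its Dirac
    operator are built from the first three.\<close>
  define w' where "w' = w(4 := (\<lambda>n. 0))"
  have w': "w' j \<in> base" "star (w' j) = w' j" for j
    using w exhaust_4[of j] zero by (auto simp: w'_def)
  have "full_dirac \<theta> w = full_dirac \<theta> w'"
    by (simp add: fun_eq_iff full_dirac_def horizontal_def w'_def)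
  moreover have "connection_dirac \<theta> w \<psi> = (if \<psi> \<in> sobolev then Some (full_dirac \<theta> w \<psi>) else None)" for \<psi>
    by (rule connection_dirac_eq) (use w in blast)
  ultimately have D: "connection_dirac \<theta> w \<psi> = (if \<psi> \<in> sobolev then Some (full_dirac \<theta> w' \<psi>) else None)" for \<psi>
    by simp
  have "connection_dirac \<theta> w = (\<lambda>\<psi>. if \<psi> \<in> sobolev then Some (full_dirac \<theta> w' \<psi>) else None)"
    using D by (rule ext)
  then have "dirac_operator \<theta> (connection_dirac \<theta> w)"
    using dirac_operator_full_dirac[of \<theta> w', OF skew w'] by simp
  then have "compatible \<theta> (connection_dirac \<theta> w) (connection_form \<theta> w')"
    by (intro compatible_connection_form[OF skew] w' D)
  moreover have "connection_form \<theta> w' = connection_form \<theta> w"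
    by (simp add: fun_eq_iff connection_form_def w'_def)
  ultimately show "compatible \<theta> (connection_dirac \<theta> w) (connection_form \<theta> w)" by simp
qed

end
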